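(* Let $H$ be a tubular group with (VRC). Then $H$ has a normal subgroup $G$ of finite index such that $G \cong F_n \rtimes \mathbb{Z}$, where $F_n$ is the free group of rank $n$, for some $n \in \mathbb{N}$.
   Context: A subgroup $H$ of a group $G$ is a virtual retract of $G$ if there is a finite index subgroup $K$ of $G$ such that $H \subseteq K$ and there is a homomorphism $\rho: K \to H$ whose restriction to $H$ is the identity map. A group has property (VRC) if every cyclic subgroup is a virtual retract. $\mathbb{N}$ denotes the positive integers. A tubular group is the fundamental group of a non-empty finite graph of groups where all vertex groups are free abelian of rank $2$ and all edge groups are infinite cyclic. Here graphs are in the sense of Serre: a graph $\Gamma$ has a vertex set $V\Gamma$, an edge set $E\Gamma$, an inversion map $e \mapsto \overline{e}$ on $E\Gamma$ with $\overline{e} \ne e$ and $\overline{\overline{e}} = e$, and incidence maps $\alpha,\omega: E\Gamma \to V\Gamma$ with $\omega(\overline{e}) = \alpha(e)$. An orientation is a decomposition $E\Gamma = E\Gamma^+ \sqcup E\Gamma^-$ with $E\Gamma^- = \{\overline{e} \mid e \in E\Gamma^+\}$. A finite graph of groups $(\mathcal{G},\Gamma)$ consists of a non-empty finite connected graph $\Gamma$, vertex groups $G_v$ ($v \in V\Gamma$), edge groups $G_e$ ($e \in E\Gamma$) with $G_e = G_{\overline{e}}$, and monomorphisms $\alpha_e: G_e \to G_{\alpha(e)}$ ($e \in E\Gamma$); put $\omega_e := \alpha_{\overline{e}}: G_e \to G_{\omega(e)}$. Given a maximal tree $T$ in $\Gamma$ and an orientation, its fundamental group is the group generated by all $G_v$,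 $v \in V\Gamma$, and free letters $t_e$, $e \in E\Gamma^+$, subject to the relations of the vertex groups, $t_e\, \omega_e(a)\, t_e^{-1} = \alpha_e(a)$ for all $e \in E\Gamma^+$, $a \in G_e$, and $t_f = 1$ for all $f \in ET \cap E\Gamma^+$; up to isomorphism it does not depend on the choices. *)

theory Defs
  imports "HOL-Algebra.Free_Abelian_Groups" "HOL-Algebra.Bij"
begin

section \<open>Group presentations and free groups\<close>

text \<open>A word over an alphabet \<open>X\<close> is a list of signed letters; \<open>(x, True)\<close> stands for \<open>x\<close> and
  \<open>(x, False)\<close> for its formal inverse. A relation \<open>u = v\<close> is a pair \<open>(u, v)\<close> of words.\<close>

definition signed_words :: "'a set \<Rightarrow> ('a \<times> bool) list set" where
  "signed_words X = lists (X \<times> UNIV)"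

inductive_set presentation_rel ::
  "'a set \<Rightarrow> (('a \<times> bool) list \<times> ('a \<times> bool) list) set \<Rightarrow>
   (('a \<times> bool) list \<times> ('a \<times> bool) list) set"
  for X R where
  refl: "w \<in> signed_words X \<Longrightarrow> (w, w) \<in> presentation_rel X R"
| sym: "(u, v) \<in> presentation_rel X R \<Longrightarrow> (v, u) \<in> presentation_rel X R"
| trans: "\<lbrakk>(u, v) \<in> presentation_rel X R; (v, w) \<in> presentation_rel X R\<rbrakk>
    \<Longrightarrow> (u, w) \<in> presentation_rel X R"
| cancel: "\<lbrakk>u \<in> signed_words X; v \<in> signed_words X; x \<in> X\<rbrakk>
    \<Longrightarrow> (u @ [(x, b), (x, \<not> b)] @ v, u @ v) \<in> presentation_rel X R"
| relation: "\<lbrakk>(l, r) \<in> R; u @ l @ v \<in> signed_words X; u @ r @ v \<in> signed_words X\<rbrakk>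
    \<Longrightarrow> (u @ l @ v, u @ r @ v) \<in> presentation_rel X R"

definition presented_group ::
  "'a set \<Rightarrow> (('a \<times> bool) list \<times> ('a \<times> bool) list) set \<Rightarrow> ('a \<times> bool) list set monoid" where
  "presented_group X R =
    \<lparr>carrier = signed_words X // presentation_rel X R,
     mult = (\<lambda>A B. \<Union>a\<in>A. \<Union>b\<in>B. presentation_rel X R `` {a @ b}),
     one = presentation_rel X R `` {[]}\<rparr>"

definition free_group_of_rank :: "nat \<Rightarrow> (nat \<times> bool) list set monoid" where
  "free_group_of_rank n = presented_group {..<n} {}"

lemma presentation_rel_words:
  assumes "(u, v) \<in> presentation_rel X R"
  shows "u \<in> signed_words X \<and> v \<in> signed_words X"
  using assms by induction (auto simp: signed_words_def)

lemma presentation_rel_context: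
  assumes "(u, v) \<in> presentation_rel X R" "p \<in> signed_words X" "q \<in> signed_words X"
  shows "(p @ u @ q, p @ v @ q) \<in> presentation_rel X R"
  using assms
proof induction
  case (refl w)
  then show ?case
    by (intro presentation_rel.refl) (auto simp: signed_words_def)
next
  case (sym u v)
  then show ?case
    by (blast intro: presentation_rel.sym)
next
  case (trans u v w)
  then show ?case
    by (blast intro: presentation_rel.trans)
next
  case (cancel u v x b)
  then show ?case
    using presentation_rel.cancel[of "p @ u" X "v @ q" x b R] by (simp add: signed_words_def)
next
  case (relation l r u v)
  then show ?case
    using presentation_rel.relation[of l r R "p @ u" "v @ q" X] by (simp add: signed_words_def)
qed

lemma equiv_presentation_rel: "equiv (signed_words X) (presentation_rel X R)"
proof (rule equivI)
  show "presentation_rel X R \<subseteq> signed_words X \<times> signed_words X"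
    using presentation_rel_words by fast
  show "refl_on (signed_words X) (presentation_rel X R)"
    by (simp add: refl_on_def presentation_rel.refl)
  show "Relation.sym (presentation_rel X R)"
    by (auto intro: symI presentation_rel.sym)
  show "Relation.trans (presentation_rel X R)"
    by (auto intro: transI presentation_rel.trans)
qed

lemma presentation_rel_append:
  assumes "(u, u') \<in> presentation_rel X R" "(v, v') \<in> presentation_rel X R"
  shows "(u @ v, u' @ v') \<in> presentation_rel X R"
proof -
  have "(u @ v, u' @ v) \<in> presentation_rel X R"
    using presentation_rel_context[OF assms(1), of "[]" v] presentation_rel_words[OF assms(2)]
    by (simp add: signed_words_def)
  moreover have "(u' @ v, u' @ v') \<in> presentation_rel X R"
    using presentation_rel_context[OF assms(2), of u' "[]"] presentation_rel_words[OF assms(1)]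
    by (simp add: signed_words_def)
  ultimately show ?thesis
    by (rule presentation_rel.trans)
qed

lemma presented_group_mult:
  assumes "u \<in> signed_words X" "v \<in> signed_words X"
  shows "presentation_rel X R `` {u} \<otimes>\<^bsub>presented_group X R\<^esub> presentation_rel X R `` {v} =
    presentation_rel X R `` {u @ v}"
proof -
  have "congruent2 (presentation_rel X R) (presentation_rel X R)
      (\<lambda>a b. presentation_rel X R `` {a @ b})"
    by (intro congruent2I' equiv_class_eq[OF equiv_presentation_rel] presentation_rel_append)
  then show ?thesis
    using UN_equiv_class2[OF equiv_presentation_rel equiv_presentation_rel _ assms]
    by (simp add: presented_group_def)
qed

lemma presentation_rel_inverse:
  assumes "w \<in> signed_words X"
  shows "(rev (map (\<lambda>(x, b). (x, \<not> b)) w) @ w, []) \<in> presentation_rel X R"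
  using assms
proof (induction w)
  case Nil
  show ?case
    by (simp add: presentation_rel.refl signed_words_def)
next
  case (Cons y w)
  obtain x b where y: "y = (x, b)" by fastforce
  let ?i = "rev (map (\<lambda>(x, b). (x, \<not> b)) w)"
  have w: "w \<in> signed_words X" "x \<in> X"
    using Cons.prems y by (auto simp: signed_words_def)
  then have "?i \<in> signed_words X"
    by (auto simp: signed_words_def)
  then have "(?i @ [(x, \<not> b), (x, \<not> \<not> b)] @ w, ?i @ w) \<in> presentation_rel X R"
    using w by (intro presentation_rel.cancel)
  from presentation_rel.trans[OF this Cons.IH[OF w(1)]] show ?case
    using y by simp
qed

lemma group_presented_group: "group (presented_group X R)"
proof (rule groupI)
  let ?G = "presented_group X R" and ?r = "presentation_rel X R"
  have car: "A \<in> carrier ?G \<longleftrightarrow> (\<exists>w\<in>signed_words X. A = ?r `` {w})" for A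
    by (auto simp: presented_group_def quotient_def)
  have one: "\<one>\<^bsub>?G\<^esub> = ?r `` {[]}" and nil: "[] \<in> signed_words X"
    by (auto simp: presented_group_def signed_words_def)
  have app: "u @ v \<in> signed_words X" if "u \<in> signed_words X" "v \<in> signed_words X" for u v
    using that by (auto simp: signed_words_def)
  show "\<one>\<^bsub>?G\<^esub> \<in> carrier ?G"
    using car one nil by blast
  show "A \<otimes>\<^bsub>?G\<^esub> B \<in> carrier ?G" if "A \<in> carrier ?G" "B \<in> carrier ?G" for A B
    using that app by (auto simp: car presented_group_mult)
  show "A \<otimes>\<^bsub>?G\<^esub> B \<otimes>\<^bsub>?G\<^esub> C = A \<otimes>\<^bsub>?G\<^esub> (B \<otimes>\<^bsub>?G\<^esub> C)"
    if "A \<in> carrier ?G" "B \<in> carrier ?G" "C \<in> carrier ?G" for A B C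
    using that app by (auto simp: car presented_group_mult)
  show "\<one>\<^bsub>?G\<^esub> \<otimes>\<^bsub>?G\<^esub> A = A" if "A \<in> carrier ?G" for A
    using that nil by (auto simp: car one presented_group_mult)
  show "\<exists>B\<in>carrier ?G. B \<otimes>\<^bsub>?G\<^esub> A = \<one>\<^bsub>?G\<^esub>" if A: "A \<in> carrier ?G" for A
  proof -
    obtain w where w: "w \<in> signed_words X" "A = ?r `` {w}"
      using A unfolding car by blast
    let ?i = "rev (map (\<lambda>(x, b). (x, \<not> b)) w)"
    have i: "?i \<in> signed_words X"
      using w by (auto simp: signed_words_def)
    have "?r `` {?i} \<otimes>\<^bsub>?G\<^esub> A = \<one>\<^bsub>?G\<^esub>"
      using equiv_class_eq[OF equiv_presentation_rel presentation_rel_inverse[OF w(1)]]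
      by (simp only: w(2) one presented_group_mult[OF i w(1)])
    moreover have "?r `` {?i} \<in> carrier ?G"
      using i unfolding car by (intro bexI[of _ ?i] HOL.refl)
    ultimately show ?thesis
      by (intro bexI)
  qed
qed


section \<open>Semidirect products\<close>

text \<open>Here \<open>\<phi>\<close> is meant to be a homomorphism from \<open>Q\<close> to \<open>AutoGroup N\<close>.\<close>

definition semidirect_product ::
  "('a, 'm) monoid_scheme \<Rightarrow> ('b, 'n) monoid_scheme \<Rightarrow> ('b \<Rightarrow> 'a \<Rightarrow> 'a) \<Rightarrow> ('a \<times> 'b) monoid" where
  "semidirect_product N Q \<phi> =
    \<lparr>carrier = carrier N \<times> carrier Q,
     mult = (\<lambda>(a, q) (b, s). (a \<otimes>\<^bsub>N\<^esub> \<phi> q b, q \<otimes>\<^bsub>Q\<^esub> s)),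
     one = (\<one>\<^bsub>N\<^esub>, \<one>\<^bsub>Q\<^esub>)\<rparr>"

lemma group_semidirect_product:
  assumes N: "group N" and Q: "group Q" and \<phi>: "\<phi> \<in> hom Q (AutoGroup N)"
  shows "group (semidirect_product N Q \<phi>)"
proof -
  interpret N: group N by fact
  interpret Q: group Q by fact
  interpret A: group "AutoGroup N" by (rule N.AutoGroup)
  interpret h: group_hom Q "AutoGroup N" \<phi>
    using \<phi> by unfold_locales
  have auto: "\<phi> q \<in> hom N N" "\<phi> q \<in> Bij (carrier N)" if "q \<in> carrier Q" for q
    using h.hom_closed[OF that] by (auto simp: AutoGroup_def auto_def)
  have closed: "\<phi> q a \<in> carrier N" if "q \<in> carrier Q" "a \<in> carrier N" for q a
    using auto(1)[OF that(1)] that(2) by (auto simp: hom_def)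
  have mult: "\<phi> q (a \<otimes>\<^bsub>N\<^esub> b) = \<phi> q a \<otimes>\<^bsub>N\<^esub> \<phi> q b"
    if "q \<in> carrier Q" "a \<in> carrier N" "b \<in> carrier N" for q a b
    using auto(1)[OF that(1)] that(2,3) by (auto simp: hom_def)
  have comp: "\<phi> (q \<otimes>\<^bsub>Q\<^esub> s) a = \<phi> q (\<phi> s a)"
    if "q \<in> carrier Q" "s \<in> carrier Q" "a \<in> carrier N" for q s a
    using h.hom_mult[OF that(1,2)] auto(2)[OF that(1)] auto(2)[OF that(2)] that(3)
    by (simp add: AutoGroup_def BijGroup_def compose_def)
  have one: "\<phi> \<one>\<^bsub>Q\<^esub> a = a" if "a \<in> carrier N" for a
    using h.hom_one that by (simp add: AutoGroup_def BijGroup_def)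
  show ?thesis
  proof (rule groupI)
    fix x assume "x \<in> carrier (semidirect_product N Q \<phi>)"
    then obtain a q where x: "x = (a, q)" "a \<in> carrier N" "q \<in> carrier Q"
      by (auto simp: semidirect_product_def)
    show "\<exists>y\<in>carrier (semidirect_product N Q \<phi>).
        y \<otimes>\<^bsub>semidirect_product N Q \<phi>\<^esub> x = \<one>\<^bsub>semidirect_product N Q \<phi>\<^esub>"
      by (rule bexI[where x = "(inv\<^bsub>N\<^esub> \<phi> (inv\<^bsub>Q\<^esub> q) a, inv\<^bsub>Q\<^esub> q)"])
        (use x closed in \<open>auto simp: semidirect_product_def simp del: h.hom_inv\<close>)
  qed (auto simp: semidirect_product_def closed mult comp one N.m_assoc Q.m_assoc
      simp del: h.hom_mult h.hom_one)
qed


section \<open>Virtual retracts\<close>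

definition virtual_retract :: "'a set \<Rightarrow> ('a, 'm) monoid_scheme \<Rightarrow> bool" where
  "virtual_retract H G \<longleftrightarrow> subgroup H G \<and>
    (\<exists>K. subgroup K G \<and> finite (rcosets\<^bsub>G\<^esub> K) \<and> H \<subseteq> K \<and>
      (\<exists>\<rho> \<in> hom (G\<lparr>carrier := K\<rparr>) (G\<lparr>carrier := H\<rparr>). \<forall>h\<in>H. \<rho> h = h))"

definition property_VRC :: "('a, 'm) monoid_scheme \<Rightarrow> bool" where
  "property_VRC G \<longleftrightarrow>
    (\<forall>C. subgroup C G \<and> cyclic_group (G\<lparr>carrier := C\<rparr>) \<longrightarrow> virtual_retract C G)"


section \<open>Graphs in the sense of Serre\<close>

record ('v, 'e) serre_graph =
  verts :: "'v set"
  edges :: "'e set"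
  rev_edge :: "'e \<Rightarrow> 'e"
  src :: "'e \<Rightarrow> 'v"
  tgt :: "'e \<Rightarrow> 'v"

definition serre_graph :: "('v, 'e, 'z) serre_graph_scheme \<Rightarrow> bool" where
  "serre_graph \<Gamma> \<longleftrightarrow>
    (\<forall>e\<in>edges \<Gamma>. rev_edge \<Gamma> e \<in> edges \<Gamma> \<and> rev_edge \<Gamma> e \<noteq> e \<and> rev_edge \<Gamma> (rev_edge \<Gamma> e) = e \<and>
      src \<Gamma> e \<in> verts \<Gamma> \<and> tgt \<Gamma> e \<in> verts \<Gamma> \<and> tgt \<Gamma> (rev_edge \<Gamma> e) = src \<Gamma> e)"

fun edge_path :: "('v, 'e, 'z) serre_graph_scheme \<Rightarrow> 'v \<Rightarrow> 'e list \<Rightarrow> 'v \<Rightarrow> bool" where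
  "edge_path \<Gamma> u [] v \<longleftrightarrow> u \<in> verts \<Gamma> \<and> u = v"
| "edge_path \<Gamma> u (e # es) v \<longleftrightarrow> e \<in> edges \<Gamma> \<and> src \<Gamma> e = u \<and> edge_path \<Gamma> (tgt \<Gamma> e) es v"

definition connected_graph :: "('v, 'e, 'z) serre_graph_scheme \<Rightarrow> bool" where
  "connected_graph \<Gamma> \<longleftrightarrow> (\<forall>u\<in>verts \<Gamma>. \<forall>v\<in>verts \<Gamma>. \<exists>es. edge_path \<Gamma> u es v)"

definition reduced_path :: "('v, 'e, 'z) serre_graph_scheme \<Rightarrow> 'e list \<Rightarrow> bool" where
  "reduced_path \<Gamma> es \<longleftrightarrow> successively (\<lambda>e f. f \<noteq> rev_edge \<Gamma> e) es"

definition tree :: "('v, 'e, 'z) serre_graph_scheme \<Rightarrow> bool" where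
  "tree \<Gamma> \<longleftrightarrow> serre_graph \<Gamma> \<and> verts \<Gamma> \<noteq> {} \<and> connected_graph \<Gamma> \<and>
    \<not> (\<exists>v es. es \<noteq> [] \<and> edge_path \<Gamma> v es v \<and> reduced_path \<Gamma> es)"

definition subgraph ::
  "('v, 'e, 'y) serre_graph_scheme \<Rightarrow> ('v, 'e, 'z) serre_graph_scheme \<Rightarrow> bool" where
  "subgraph \<Delta> \<Gamma> \<longleftrightarrow> serre_graph \<Delta> \<and> verts \<Delta> \<subseteq> verts \<Gamma> \<and> edges \<Delta> \<subseteq> edges \<Gamma> \<and>
    (\<forall>e\<in>edges \<Delta>. rev_edge \<Delta> e = rev_edge \<Gamma> e \<and> src \<Delta> e = src \<Gamma> e \<and> tgt \<Delta> e = tgt \<Gamma> e)"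

definition maximal_tree ::
  "('v, 'e) serre_graph \<Rightarrow> ('v, 'e, 'z) serre_graph_scheme \<Rightarrow> bool" where
  "maximal_tree T \<Gamma> \<longleftrightarrow> subgraph T \<Gamma> \<and> tree T \<and>
    (\<forall>T' :: ('v, 'e) serre_graph. subgraph T' \<Gamma> \<and> tree T' \<and> subgraph T T' \<longrightarrow>
      verts T' = verts T \<and> edges T' = edges T)"

text \<open>An orientation is given by its set \<open>P\<close> of positive edges.\<close>

definition orientation :: "'e set \<Rightarrow> ('v, 'e, 'z) serre_graph_scheme \<Rightarrow> bool" where
  "orientation P \<Gamma> \<longleftrightarrow> edges \<Gamma> = P \<union> rev_edge \<Gamma> ` P \<and> P \<inter> rev_edge \<Gamma> ` P = {}"


section \<open>Graphs of groups and tubular groups\<close>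

text \<open>\<open>emb \<G> e\<close> is the monomorphism from the edge group of \<open>e\<close> to the vertex group of the source
  of \<open>e\<close>; the one to the vertex group of the target is \<open>emb \<G> (rev_edge \<G> e)\<close>. That all vertex
  groups share the type \<open>'g\<close>, and all edge groups the type \<open>'c\<close>, loses no generality, since any
  family of groups can be embedded in one type.\<close>

record ('v, 'e, 'g, 'c) graph_of_groups = "('v, 'e) serre_graph" +
  vgroup :: "'v \<Rightarrow> 'g monoid"
  egroup :: "'e \<Rightarrow> 'c monoid"
  emb :: "'e \<Rightarrow> 'c \<Rightarrow> 'g"

definition finite_graph_of_groups :: "('v, 'e, 'g, 'c) graph_of_groups \<Rightarrow> bool" where
  "finite_graph_of_groups \<G> \<longleftrightarrow>
    serre_graph \<G> \<and> verts \<G> \<noteq> {} \<and> finite (verts \<G>) \<and> finite (edges \<G>) \<and> connected_graph \<G> \<and>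
    (\<forall>v\<in>verts \<G>. group (vgroup \<G> v)) \<and>
    (\<forall>e\<in>edges \<G>. group (egroup \<G> e) \<and> egroup \<G> (rev_edge \<G> e) = egroup \<G> e \<and>
      emb \<G> e \<in> mon (egroup \<G> e) (vgroup \<G> (src \<G> e)))"

datatype ('v, 'e, 'g) pi1_generator = Vertex_Elt 'v 'g | Free_Letter 'e

definition pi1_generators ::
  "('v, 'e, 'g, 'c) graph_of_groups \<Rightarrow> 'e set \<Rightarrow> ('v, 'e, 'g) pi1_generator set" where
  "pi1_generators \<G> P =
    {Vertex_Elt v a | v a. v \<in> verts \<G> \<and> a \<in> carrier (vgroup \<G> v)} \<union> {Free_Letter e | e. e \<in> P}"

definition pi1_relations ::
  "('v, 'e, 'g, 'c) graph_of_groups \<Rightarrow> ('v, 'e) serre_graph \<Rightarrow> 'e set \<Rightarrow>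
   ((('v, 'e, 'g) pi1_generator \<times> bool) list \<times> (('v, 'e, 'g) pi1_generator \<times> bool) list) set" where
  "pi1_relations \<G> T P =
    {([(Vertex_Elt v a, True), (Vertex_Elt v b, True)], [(Vertex_Elt v (a \<otimes>\<^bsub>vgroup \<G> v\<^esub> b), True)])
      | v a b. v \<in> verts \<G> \<and> a \<in> carrier (vgroup \<G> v) \<and> b \<in> carrier (vgroup \<G> v)} \<union>
    {([(Free_Letter e, True), (Vertex_Elt (tgt \<G> e) (emb \<G> (rev_edge \<G> e) c), True),
       (Free_Letter e, False)],
      [(Vertex_Elt (src \<G> e) (emb \<G> e c), True)])
      | e c. e \<in> P \<and> c \<in> carrier (egroup \<G> e)} \<union>
    {([(Free_Letter f, True)], []) | f. f \<in> edges T \<inter> P}"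

definition fundamental_group ::
  "('v, 'e, 'g, 'c) graph_of_groups \<Rightarrow> ('v, 'e) serre_graph \<Rightarrow> 'e set \<Rightarrow>
   (('v, 'e, 'g) pi1_generator \<times> bool) list set monoid" where
  "fundamental_group \<G> T P = presented_group (pi1_generators \<G> P) (pi1_relations \<G> T P)"

definition tubular_graph_of_groups :: "('v, 'e, 'g, 'c) graph_of_groups \<Rightarrow> bool" where
  "tubular_graph_of_groups \<G> \<longleftrightarrow> finite_graph_of_groups \<G> \<and>
    (\<forall>v\<in>verts \<G>. vgroup \<G> v \<cong> free_Abelian_group {..<2::nat}) \<and>
    (\<forall>e\<in>edges \<G>. cyclic_group (egroup \<G> e) \<and> infinite (carrier (egroup \<G> e)))"

text \<open>A tubular group is one for which such data exist. The graph of groups is a parameter only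
  because its type variables cannot be quantified existentially.\<close>

definition tubular_group_via ::
  "('v, 'e, 'g, 'c) graph_of_groups \<Rightarrow> ('h, 'm) monoid_scheme \<Rightarrow> bool" where
  "tubular_group_via \<G> H \<longleftrightarrow> group H \<and> tubular_graph_of_groups \<G> \<and>
    (\<exists>T P. maximal_tree T \<G> \<and> orientation P \<G> \<and> H \<cong> fundamental_group \<G> T P)"

end

theory Submission
  imports Defs "HOL-Library.Product_Plus"
begin

text \<open>By (VRC) every edge generator, and some element of every vertex group, is mapped to a nonzero
  integer by a homomorphism defined on a finite-index subgroup of \<open>H\<close>; a generic integral combination
  of conjugates of these is a homomorphism \<open>f\<close> from a normal subgroup \<open>K\<close> of finite index onto \<open>\<int>\<close>
  that vanishes on no nontrivial element of \<open>K\<close> conjugate into an edge group. So \<open>K\<close> is the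
  semidirect product of \<open>N = ker f\<close> and \<open>\<int>\<close>. On the Bass--Serre tree, \<open>N\<close> acts with trivial edge
  stabilizers, infinite cyclic vertex stabilizers and finite quotient, so it is free of finite rank.
  The tree is avoided by working with \<open>\<Omega> = H / N\<close>: the vertices and edges of the quotient graph are the
  orbits on \<open>\<Omega>\<close> of the vertex and edge groups, a basis of \<open>N\<close> is given by one element for each vertex
  and one for each edge outside a spanning tree, and the inverse of the resulting map from the free
  group comes from a cocycle on \<open>\<Omega>\<close>.\<close>

section \<open>Homomorphisms out of presented groups\<close>

text \<open>The obstacle that shapes the argument is that \<open>N\<close> is a subgroup of a
  presented group: maps out of \<open>H\<close> can be prescribed on generators, maps out of
  \<open>N\<close> cannot. The map from \<open>N\<close> back to the free group is therefore the
  restriction of a cocycle defined on all of \<open>H\<close>, that is, of a homomorphism from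
  \<open>H\<close> to a permutational wreath product; this takes the place of Reidemeister-Schreier
  rewriting. \<open>N\<close> is normal in \<open>K\<close> but need not be normal in
  \<open>H\<close>, so the point stabilizers on \<Omega> are the conjugates of \<open>N\<close>.
  This is why \<open>f\<close> has to be nonzero on all conjugates of the chosen elements; as
  \<open>f\<close> is invariant under conjugation by \<open>K\<close>, only finitely many conjugates
  matter. Since \<open>f\<close> is defined on \<open>K\<close> only, the conditions are imposed on
  \<open>M\<close>-th powers, where \<open>M\<close> is an exponent that takes all of
  \<open>H\<close> into \<open>K\<close>. (VRC) gives a homomorphism to \<int> only for an element
  of infinite order, so the vertex groups must be known to embed in \<open>H\<close> beforehand. An
  action of \<open>H\<close> by permutations shows this without normal forms.\<close>

definition (in monoid) word_eval :: "('x \<Rightarrow> 'a) \<Rightarrow> ('x \<times> bool) list \<Rightarrow> 'a" where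
  "word_eval f w = foldr (\<lambda>(x, b) y. (if b then f x else inv (f x)) \<otimes> y) w \<one>"

context group
begin

lemma word_eval_Nil [simp]: "word_eval f [] = \<one>"
  by (simp add: word_eval_def)

lemma word_eval_Cons [simp]:
  "word_eval f ((x, b) # w) = (if b then f x else inv (f x)) \<otimes> word_eval f w"
  by (simp add: word_eval_def)

lemma word_eval_closed:
  assumes "f \<in> X \<rightarrow> carrier G" "w \<in> signed_words X"
  shows "word_eval f w \<in> carrier G"
  using assms(2) by (induction w) (use assms(1) in \<open>auto simp: signed_words_def Pi_iff\<close>)

lemma word_eval_append:
  assumes "f \<in> X \<rightarrow> carrier G" "u \<in> signed_words X" "v \<in> signed_words X"
  shows "word_eval f (u @ v) = word_eval f u \<otimes> word_eval f v"
  using assms(2)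
proof (induction u)
  case Nil
  then show ?case using word_eval_closed[OF assms(1,3)] by simp
next
  case (Cons a u)
  obtain x b where a: "a = (x, b)" by fastforce
  have "x \<in> X" "u \<in> signed_words X" using Cons.prems a by (auto simp: signed_words_def)
  moreover from this have "f x \<in> carrier G" using assms(1) by auto
  ultimately show ?case
    using Cons.IH word_eval_closed[OF assms(1,3)] word_eval_closed[OF assms(1)] a
    by (simp add: m_assoc)
qed

lemma word_eval_presentation_rel:
  assumes f: "f \<in> X \<rightarrow> carrier G"
    and R: "\<And>l r. (l, r) \<in> R \<Longrightarrow> l \<in> signed_words X \<Longrightarrow> r \<in> signed_words X \<Longrightarrow>
      word_eval f l = word_eval f r"
    and "(u, v) \<in> presentation_rel X R"
  shows "word_eval f u = word_eval f v"
  using assms(3)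
proof induction
  case (cancel u v x b)
  have "f x \<in> carrier G" using cancel f by auto
  then have "word_eval f ([(x, b), (x, \<not> b)] @ v) = word_eval f v"
    using word_eval_closed[OF f cancel(2)] by (cases b) (simp_all add: m_assoc[symmetric])
  moreover have "[(x, b), (x, \<not> b)] @ v \<in> signed_words X"
    using cancel by (auto simp: signed_words_def)
  ultimately show ?case
    using cancel by (simp only: word_eval_append[OF f])
next
  case (relation l r u v)
  have *: "u \<in> signed_words X" "v \<in> signed_words X" "l \<in> signed_words X" "r \<in> signed_words X"
    "l @ v \<in> signed_words X" "r @ v \<in> signed_words X"
    using relation by (auto simp: signed_words_def)
  show ?case
    using R[OF relation(1)] * by (simp only: word_eval_append[OF f])
qed auto

end

definition generator_class ::
  "'a set \<Rightarrow> (('a \<times> bool) list \<times> ('a \<times> bool) list) set \<Rightarrow> 'a \<Rightarrow> ('a \<times> bool) list set" where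
  "generator_class X R x = presentation_rel X R `` {[(x, True)]}"

lemma presented_group_carrier:
  "A \<in> carrier (presented_group X R) \<longleftrightarrow> (\<exists>w\<in>signed_words X. A = presentation_rel X R `` {w})"
  by (auto simp: presented_group_def quotient_def)

lemma presented_group_one: "\<one>\<^bsub>presented_group X R\<^esub> = presentation_rel X R `` {[]}"
  by (simp add: presented_group_def)

lemma generator_class_closed: "x \<in> X \<Longrightarrow> generator_class X R x \<in> carrier (presented_group X R)"
  unfolding presented_group_carrier generator_class_def
  by (intro bexI[of _ "[(x, True)]"]) (auto simp: signed_words_def)

text \<open>Von Dyck's theorem: evaluation of words is constant on the classes of
  \<open>presentation_rel\<close>. A pair in \<open>R\<close> is only ever applied when both of its
  sides are words over \<open>X\<close>, so nothing is asked of other pairs.\<close>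

lemma (in group) presented_group_lift:
  assumes f: "f \<in> X \<rightarrow> carrier G"
    and R: "\<And>l r. (l, r) \<in> R \<Longrightarrow> l \<in> signed_words X \<Longrightarrow> r \<in> signed_words X \<Longrightarrow>
      word_eval f l = word_eval f r"
  obtains \<Phi> where "\<Phi> \<in> hom (presented_group X R) G" "\<And>x. x \<in> X \<Longrightarrow> \<Phi> (generator_class X R x) = f x"
proof
  define \<Phi> where "\<Phi> A = the_elem (word_eval f ` A)" for A
  have \<Phi>: "\<Phi> (presentation_rel X R `` {w}) = word_eval f w" if "w \<in> signed_words X" for w
  proof -
    have "word_eval f v = word_eval f w" if "(w, v) \<in> presentation_rel X R" for v
      using word_eval_presentation_rel[OF f R that] by simp
    then have "word_eval f ` (presentation_rel X R `` {w}) = {word_eval f w}"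
      using presentation_rel.refl[OF that, of R] by blast
    then show ?thesis by (simp add: \<Phi>_def)
  qed
  show "\<Phi> \<in> hom (presented_group X R) G"
  proof (rule homI)
    fix A assume "A \<in> carrier (presented_group X R)"
    then show "\<Phi> A \<in> carrier G"
      using \<Phi> word_eval_closed[OF f] by (auto simp: presented_group_carrier)
  next
    fix A B assume "A \<in> carrier (presented_group X R)" "B \<in> carrier (presented_group X R)"
    then obtain u v where uv: "u \<in> signed_words X" "v \<in> signed_words X"
      "A = presentation_rel X R `` {u}" "B = presentation_rel X R `` {v}"
      by (auto simp: presented_group_carrier)
    moreover have "u @ v \<in> signed_words X" using uv by (auto simp: signed_words_def)
    ultimately show "\<Phi> (A \<otimes>\<^bsub>presented_group X R\<^esub> B) = \<Phi> A \<otimes> \<Phi> B"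
      by (simp add: presented_group_mult \<Phi> word_eval_append[OF f])
  qed
  show "\<Phi> (generator_class X R x) = f x" if "x \<in> X" for x
    using \<Phi>[of "[(x, True)]"] that funcset_mem[OF f that]
    by (simp add: generator_class_def signed_words_def)
qed

text \<open>Translates between formal words and products in the presented group; in particular it
  turns pairs in \<open>R\<close> into equations between generators.\<close>

lemma generator_class_relation:
  assumes "w \<in> signed_words X"
  shows "monoid.word_eval (presented_group X R) (generator_class X R) w = presentation_rel X R `` {w}"
proof -
  interpret L: group "presented_group X R" by (rule group_presented_group)
  show ?thesis
    using assms
  proof (induction w)
    case Nil
    then show ?case by (simp add: presented_group_one)
  next
    case (Cons a w)
    obtain x b where a: "a = (x, b)" by fastforce
    have x: "x \<in> X" "w \<in> signed_words X" using Cons.prems a by (auto simp: signed_words_def)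
    have s: "[(x, True)] \<in> signed_words X" "[(x, False)] \<in> signed_words X" "[] \<in> signed_words X"
      using x by (auto simp: signed_words_def)
    have "presentation_rel X R `` {[(x, False)]} \<otimes>\<^bsub>presented_group X R\<^esub> generator_class X R x
        = \<one>\<^bsub>presented_group X R\<^esub>"
      unfolding generator_class_def presented_group_mult[OF s(2,1)] presented_group_one
      using presentation_rel.cancel[OF s(3) s(3) x(1), of False R]
      by (simp add: equiv_class_eq[OF equiv_presentation_rel])
    moreover have "presentation_rel X R `` {[(x, False)]} \<in> carrier (presented_group X R)"
      using s by (auto simp: presented_group_carrier)
    ultimately have i: "inv\<^bsub>presented_group X R\<^esub> generator_class X R x = presentation_rel X R `` {[(x, False)]}"
      using generator_class_closed[OF x(1)] L.inv_equality by blast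
    show ?case
      using Cons.IH[OF x(2)] x s presented_group_mult[OF s(1) x(2), of R] presented_group_mult[OF s(2) x(2), of R]
      by (cases b) (simp_all add: a i, simp add: generator_class_def)
  qed
qed

lemma presented_group_relation:
  assumes "(l, r) \<in> R" "l \<in> signed_words X" "r \<in> signed_words X"
  shows "monoid.word_eval (presented_group X R) (generator_class X R) l =
    monoid.word_eval (presented_group X R) (generator_class X R) r"
  using presentation_rel.relation[of l r R "[]" "[]" X] assms
  by (simp add: generator_class_relation equiv_class_eq[OF equiv_presentation_rel])

lemma presented_group_generated:
  assumes B: "subgroup B (presented_group X R)" and gen: "\<And>x. x \<in> X \<Longrightarrow> generator_class X R x \<in> B"
  shows "B = carrier (presented_group X R)"
proof -
  interpret L: group "presented_group X R" by (rule group_presented_group)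
  have "monoid.word_eval (presented_group X R) (generator_class X R) w \<in> B" if "w \<in> signed_words X" for w
    using that
  proof (induction w)
    case Nil
    then show ?case using subgroup.one_closed[OF B] by simp
  next
    case (Cons a w)
    obtain x b where a: "a = (x, b)" by fastforce
    have x: "x \<in> X" "w \<in> signed_words X" using Cons.prems a by (auto simp: signed_words_def)
    then show ?case
      using Cons.IH gen subgroup.m_closed[OF B] subgroup.m_inv_closed[OF B] a by simp
  qed
  then show ?thesis
    using subgroup.subset[OF B] by (auto simp: generator_class_relation presented_group_carrier)
qed

text \<open>The equalizer of two homomorphisms is a subgroup, so it is everything once it contains
  the generators.\<close>

lemma hom_eq_on_generators:
  assumes "group L" "\<Phi> \<in> hom (presented_group X R) L" "\<Psi> \<in> hom (presented_group X R) L"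
    and "\<And>x. x \<in> X \<Longrightarrow> \<Phi> (generator_class X R x) = \<Psi> (generator_class X R x)"
    and "A \<in> carrier (presented_group X R)"
  shows "\<Phi> A = \<Psi> A"
proof -
  interpret G: group "presented_group X R" by (rule group_presented_group)
  interpret L: group L by fact
  interpret \<Phi>: group_hom "presented_group X R" L \<Phi> using assms(2) by unfold_locales
  interpret \<Psi>: group_hom "presented_group X R" L \<Psi> using assms(3) by unfold_locales
  have "subgroup {A \<in> carrier (presented_group X R). \<Phi> A = \<Psi> A} (presented_group X R)"
    by (rule G.subgroupI) auto
  from presented_group_generated[OF this] show ?thesis
    using assms(4,5) generator_class_closed[of _ X R] by blast
qed

lemma (in group) free_group_lift:
  assumes "f \<in> {..<n} \<rightarrow> carrier G"
  obtains \<Phi> where "\<Phi> \<in> hom (free_group_of_rank n) G"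
    "\<And>k. k < n \<Longrightarrow> \<Phi> (generator_class {..<n} {} k) = f k"
proof -
  show thesis
    by (rule presented_group_lift[of f "{..<n}" "{}"]) (use assms that in \<open>auto simp: free_group_of_rank_def\<close>)
qed

section \<open>Trees\<close>

lemma edge_path_append:
  "edge_path \<Gamma> u (p @ q) v \<longleftrightarrow> (\<exists>x. edge_path \<Gamma> u p x \<and> edge_path \<Gamma> x q v)"
  if "serre_graph \<Gamma>"
proof (induction p arbitrary: u)
  case Nil
  have "edge_path \<Gamma> u q v \<Longrightarrow> u \<in> verts \<Gamma>"
    using that by (cases q) (auto simp: serre_graph_def)
  then show ?case by auto
qed auto

lemma edge_path_verts:
  assumes "serre_graph \<Gamma>" "edge_path \<Gamma> u p v"
  shows "u \<in> verts \<Gamma>" "v \<in> verts \<Gamma>"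
  using assms(2) by (induction p arbitrary: u) (use assms(1) in \<open>auto simp: serre_graph_def\<close>)

lemma serre_graph_src_rev:
  "serre_graph \<Gamma> \<Longrightarrow> e \<in> edges \<Gamma> \<Longrightarrow> src \<Gamma> (rev_edge \<Gamma> e) = tgt \<Gamma> e"
  unfolding serre_graph_def by metis

lemma edge_path_reverse:
  assumes "serre_graph \<Gamma>" "edge_path \<Gamma> u p v"
  shows "edge_path \<Gamma> v (rev (map (rev_edge \<Gamma>) p)) u"
  using assms(2)
proof (induction p arbitrary: u)
  case (Cons e p)
  then have e: "e \<in> edges \<Gamma>" "src \<Gamma> e = u" "edge_path \<Gamma> (tgt \<Gamma> e) p v" by auto
  have "edge_path \<Gamma> (tgt \<Gamma> e) [rev_edge \<Gamma> e] u"
    using e assms(1) by (auto simp: serre_graph_src_rev) (auto simp: serre_graph_def)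
  then show ?case
    using Cons.IH[OF e(3)] by (auto simp: edge_path_append[OF assms(1)] simp del: edge_path.simps)
qed auto

lemma not_reduced_path:
  assumes "\<not> reduced_path \<Gamma> es"
  obtains p e q where "es = p @ e # rev_edge \<Gamma> e # q"
proof -
  have "\<exists>p e q. es = p @ e # rev_edge \<Gamma> e # q"
    using assms unfolding reduced_path_def
  proof (induction es rule: induct_list012)
    case (3 x y zs)
    show ?case
    proof (cases "y = rev_edge \<Gamma> x")
      case True
      then show ?thesis by (intro exI[of _ "[]"]) auto
    next
      case False
      then obtain p e q where "y # zs = p @ e # rev_edge \<Gamma> e # q"
        using 3 by auto
      then show ?thesis by (intro exI[of _ "x # p"]) auto
    qed
  qed auto
  then show thesis using that by blast
qed

text \<open>Backtracking can be removed from a closed path in a tree until nothing is left, so the product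
  of the labels along a path depends on its end points only.\<close>

lemma tree_potential:
  fixes \<Gamma> :: "('v, 'e, 'z) serre_graph_scheme"
  assumes \<Gamma>: "tree \<Gamma>" and "group L" and d: "\<And>e. e \<in> edges \<Gamma> \<Longrightarrow> d e \<in> carrier L"
    and d_rev: "\<And>e. e \<in> edges \<Gamma> \<Longrightarrow> d (rev_edge \<Gamma> e) = inv\<^bsub>L\<^esub> d e" and v0: "v0 \<in> verts \<Gamma>"
  obtains u where "u \<in> verts \<Gamma> \<rightarrow> carrier L" "u v0 = \<one>\<^bsub>L\<^esub>"
    "\<And>e. e \<in> edges \<Gamma> \<Longrightarrow> u (src \<Gamma> e) \<otimes>\<^bsub>L\<^esub> d e = u (tgt \<Gamma> e)"
proof -
  interpret L: group L by fact
  have serre: "serre_graph \<Gamma>" using \<Gamma> by (simp add: tree_def)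
  define pp where "pp es = foldr (\<lambda>e y. d e \<otimes>\<^bsub>L\<^esub> y) es \<one>\<^bsub>L\<^esub>" for es
  have pp_simps [simp]: "pp [] = \<one>\<^bsub>L\<^esub>" "pp (e # es) = d e \<otimes>\<^bsub>L\<^esub> pp es" for e es
    by (auto simp: pp_def)
  have pp_closed: "pp es \<in> carrier L" if "set es \<subseteq> edges \<Gamma>" for es
    using that by (induction es) (use d in auto)
  have path_edges: "set es \<subseteq> edges \<Gamma>" if "edge_path \<Gamma> x es y" for x es y
    using that by (induction es arbitrary: x) auto
  have pp_app: "pp (p @ q) = pp p \<otimes>\<^bsub>L\<^esub> pp q" if "set p \<subseteq> edges \<Gamma>" "set q \<subseteq> edges \<Gamma>" for p q
    using that by (induction p) (use d pp_closed in \<open>auto simp: L.m_assoc\<close>)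
  have rev_in: "rev_edge \<Gamma> e \<in> edges \<Gamma>" if "e \<in> edges \<Gamma>" for e
    using that serre by (auto simp: serre_graph_def)
  have pp_rev: "pp (rev (map (rev_edge \<Gamma>) p)) = inv\<^bsub>L\<^esub> pp p" if "set p \<subseteq> edges \<Gamma>" for p
    using that
  proof (induction p)
    case (Cons e p)
    then have "set (rev (map (rev_edge \<Gamma>) p)) \<subseteq> edges \<Gamma>" "set [rev_edge \<Gamma> e] \<subseteq> edges \<Gamma>"
      using rev_in by auto
    from pp_app[OF this] show ?case
      using Cons d d_rev pp_closed rev_in by (auto simp: L.inv_mult_group)
  qed auto
  have closed_path: "pp es = \<one>\<^bsub>L\<^esub>" if "edge_path \<Gamma> x es x" for x es
    using that
  proof (induction es rule: length_induct)
    case (1 es)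
    show ?case
    proof (cases "es = []")
      case False
      then have "\<not> reduced_path \<Gamma> es"
        using \<Gamma> 1 unfolding tree_def by blast
      then obtain p e q where es: "es = p @ e # rev_edge \<Gamma> e # q" by (rule not_reduced_path)
      then have e: "set p \<subseteq> edges \<Gamma>" "e \<in> edges \<Gamma>" "set q \<subseteq> edges \<Gamma>"
        using path_edges[OF 1(2)] by auto
      have "tgt \<Gamma> (rev_edge \<Gamma> e) = src \<Gamma> e" using e serre by (auto simp: serre_graph_def)
      then have "edge_path \<Gamma> x (p @ q) x"
        using 1(2) unfolding es by (auto simp: edge_path_append[OF serre])
      then have "pp (p @ q) = \<one>\<^bsub>L\<^esub>"
        using 1(1) es by auto
      moreover have "pp es = pp (p @ q)"
        using e d d_rev[OF e(2)] rev_in[OF e(2)] pp_closed unfolding es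
        by (simp add: pp_app L.m_assoc[symmetric])
      ultimately show ?thesis by simp
    qed auto
  qed
  define \<pi> where "\<pi> v = (SOME es. edge_path \<Gamma> v0 es v)" for v
  have \<pi>: "edge_path \<Gamma> v0 (\<pi> v) v" if "v \<in> verts \<Gamma>" for v
    unfolding \<pi>_def by (rule someI_ex) (use \<Gamma> v0 that in \<open>auto simp: tree_def connected_graph_def\<close>)
  show thesis
  proof
    show "(\<lambda>v. pp (\<pi> v)) \<in> verts \<Gamma> \<rightarrow> carrier L"
      using \<pi> path_edges pp_closed by blast
    show "pp (\<pi> v0) = \<one>\<^bsub>L\<^esub>" using \<pi> v0 closed_path by blast
    fix e assume e: "e \<in> edges \<Gamma>"
    then have v: "src \<Gamma> e \<in> verts \<Gamma>" "tgt \<Gamma> e \<in> verts \<Gamma>"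
      using serre by (auto simp: serre_graph_def)
    \<comment> \<open>The loop out to the source of \<open>e\<close>, across \<open>e\<close>, and
      back from its target. That its product is trivial is the claimed equation.\<close>
    let ?c = "(\<pi> (src \<Gamma> e) @ [e]) @ rev (map (rev_edge \<Gamma>) (\<pi> (tgt \<Gamma> e)))"
    have "edge_path \<Gamma> v0 (\<pi> (src \<Gamma> e) @ [e]) (tgt \<Gamma> e)"
      using \<pi>[OF v(1)] e v by (auto simp: edge_path_append[OF serre])
    then have "edge_path \<Gamma> v0 ?c v0"
      using edge_path_reverse[OF serre \<pi>[OF v(2)]] unfolding edge_path_append[OF serre, of _ "_ @ [e]"] by blast
    from closed_path[OF this] have "pp (\<pi> (src \<Gamma> e)) \<otimes>\<^bsub>L\<^esub> d e \<otimes>\<^bsub>L\<^esub> inv\<^bsub>L\<^esub> pp (\<pi> (tgt \<Gamma> e)) = \<one>\<^bsub>L\<^esub>"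
      using path_edges[OF \<pi>[OF v(1)]] path_edges[OF \<pi>[OF v(2)]] rev_in e d
      by (subst (asm) pp_app) (auto simp: pp_app pp_rev)
    then show "pp (\<pi> (src \<Gamma> e)) \<otimes>\<^bsub>L\<^esub> d e = pp (\<pi> (tgt \<Gamma> e))"
      using pp_closed path_edges[OF \<pi>[OF v(1)]] path_edges[OF \<pi>[OF v(2)]] d[OF e]
      by (metis L.inv_closed L.inv_equality L.inv_inv L.m_closed)
  qed
qed

lemma edge_path_leaving:
  assumes "edge_path \<Gamma> u es v" "u \<in> A" "v \<notin> A"
  obtains e where "e \<in> edges \<Gamma>" "src \<Gamma> e \<in> A" "tgt \<Gamma> e \<notin> A"
  using assms by (induction es arbitrary: u) auto

lemma edge_path_mono:
  assumes "edge_path \<Gamma> u es v" "verts \<Gamma> \<subseteq> verts \<Delta>" "edges \<Gamma> \<subseteq> edges \<Delta>"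
    and "\<And>e. e \<in> edges \<Gamma> \<Longrightarrow> src \<Delta> e = src \<Gamma> e \<and> tgt \<Delta> e = tgt \<Gamma> e"
  shows "edge_path \<Delta> u es v"
  using assms(1) by (induction es arbitrary: u) (use assms(2-) in auto)

text \<open>Serves to contradict the maximality of a tree that misses a vertex. The new end point is
  a leaf, and a path that passes through a leaf backtracks there.\<close>

lemma tree_add_leaf:
  fixes T T' :: "('v, 'e) serre_graph"
  assumes T: "tree T" and T': "serre_graph T'"
    and edges: "edges T' = edges T \<union> {e, rev_edge T' e}"
    and verts: "verts T' = insert (tgt T' e) (verts T)"
    and eq: "\<And>f. f \<in> edges T \<Longrightarrow> rev_edge T' f = rev_edge T f \<and> src T' f = src T f \<and> tgt T' f = tgt T f"
    and e: "src T' e \<in> verts T" "tgt T' e \<notin> verts T"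
  shows "tree T'"
proof -
  let ?w = "tgt T' e" and ?u = "src T' e" and ?e' = "rev_edge T' e"
  have e': "e \<in> edges T'" "?e' \<in> edges T'" using edges by auto
  then have rev: "rev_edge T' ?e' = e" "src T' ?e' = ?w" "tgt T' ?e' = ?u" "?e' \<noteq> e"
    using T' serre_graph_src_rev[OF T'] by (auto simp: serre_graph_def)
  have serre: "serre_graph T" using T by (simp add: tree_def)
  have T_ends: "src T f \<in> verts T" "tgt T f \<in> verts T" if "f \<in> edges T" for f
    using that serre by (auto simp: serre_graph_def)
  have lift: "edge_path T' x p y" if "edge_path T x p y" for x p y
    using that by (rule edge_path_mono) (use verts edges eq in auto)
  have uw: "edge_path T' ?u [e] ?w" "edge_path T' ?w [?e'] ?u"
    using e e' verts rev by auto
  have to_u: "\<exists>p. edge_path T' x p ?u" if "x \<in> verts T'" for x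
  proof (cases "x = ?w")
    case False
    have "connected_graph T" using T by (simp add: tree_def)
    moreover have "x \<in> verts T" using that verts False by auto
    ultimately obtain p where "edge_path T x p ?u"
      using e(1) unfolding connected_graph_def by blast
    then show ?thesis using lift by blast
  qed (use uw in blast)
  have "connected_graph T'"
    unfolding connected_graph_def
  proof (intro ballI)
    fix x y assume "x \<in> verts T'" "y \<in> verts T'"
    then obtain p q where "edge_path T' x p ?u" "edge_path T' y q ?u" using to_u by blast
    then show "\<exists>es. edge_path T' x es y"
      using edge_path_reverse[OF T'] edge_path_append[OF T'] by blast
  qed
  moreover have False if *: "es \<noteq> []" "edge_path T' v es v" "reduced_path T' es" for v es
  proof -
    \<comment> \<open>The only edge leaving the leaf \<open>tgt T' e\<close> is the inverse of \<open>e\<close>, so \<open>e\<close> can only be the last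
      edge of a reduced path.\<close>
    have src_w: "f = ?e'" if "f \<in> edges T'" "src T' f = ?w" for f
      using that edges rev e eq T_ends by (metis Un_iff empty_iff insert_iff)
    have inside: "edge_path T x p y \<and> reduced_path T p \<and> y \<noteq> ?w"
      if "edge_path T' x p y" "reduced_path T' p" "x \<in> verts T" "y \<noteq> ?w" for x p y
      using that
    proof (induction p arbitrary: x)
      case Nil
      then show ?case by (auto simp: reduced_path_def)
    next
      case (Cons f p)
      have f: "f \<in> edges T'" "src T' f = x" "edge_path T' (tgt T' f) p y" using Cons.prems by auto
      have "f \<noteq> e"
      proof
        assume "f = e"
        then have "p \<noteq> []" using f Cons.prems by auto
        then obtain g p' where p: "p = g # p'" by (cases p) auto
        then have "g = ?e'" using f \<open>f = e\<close> src_w by auto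
        then show False using Cons.prems p \<open>f = e\<close> by (auto simp: reduced_path_def)
      qed
      moreover have "f \<noteq> ?e'" using f rev Cons.prems e by auto
      ultimately have fT: "f \<in> edges T" using f edges by auto
      then have "edge_path T (tgt T f) p y \<and> reduced_path T p"
        using Cons.IH[of "tgt T' f"] f Cons.prems eq[OF fT] T_ends(2)[OF fT]
        by (auto simp: reduced_path_def successively_Cons)
      moreover have "hd p \<noteq> rev_edge T f" if "p \<noteq> []"
        using Cons.prems that eq[OF fT] by (auto simp: reduced_path_def successively_Cons)
      ultimately show ?case
        using fT f eq[OF fT] Cons.prems by (auto simp: reduced_path_def successively_Cons)
    qed
    have no_T: False if "edge_path T x p x" "reduced_path T p" "p \<noteq> []" for x p
      using that T by (auto simp: tree_def)
    show False
    proof (cases "v = ?w")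
      case False
      then have "v \<in> verts T" using edge_path_verts[OF T' *(2)] verts by auto
      then show False using inside[OF *(2,3)] no_T * False by blast
    next
      case True
      \<comment> \<open>A closed path based at the leaf starts with the inverse of \<open>e\<close>
        and ends with \<open>e\<close>. What lies between is a reduced closed path of
        \<open>T\<close>, hence empty, and the two remaining edges backtrack.\<close>
      obtain f p where es: "es = f # p" using *(1) by (cases es) auto
      have f: "f = ?e'" using es * src_w True by auto
      have p: "edge_path T' ?u p ?w" using es * f rev True by auto
      then have "p \<noteq> []" using e by auto
      then obtain q g where q: "p = q @ [g]" by (metis rev_exhaust)
      have g: "g \<in> edges T'" "tgt T' g = ?w" "edge_path T' ?u q (src T' g)"
        using p unfolding q by (auto simp: edge_path_append[OF T'])
      have "g \<notin> edges T" using g e eq T_ends by metis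
      moreover have "g \<noteq> ?e'" using g rev e by auto
      ultimately have ge: "g = e" using g edges by auto
      have red: "reduced_path T' q"
        using *(3) unfolding es q by (auto simp: reduced_path_def successively_Cons successively_append_iff)
      have "?u \<noteq> ?w" using e by auto
      then have "edge_path T ?u q ?u \<and> reduced_path T q"
        using inside[OF g(3) red e(1)] ge by auto
      then have "q = []" using no_T by blast
      then show False using * es q f ge rev by (auto simp: reduced_path_def)
    qed
  qed
  ultimately show ?thesis
    using T' verts unfolding tree_def by auto
qed

text \<open>Otherwise connectedness provides an edge that leaves the vertex set of the tree, and
  adding it gives a larger tree.\<close>

lemma maximal_tree_spanning:
  fixes \<Gamma> :: "('v, 'e, 'z) serre_graph_scheme"
  assumes T: "maximal_tree T \<Gamma>" and \<Gamma>: "serre_graph \<Gamma>" "connected_graph \<Gamma>"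
  shows "verts T = verts \<Gamma>"
proof (rule ccontr)
  assume ne: "verts T \<noteq> verts \<Gamma>"
  have sub: "subgraph T \<Gamma>" and tr: "tree T" using T by (auto simp: maximal_tree_def)
  obtain x where x: "x \<in> verts \<Gamma>" "x \<notin> verts T" using ne sub by (auto simp: subgraph_def)
  obtain u where u: "u \<in> verts T" using tr by (auto simp: tree_def)
  then have "u \<in> verts \<Gamma>" using sub by (auto simp: subgraph_def)
  then obtain es where "edge_path \<Gamma> u es x" using x \<Gamma>(2) by (auto simp: connected_graph_def)
  then obtain e where e: "e \<in> edges \<Gamma>" "src \<Gamma> e \<in> verts T" "tgt \<Gamma> e \<notin> verts T"
    using edge_path_leaving u x by metis
  \<comment> \<open>The structure maps are those of \<Gamma>, because those of \<open>T\<close> are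
    arbitrary outside \<open>edges T\<close>.\<close>
  define T' :: "('v, 'e) serre_graph" where
    "T' = \<lparr>verts = insert (tgt \<Gamma> e) (verts T), edges = edges T \<union> {e, rev_edge \<Gamma> e},
      rev_edge = rev_edge \<Gamma>, src = src \<Gamma>, tgt = tgt \<Gamma>\<rparr>"
  have sel: "verts T' = insert (tgt \<Gamma> e) (verts T)" "edges T' = edges T \<union> {e, rev_edge \<Gamma> e}"
    "rev_edge T' = rev_edge \<Gamma>" "src T' = src \<Gamma>" "tgt T' = tgt \<Gamma>"
    by (auto simp: T'_def)
  have eq: "rev_edge T f = rev_edge \<Gamma> f" "src T f = src \<Gamma> f" "tgt T f = tgt \<Gamma> f" "f \<in> edges \<Gamma>"
    "rev_edge T f \<in> edges T" "src T f \<in> verts T" "tgt T f \<in> verts T" if "f \<in> edges T" for f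
    using that sub by (auto simp: subgraph_def serre_graph_def)
  have \<Gamma>e: "rev_edge \<Gamma> f \<in> edges \<Gamma>" "rev_edge \<Gamma> f \<noteq> f" "rev_edge \<Gamma> (rev_edge \<Gamma> f) = f"
    "tgt \<Gamma> (rev_edge \<Gamma> f) = src \<Gamma> f" "src \<Gamma> (rev_edge \<Gamma> f) = tgt \<Gamma> f"
    "src \<Gamma> f \<in> verts \<Gamma>" "tgt \<Gamma> f \<in> verts \<Gamma>" if "f \<in> edges \<Gamma>" for f
    using that \<Gamma>(1) serre_graph_src_rev by (auto simp: serre_graph_def)
  have "rev_edge \<Gamma> f \<in> edges T' \<and> rev_edge \<Gamma> f \<noteq> f \<and> rev_edge \<Gamma> (rev_edge \<Gamma> f) = f \<and>
      src \<Gamma> f \<in> verts T' \<and> tgt \<Gamma> f \<in> verts T' \<and> tgt \<Gamma> (rev_edge \<Gamma> f) = src \<Gamma> f" if "f \<in> edges T'" for f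
  proof (cases "f \<in> edges T")
    case True
    then show ?thesis using eq[OF True] \<Gamma>e[of f] unfolding sel by auto
  next
    case False
    then have "f = e \<or> f = rev_edge \<Gamma> e" using that sel by auto
    then show ?thesis using e \<Gamma>e[OF e(1)] unfolding sel by auto
  qed
  then have serre': "serre_graph T'"
    unfolding serre_graph_def sel(3-5) by blast
  have "tree T'"
    by (rule tree_add_leaf[OF tr serre', of e]) (use e eq in \<open>auto simp: sel\<close>)
  moreover have "subgraph T' \<Gamma>"
    using serre' sub e \<Gamma>e[OF e(1)] by (auto simp: subgraph_def sel)
  moreover have "subgraph T T'"
    using sub by (auto simp: subgraph_def sel)
  ultimately have "verts T' = verts T" using T by (auto simp: maximal_tree_def)
  then show False using e by (auto simp: sel)
qed

section \<open>Coordinates on the vertex groups\<close>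

definition zscale :: "int \<Rightarrow> int \<times> int \<Rightarrow> int \<times> int" where
  "zscale k x = (k * fst x, k * snd x)"

text \<open>The source is a type with its addition instead of a group record, so that elements of
  vertex groups can be handled by vector arithmetic.\<close>

definition Z2_hom :: "('a, 'm) monoid_scheme \<Rightarrow> (int \<times> int \<Rightarrow> 'a) \<Rightarrow> bool" where
  "Z2_hom L j \<longleftrightarrow> (\<forall>x. j x \<in> carrier L) \<and> (\<forall>x y. j (x + y) = j x \<otimes>\<^bsub>L\<^esub> j y)"

lemma zscale_simps [simp]:
  "zscale 0 x = 0" "zscale 1 x = x" "zscale k 0 = 0"
  "fst (zscale k x) = k * fst x" "snd (zscale k x) = k * snd x"
  by (auto simp: zscale_def prod_eq_iff)

lemma zscale_add: "zscale (k + l) x = zscale k x + zscale l x"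
  by (auto simp: prod_eq_iff algebra_simps)

lemma zscale_minus: "zscale (- k) x = - zscale k x"
  by (auto simp: prod_eq_iff)

lemma zscale_diff: "zscale (k - l) x = zscale k x - zscale l x"
  by (auto simp: prod_eq_iff algebra_simps)

lemma zscale_eq_0_iff: "zscale k x = 0 \<longleftrightarrow> k = 0 \<or> x = 0"
  by (auto simp: prod_eq_iff)

lemma Z2_hom_closed: "Z2_hom L j \<Longrightarrow> j x \<in> carrier L"
  unfolding Z2_hom_def by blast

lemma Z2_hom_add: "Z2_hom L j \<Longrightarrow> j (x + y) = j x \<otimes>\<^bsub>L\<^esub> j y"
  unfolding Z2_hom_def by blast

lemma (in group) Z2_hom_zero:
  assumes "Z2_hom G j" shows "j 0 = \<one>"
  using Z2_hom_add[OF assms, of 0 0] Z2_hom_closed[OF assms, of 0] by (simp add: l_cancel_one)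

lemma (in group) Z2_hom_uminus:
  assumes "Z2_hom G j" shows "j (- x) = inv (j x)"
  using Z2_hom_add[OF assms, of "- x" x] Z2_hom_closed[OF assms] Z2_hom_zero[OF assms]
  by (metis add.left_inverse inv_equality)

lemma (in group) Z2_hom_zscale:
  assumes "Z2_hom G j" shows "j (zscale k x) = j x [^] k"
proof -
  have nat: "j (zscale (int n) x) = j x [^] n" for n
    by (induction n) (use Z2_hom_zero[OF assms] Z2_hom_add[OF assms, of "zscale _ x" x] in
      \<open>auto simp: zscale_add add.commute\<close>)
  show ?thesis
  proof (cases k)
    case (neg n)
    then have "zscale k x = - zscale (int (Suc n)) x" by (simp only: zscale_minus)
    then show ?thesis
      using neg nat[of "Suc n"] Z2_hom_closed[OF assms, of x]
      by (simp only: Z2_hom_uminus[OF assms] int_pow_neg int_pow_int)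
  qed (use nat in \<open>simp add: int_pow_int\<close>)
qed

lemma (in group) conjugation_hom:
  assumes "a \<in> carrier G"
  shows "(\<lambda>x. a \<otimes> x \<otimes> inv a) \<in> hom G G"
proof (rule homI)
  fix x y assume "x \<in> carrier G" "y \<in> carrier G"
  moreover have "inv a \<otimes> (a \<otimes> z) = z" if "z \<in> carrier G" for z
    using assms that by (simp add: m_assoc[symmetric])
  ultimately show "a \<otimes> (x \<otimes> y) \<otimes> inv a = a \<otimes> x \<otimes> inv a \<otimes> (a \<otimes> y \<otimes> inv a)"
    using assms by (simp add: m_assoc)
qed (use assms in auto)

lemma (in group) int_pow_conjugate:
  assumes "a \<in> carrier G" "x \<in> carrier G"
  shows "(a \<otimes> x \<otimes> inv a) [^] (k::int) = a \<otimes> x [^] k \<otimes> inv a"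
  using hom_int_pow[OF conjugation_hom[OF assms(1)] assms(2)] is_group by simp

lemma free_Abelian_group_2_coordinates:
  assumes "group G" "G \<cong> free_Abelian_group {..<2::nat}"
  obtains \<eta> :: "int \<times> int \<Rightarrow> 'a" where "bij_betw \<eta> UNIV (carrier G)" "Z2_hom G \<eta>"
proof -
  let ?F = "free_Abelian_group {..<2::nat}"
  define b where "b x = frag_cmul (fst x) (frag_of (0::nat)) + frag_cmul (snd x) (frag_of 1)"
    for x :: "int \<times> int"
  have look: "Poly_Mapping.lookup (b x) k = (if k = 0 then fst x else if k = 1 then snd x else 0)" for x and k :: nat
    by (auto simp: b_def lookup_add lookup_frag_of lookup_one when_def)
  have b_closed: "b x \<in> carrier ?F" for x
    by (auto simp: in_keys_iff look split: if_splits)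
  have b_bij: "bij_betw b UNIV (carrier ?F)"
  proof (rule bij_betwI[where g = "\<lambda>c. (Poly_Mapping.lookup c 0, Poly_Mapping.lookup c 1)"])
    show "b (Poly_Mapping.lookup c 0, Poly_Mapping.lookup c 1) = c" if "c \<in> carrier ?F" for c
    proof (rule poly_mapping_eqI)
      fix k :: nat
      have "Poly_Mapping.lookup c k = 0" if "k \<noteq> 0" "k \<noteq> 1"
      proof -
        have "k \<notin> Poly_Mapping.keys c" using that \<open>c \<in> carrier ?F\<close> by auto
        then show ?thesis by (simp add: in_keys_iff)
      qed
      then show "Poly_Mapping.lookup (b (Poly_Mapping.lookup c 0, Poly_Mapping.lookup c 1)) k = Poly_Mapping.lookup c k"
        by (simp add: look)
    qed
  qed (use b_closed look in auto)
  have b_add: "b (x + y) = b x \<otimes>\<^bsub>?F\<^esub> b y" for x y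
    by (simp add: b_def frag_cmul_distrib algebra_simps)
  obtain g where g: "g \<in> iso ?F G"
    using group.iso_sym[OF assms] by (auto simp: is_iso_def)
  show thesis
  proof
    show "bij_betw (g \<circ> b) UNIV (carrier G)"
      using bij_betw_trans[OF b_bij] g by (auto simp: iso_def)
    have "g \<in> hom ?F G" using g by (simp add: iso_def)
    then show "Z2_hom G (g \<circ> b)"
      using b_closed b_add unfolding Z2_hom_def comp_def hom_def by (auto simp del: carrier_free_Abelian_group_iff)
  qed
qed

section \<open>Homomorphisms out of a tubular group\<close>

text \<open>With the isomorphism \<Theta> fixed, the generators of the presentation become elements
  \<open>i v x\<close> and \<open>t e\<close> of \<open>H\<close> itself.\<close>

locale tubular = group H
  for H :: "('h, 'm) monoid_scheme" (structure) +
  fixes G :: "('v, 'e, 'g, 'c) graph_of_groups" and T :: "('v, 'e) serre_graph" and P :: "'e set"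
    and \<Theta> :: "'h \<Rightarrow> (('v, 'e, 'g) pi1_generator \<times> bool) list set"
  assumes tubular: "tubular_graph_of_groups G" and maximal_tree: "maximal_tree T G"
    and orientation: "orientation P G" and iso: "\<Theta> \<in> iso H (fundamental_group G T P)"
begin

definition coord :: "'v \<Rightarrow> int \<times> int \<Rightarrow> 'g" where
  "coord v = (SOME \<eta>. bij_betw \<eta> UNIV (carrier (vgroup G v)) \<and> Z2_hom (vgroup G v) \<eta>)"

definition from_pi1 :: "('v, 'e, 'g) pi1_generator \<Rightarrow> 'h" where
  "from_pi1 x = inv_into (carrier H) \<Theta> (generator_class (pi1_generators G P) (pi1_relations G T P) x)"

text \<open>The canonical map of a vertex group, in coordinates. Its injectivity is a genuine fact
  about graphs of groups and becomes available only with \<open>i_eq_one_iff\<close>.\<close>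

definition i :: "'v \<Rightarrow> int \<times> int \<Rightarrow> 'h" where
  "i v x = from_pi1 (Vertex_Elt v (coord v x))"

definition t :: "'e \<Rightarrow> 'h" where
  "t e = from_pi1 (Free_Letter e)"

definition egen :: "'e \<Rightarrow> 'c" where
  "egen e = (SOME c. c \<in> carrier (egroup G e) \<and> carrier (egroup G e) = range (\<lambda>n::int. c [^]\<^bsub>egroup G e\<^esub> n))"

text \<open>\<open>w_src e\<close> and \<open>w_tgt e\<close> are the attaching vectors of
  \<open>e\<close>. The relations of \<open>e\<close> amount to a single one between these two
  vectors, \<open>t_conj\<close>.\<close>

definition w_src :: "'e \<Rightarrow> int \<times> int" where
  "w_src e = the_inv (coord (src G e)) (emb G e (egen e))"

definition w_tgt :: "'e \<Rightarrow> int \<times> int" where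
  "w_tgt e = the_inv (coord (tgt G e)) (emb G (rev_edge G e) (egen e))"

definition root :: 'v where "root = (SOME v. v \<in> verts G)"

lemma finite_verts: "finite (verts G)" and root: "root \<in> verts G"
  and serre: "serre_graph G" and connected: "connected_graph G"
  using tubular some_in_eq[of "verts G"]
  by (auto simp: tubular_graph_of_groups_def finite_graph_of_groups_def root_def)

lemma P_subset: "P \<subseteq> edges G" and finite_P: "finite P"
  using orientation tubular
  by (auto simp: orientation_def tubular_graph_of_groups_def finite_graph_of_groups_def)

lemma P_ends: "e \<in> P \<Longrightarrow> src G e \<in> verts G" "e \<in> P \<Longrightarrow> tgt G e \<in> verts G"
  using P_subset serre by (auto simp: serre_graph_def)

lemma coord:
  assumes "v \<in> verts G"
  shows coord_bij: "bij_betw (coord v) UNIV (carrier (vgroup G v))" and coord_hom: "Z2_hom (vgroup G v) (coord v)"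
    and coord_inj: "inj (coord v)"
proof -
  have "group (vgroup G v)" "vgroup G v \<cong> free_Abelian_group {..<2::nat}"
    using tubular assms by (auto simp: tubular_graph_of_groups_def finite_graph_of_groups_def)
  then have "\<exists>\<eta>. bij_betw \<eta> UNIV (carrier (vgroup G v)) \<and> Z2_hom (vgroup G v) \<eta>"
    using free_Abelian_group_2_coordinates by metis
  from someI_ex[OF this]
  show "bij_betw (coord v) UNIV (carrier (vgroup G v))" "Z2_hom (vgroup G v) (coord v)"
    by (auto simp: coord_def)
  then show "inj (coord v)" by (simp add: bij_betw_def)
qed

lemma edge_group:
  assumes "e \<in> edges G"
  shows "group (egroup G e)" "egroup G (rev_edge G e) = egroup G e"
    "emb G e \<in> mon (egroup G e) (vgroup G (src G e))"
    "emb G (rev_edge G e) \<in> mon (egroup G e) (vgroup G (tgt G e))"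
    "group (vgroup G (src G e))" "group (vgroup G (tgt G e))"
proof -
  have *: "group (egroup G f)" "egroup G (rev_edge G f) = egroup G f"
    "emb G f \<in> mon (egroup G f) (vgroup G (src G f))" if "f \<in> edges G" for f
    using tubular that by (auto simp: tubular_graph_of_groups_def finite_graph_of_groups_def)
  have r: "rev_edge G e \<in> edges G" "src G (rev_edge G e) = tgt G e"
    using assms serre serre_graph_src_rev[OF serre] by (auto simp: serre_graph_def)
  show "group (egroup G e)" "egroup G (rev_edge G e) = egroup G e"
    "emb G e \<in> mon (egroup G e) (vgroup G (src G e))"
    using *[OF assms] by auto
  show "emb G (rev_edge G e) \<in> mon (egroup G e) (vgroup G (tgt G e))"
    using *(3)[OF r(1)] r(2) *(2)[OF assms] by simp
  show "group (vgroup G (src G e))" "group (vgroup G (tgt G e))"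
    using tubular assms serre
    by (auto simp: tubular_graph_of_groups_def finite_graph_of_groups_def serre_graph_def)
qed

lemma egen:
  assumes "e \<in> edges G"
  shows "egen e \<in> carrier (egroup G e)" "carrier (egroup G e) = range (\<lambda>n::int. egen e [^]\<^bsub>egroup G e\<^esub> n)"
    "egen e \<noteq> \<one>\<^bsub>egroup G e\<^esub>"
proof -
  interpret C: group "egroup G e" using edge_group(1)[OF assms] .
  have "cyclic_group (egroup G e)" "infinite (carrier (egroup G e))"
    using tubular assms by (auto simp: tubular_graph_of_groups_def)
  then have "\<exists>c. c \<in> carrier (egroup G e) \<and> carrier (egroup G e) = range (\<lambda>n::int. c [^]\<^bsub>egroup G e\<^esub> n)"
    unfolding C.cyclic_group by auto
  from someI_ex[OF this]
  show *: "egen e \<in> carrier (egroup G e)" "carrier (egroup G e) = range (\<lambda>n::int. egen e [^]\<^bsub>egroup G e\<^esub> n)"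
    by (auto simp: egen_def)
  show "egen e \<noteq> \<one>\<^bsub>egroup G e\<^esub>"
  proof
    assume "egen e = \<one>\<^bsub>egroup G e\<^esub>"
    then have "carrier (egroup G e) = {\<one>\<^bsub>egroup G e\<^esub>}" by (subst *(2)) auto
    then show False using \<open>infinite _\<close> by simp
  qed
qed

lemma coord_the_inv:
  assumes "v \<in> verts G" "a \<in> carrier (vgroup G v)"
  shows "coord v (the_inv (coord v) a) = a"
  using coord[OF assms(1)] assms(2) by (intro f_the_inv_into_f) (auto simp: bij_betw_def)

text \<open>Injectivity of the edge maps enters here: it makes the attaching vectors
  nonzero.\<close>

lemma emb_power:
  assumes v: "v \<in> verts G" and m: "m \<in> mon (egroup G e) (vgroup G v)" and e: "e \<in> edges G"
  shows "the_inv (coord v) (m (egen e)) \<noteq> 0"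
    "m (egen e [^]\<^bsub>egroup G e\<^esub> (n::int)) = coord v (zscale n (the_inv (coord v) (m (egen e))))"
proof -
  have gr: "group (egroup G e)" "group (vgroup G v)"
    using edge_group[OF e] v tubular by (auto simp: tubular_graph_of_groups_def finite_graph_of_groups_def)
  interpret V: group "vgroup G v" by fact
  have hom: "m \<in> hom (egroup G e) (vgroup G v)" "inj_on m (carrier (egroup G e))"
    using m by (auto simp: mon_def)
  interpret h: group_hom "egroup G e" "vgroup G v" m
    using gr hom by (simp add: group_hom_def group_hom_axioms_def)
  note g = egen[OF e]
  have c: "coord v (the_inv (coord v) (m (egen e))) = m (egen e)"
    using coord_the_inv[OF v] g by auto
  show "m (egen e [^]\<^bsub>egroup G e\<^esub> (n::int)) = coord v (zscale n (the_inv (coord v) (m (egen e))))"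
    using h.hom_int_pow[OF g(1)] c V.Z2_hom_zscale[OF coord_hom[OF v]] by simp
  show "the_inv (coord v) (m (egen e)) \<noteq> 0"
  proof
    assume "the_inv (coord v) (m (egen e)) = 0"
    then have "m (egen e) = m \<one>\<^bsub>egroup G e\<^esub>" using c V.Z2_hom_zero[OF coord_hom[OF v]] by simp
    then have "egen e = \<one>\<^bsub>egroup G e\<^esub>" by (rule inj_onD[OF hom(2)]) (use g in auto)
    then show False using g by simp
  qed
qed

lemma w_nonzero: "e \<in> P \<Longrightarrow> w_src e \<noteq> 0" "e \<in> P \<Longrightarrow> w_tgt e \<noteq> 0"
  using emb_power(1)[OF _ edge_group(3)] emb_power(1)[OF _ edge_group(4)] P_ends P_subset
  unfolding w_src_def w_tgt_def by blast+

lemma verts_T: "verts T = verts G"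
  using maximal_tree_spanning[OF maximal_tree serre connected] .

lemma T_edges:
  assumes "e \<in> edges T"
  shows "src T e = src G e" "tgt T e = tgt G e" "rev_edge T e = rev_edge G e" "rev_edge G e \<in> edges T"
    "e \<in> P \<or> rev_edge G e \<in> P"
    "src G (rev_edge G e) = tgt G e" "tgt G (rev_edge G e) = src G e" "rev_edge G (rev_edge G e) = e"
    "\<not> (e \<in> P \<and> rev_edge G e \<in> P)"
proof -
  have e: "e \<in> edges G" using assms maximal_tree by (auto simp: maximal_tree_def subgraph_def)
  show "src T e = src G e" "tgt T e = tgt G e" "rev_edge T e = rev_edge G e" "rev_edge G e \<in> edges T"
    using assms maximal_tree by (auto simp: maximal_tree_def subgraph_def serre_graph_def)
  show "src G (rev_edge G e) = tgt G e" "tgt G (rev_edge G e) = src G e" "rev_edge G (rev_edge G e) = e"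
    using e serre serre_graph_src_rev[OF serre e] by (auto simp: serre_graph_def)
  have "e \<in> P \<union> rev_edge G ` P" using e orientation by (simp add: orientation_def)
  moreover have "rev_edge G (rev_edge G f) = f" if "f \<in> P" for f
    using that P_subset serre by (auto simp: serre_graph_def)
  ultimately show "e \<in> P \<or> rev_edge G e \<in> P" by auto
  show "\<not> (e \<in> P \<and> rev_edge G e \<in> P)"
    using orientation \<open>rev_edge G (rev_edge G e) = e\<close> unfolding orientation_def
    by (metis IntI empty_iff imageI)
qed

text \<open>The tree is connected and spanning. A path may run along a positive edge in either
  direction, whence the equivalence in the second premise.\<close>

lemma tree_induct:
  assumes "Q root" "\<And>f. f \<in> edges T \<inter> P \<Longrightarrow> Q (src G f) \<longleftrightarrow> Q (tgt G f)" "v \<in> verts G"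
  shows "Q v"
proof -
  have step: "Q (src G f) \<longleftrightarrow> Q (tgt G f)" if "f \<in> edges T" for f
    using assms(2)[of f] assms(2)[of "rev_edge G f"] T_edges[OF that] that by auto
  have "Q y" if "edge_path T x es y" "Q x" for x y es
    using that by (induction es arbitrary: x) (auto simp: T_edges step)
  moreover have "connected_graph T" using maximal_tree by (simp add: maximal_tree_def tree_def)
  then obtain es where "edge_path T root es v"
    using root assms(3) unfolding connected_graph_def verts_T by blast
  ultimately show ?thesis using assms(1) by blast
qed

lemma iso_inverse:
  "inv_into (carrier H) \<Theta> \<in> iso (fundamental_group G T P) H"
  using iso_set_sym[OF iso] .

lemma Vertex_Elt_generator: "v \<in> verts G \<Longrightarrow> Vertex_Elt v (coord v x) \<in> pi1_generators G P"
  and Free_Letter_generator: "e \<in> P \<Longrightarrow> Free_Letter e \<in> pi1_generators G P"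
  using Z2_hom_closed[OF coord_hom] by (auto simp: pi1_generators_def)

lemma from_pi1_closed: "x \<in> pi1_generators G P \<Longrightarrow> from_pi1 x \<in> carrier H"
  using iso_inverse generator_class_closed[of x "pi1_generators G P" "pi1_relations G T P"]
  by (auto simp: from_pi1_def fundamental_group_def iso_def hom_def)

lemma i_closed: "v \<in> verts G \<Longrightarrow> i v x \<in> carrier H"
  and t_closed: "e \<in> P \<Longrightarrow> t e \<in> carrier H"
  by (simp_all add: i_def t_def from_pi1_closed Vertex_Elt_generator Free_Letter_generator)

lemma from_pi1_word_eval:
  assumes "w \<in> signed_words (pi1_generators G P)"
  shows "word_eval from_pi1 w =
    inv_into (carrier H) \<Theta> (presentation_rel (pi1_generators G P) (pi1_relations G T P) `` {w})"
proof -
  let ?X = "pi1_generators G P" and ?R = "pi1_relations G T P"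
  let ?f = "inv_into (carrier H) \<Theta>"
  interpret \<Pi>: group "presented_group ?X ?R" by (rule group_presented_group)
  interpret f: group_hom "presented_group ?X ?R" H ?f
    using iso_inverse by unfold_locales (simp add: iso_def fundamental_group_def)
  have "word_eval from_pi1 w = ?f (monoid.word_eval (presented_group ?X ?R) (generator_class ?X ?R) w)"
    using assms
  proof (induction w)
    case (Cons a w)
    obtain x b where a: "a = (x, b)" by (cases a) auto
    have x: "x \<in> ?X" "w \<in> signed_words ?X" using Cons.prems a by (auto simp: signed_words_def)
    have "generator_class ?X ?R \<in> ?X \<rightarrow> carrier (presented_group ?X ?R)"
      by (auto intro: generator_class_closed)
    note c = \<Pi>.word_eval_closed[OF this x(2)] generator_class_closed[OF x(1), of ?R]
    show ?case
    proof (cases b)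
      case True
      then show ?thesis
        using f.hom_mult[OF c(2,1)] Cons.IH[OF x(2)] by (simp only: a word_eval_Cons \<Pi>.word_eval_Cons from_pi1_def if_True)
    next
      case False
      then show ?thesis
        using f.hom_mult[OF \<Pi>.inv_closed[OF c(2)] c(1)] f.hom_inv[OF c(2)] Cons.IH[OF x(2)]
        by (simp only: a word_eval_Cons \<Pi>.word_eval_Cons from_pi1_def if_False)
    qed
  qed simp
  then show ?thesis using generator_class_relation[OF assms, of ?R] by simp
qed

lemma from_pi1_relation:
  assumes "(l, r) \<in> pi1_relations G T P"
    "l \<in> signed_words (pi1_generators G P)" "r \<in> signed_words (pi1_generators G P)"
  shows "word_eval from_pi1 l = word_eval from_pi1 r"
  using presented_group_relation[OF assms] generator_class_relation[OF assms(2)]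
    generator_class_relation[OF assms(3)] from_pi1_word_eval assms by simp

lemma i_hom: "Z2_hom H (i v)" if "v \<in> verts G"
proof -
  have "i v (x + y) = i v x \<otimes> i v y" for x y
  proof -
    let ?x = "Vertex_Elt v (coord v x)" and ?y = "Vertex_Elt v (coord v y)"
      and ?xy = "Vertex_Elt v (coord v (x + y))"
    have "([(?x, True), (?y, True)], [(?xy, True)]) \<in> pi1_relations G T P"
      using that Z2_hom_closed[OF coord_hom[OF that]]
      unfolding pi1_relations_def Z2_hom_add[OF coord_hom[OF that]] by blast
    then have "word_eval from_pi1 [(?x, True), (?y, True)] = word_eval from_pi1 [(?xy, True)]"
      by (rule from_pi1_relation) (use that Vertex_Elt_generator in \<open>auto simp: signed_words_def\<close>)
    then show ?thesis
      using i_closed[OF that, of x] i_closed[OF that, of y] i_closed[OF that, of "x + y"] by (simp add: i_def)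
  qed
  then show ?thesis using i_closed[OF that] by (simp add: Z2_hom_def)
qed

lemma t_tree: "f \<in> edges T \<inter> P \<Longrightarrow> t f = \<one>"
  using from_pi1_relation[of "[(Free_Letter f, True)]" "[]"] t_closed[of f] Free_Letter_generator[of f]
  by (auto simp: pi1_relations_def signed_words_def t_def)

lemma t_conj: "t e \<otimes> i (tgt G e) (w_tgt e) = i (src G e) (w_src e) \<otimes> t e" if "e \<in> P"
proof -
  have e: "e \<in> edges G" using that P_subset by auto
  let ?x = "Vertex_Elt (tgt G e) (coord (tgt G e) (w_tgt e))"
    and ?y = "Vertex_Elt (src G e) (coord (src G e) (w_src e))" and ?t = "Free_Letter e"
  have "emb G e (egen e) \<in> carrier (vgroup G (src G e))"
    "emb G (rev_edge G e) (egen e) \<in> carrier (vgroup G (tgt G e))"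
    using edge_group(3,4)[OF e] egen(1)[OF e] by (auto simp: mon_def hom_def)
  then have "coord (src G e) (w_src e) = emb G e (egen e)"
    "coord (tgt G e) (w_tgt e) = emb G (rev_edge G e) (egen e)"
    using coord_the_inv P_ends[OF that] by (auto simp: w_src_def w_tgt_def)
  then have "([(?t, True), (?x, True), (?t, False)], [(?y, True)]) \<in> pi1_relations G T P"
    using that egen(1)[OF e] unfolding pi1_relations_def by auto
  then have "word_eval from_pi1 [(?t, True), (?x, True), (?t, False)] = word_eval from_pi1 [(?y, True)]"
    by (rule from_pi1_relation)
      (use that Vertex_Elt_generator Free_Letter_generator P_ends in \<open>auto simp: signed_words_def\<close>)
  then have "t e \<otimes> (i (tgt G e) (w_tgt e) \<otimes> inv t e) = i (src G e) (w_src e)"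
    using i_closed[OF P_ends(1)[OF that]] i_closed[OF P_ends(2)[OF that]] t_closed[OF that]
    by (simp add: i_def t_def)
  then show ?thesis
    using i_closed[OF P_ends(1)[OF that]] i_closed[OF P_ends(2)[OF that]] t_closed[OF that]
    by (metis inv_closed inv_solve_right m_assoc m_closed)
qed

text \<open>The means of proving a statement about all of \<open>H\<close>: the elements that
  satisfy it are shown to form a subgroup containing the generators.\<close>

lemma generated:
  assumes B: "subgroup B H" and "\<And>v x. v \<in> verts G \<Longrightarrow> i v x \<in> B" "\<And>e. e \<in> P \<Longrightarrow> t e \<in> B"
  shows "B = carrier H"
proof -
  let ?X = "pi1_generators G P" and ?R = "pi1_relations G T P"
  interpret \<Pi>: group "presented_group ?X ?R" by (rule group_presented_group)
  interpret h: group_hom H "presented_group ?X ?R" \<Theta>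
    using iso by unfold_locales (simp add: iso_def fundamental_group_def)
  have bij: "bij_betw \<Theta> (carrier H) (carrier (presented_group ?X ?R))"
    using iso by (simp add: iso_def fundamental_group_def)
  have from_B: "from_pi1 x \<in> B" if x: "x \<in> ?X" for x
  proof -
    consider v a where "v \<in> verts G" "a \<in> carrier (vgroup G v)" "x = Vertex_Elt v a" | e where "e \<in> P" "x = Free_Letter e"
      using x unfolding pi1_generators_def by blast
    then show ?thesis
    proof cases
      case 1
      then show ?thesis using assms(2)[of v "the_inv (coord v) a"] coord_the_inv by (simp add: i_def)
    qed (use assms(3) in \<open>auto simp: t_def\<close>)
  qed
  have "\<Theta> ` B = carrier (presented_group ?X ?R)"
  proof (rule presented_group_generated)
    show "subgroup (\<Theta> ` B) (presented_group ?X ?R)" using B by (rule h.subgroup_img_is_subgroup)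
    fix x assume x: "x \<in> ?X"
    have "\<Theta> (from_pi1 x) = generator_class ?X ?R x"
      using bij generator_class_closed[OF x] by (simp add: from_pi1_def bij_betw_inv_into_right)
    then show "generator_class ?X ?R x \<in> \<Theta> ` B" using from_B[OF x] by force
  qed
  then have "\<Theta> ` B = \<Theta> ` carrier H" using bij by (simp add: bij_betw_def)
  then show ?thesis
    using bij subgroup.subset[OF B] by (meson bij_betw_def inj_on_image_eq_iff order_refl)
qed

text \<open>Homomorphisms out of the fundamental group may be specified without regard to the relations
  for the tree edges: these are met after conjugating the data at each vertex.\<close>

lemma gauge:
  assumes "group L" and j: "\<And>v. v \<in> verts G \<Longrightarrow> Z2_hom L (j v)"
    and d: "\<And>e. e \<in> P \<Longrightarrow> d e \<in> carrier L"
    and dj: "\<And>e. e \<in> P \<Longrightarrow> d e \<otimes>\<^bsub>L\<^esub> j (tgt G e) (w_tgt e) = j (src G e) (w_src e) \<otimes>\<^bsub>L\<^esub> d e"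
  obtains \<Phi> u where "\<Phi> \<in> hom H L" "u \<in> verts G \<rightarrow> carrier L" "u root = \<one>\<^bsub>L\<^esub>"
    "\<And>v x. v \<in> verts G \<Longrightarrow> \<Phi> (i v x) = u v \<otimes>\<^bsub>L\<^esub> j v x \<otimes>\<^bsub>L\<^esub> inv\<^bsub>L\<^esub> u v"
    "\<And>e. e \<in> P \<Longrightarrow> \<Phi> (t e) = u (src G e) \<otimes>\<^bsub>L\<^esub> d e \<otimes>\<^bsub>L\<^esub> inv\<^bsub>L\<^esub> u (tgt G e)"
proof -
  interpret L: group L by fact
  let ?X = "pi1_generators G P" and ?R = "pi1_relations G T P"
  \<comment> \<open>\<open>tree_potential\<close> needs a label on both orientations of a tree edge,
    whereas \<open>d\<close> is given on positive edges only.\<close>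
  define d' where "d' e = (if e \<in> P then d e else inv\<^bsub>L\<^esub> d (rev_edge G e))" for e
  have tT: "tree T" using maximal_tree by (simp add: maximal_tree_def)
  obtain u where u: "u \<in> verts T \<rightarrow> carrier L" "u root = \<one>\<^bsub>L\<^esub>"
    "\<And>e. e \<in> edges T \<Longrightarrow> u (src T e) \<otimes>\<^bsub>L\<^esub> d' e = u (tgt T e)"
  proof (rule tree_potential[OF tT \<open>group L\<close>, of d' root])
    show "d' e \<in> carrier L" if "e \<in> edges T" for e
      using T_edges(5)[OF that] d by (auto simp: d'_def)
    show "d' (rev_edge T e) = inv\<^bsub>L\<^esub> d' e" if "e \<in> edges T" for e
      using T_edges[OF that] d by (auto simp: d'_def)
  qed (use root verts_T in auto)
  have uc: "u v \<in> carrier L" if "v \<in> verts G" for v using u(1) verts_T that by auto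
  \<comment> \<open>On a positive tree edge \<open>u (src G e)\<close> times \<open>d e\<close> is
    \<open>u (tgt G e)\<close>, so the corrected letter is trivial there, as the tree relation
    demands.\<close>
  define f where "f x = (case x of Vertex_Elt v a \<Rightarrow> u v \<otimes>\<^bsub>L\<^esub> j v (the_inv (coord v) a) \<otimes>\<^bsub>L\<^esub> inv\<^bsub>L\<^esub> u v
    | Free_Letter e \<Rightarrow> u (src G e) \<otimes>\<^bsub>L\<^esub> d e \<otimes>\<^bsub>L\<^esub> inv\<^bsub>L\<^esub> u (tgt G e))" for x
  have f_vertex: "f (Vertex_Elt v (coord v x)) = u v \<otimes>\<^bsub>L\<^esub> j v x \<otimes>\<^bsub>L\<^esub> inv\<^bsub>L\<^esub> u v" if "v \<in> verts G" for v x
    using coord_inj[OF that] by (simp add: f_def the_inv_f_f)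
  have f_letter: "f (Free_Letter e) = u (src G e) \<otimes>\<^bsub>L\<^esub> d e \<otimes>\<^bsub>L\<^esub> inv\<^bsub>L\<^esub> u (tgt G e)" for e
    by (simp add: f_def)
  note jc = Z2_hom_closed[OF j]
  have f: "f \<in> ?X \<rightarrow> carrier L"
    using uc d P_ends by (auto simp: pi1_generators_def f_def intro!: jc L.m_closed L.inv_closed)
  have cancel: "inv\<^bsub>L\<^esub> c \<otimes>\<^bsub>L\<^esub> (c \<otimes>\<^bsub>L\<^esub> x) = x" if "c \<in> carrier L" "x \<in> carrier L" for c x
    using that by (simp add: L.m_assoc[symmetric])
  have rel: "L.word_eval f l = L.word_eval f r"
    if lr: "(l, r) \<in> ?R" for l r
  proof -
    consider (mult) v a b where "v \<in> verts G" "a \<in> carrier (vgroup G v)" "b \<in> carrier (vgroup G v)"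
        "l = [(Vertex_Elt v a, True), (Vertex_Elt v b, True)]" "r = [(Vertex_Elt v (a \<otimes>\<^bsub>vgroup G v\<^esub> b), True)]"
      | (edge) e c where "e \<in> P" "c \<in> carrier (egroup G e)"
        "l = [(Free_Letter e, True), (Vertex_Elt (tgt G e) (emb G (rev_edge G e) c), True), (Free_Letter e, False)]"
        "r = [(Vertex_Elt (src G e) (emb G e c), True)]"
      | (tree) e where "e \<in> edges T \<inter> P" "l = [(Free_Letter e, True)]" "r = []"
      using lr unfolding pi1_relations_def by blast
    then show ?thesis
    proof cases
      case mult
      define x y where "x = the_inv (coord v) a" and "y = the_inv (coord v) b"
      have a: "a = coord v x" "b = coord v y" using mult coord_the_inv by (auto simp: x_def y_def)
      have ab: "a \<otimes>\<^bsub>vgroup G v\<^esub> b = coord v (x + y)" using a Z2_hom_add[OF coord_hom] mult by auto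
      show ?thesis
        using mult uc[OF mult(1)] jc[OF mult(1)]
        by (simp add: ab) (simp add: a f_vertex Z2_hom_add[OF j] L.m_assoc cancel)
    next
      case edge
      have e: "e \<in> edges G" using edge P_subset by auto
      obtain n :: int where c: "c = egen e [^]\<^bsub>egroup G e\<^esub> n" using egen(2)[OF e] edge by auto
      have emb: "emb G e c = coord (src G e) (zscale n (w_src e))"
        "emb G (rev_edge G e) c = coord (tgt G e) (zscale n (w_tgt e))"
        using emb_power(2)[OF P_ends(1)[OF edge(1)] edge_group(3)[OF e] e]
          emb_power(2)[OF P_ends(2)[OF edge(1)] edge_group(4)[OF e] e] by (auto simp: c w_src_def w_tgt_def)
      note closed = uc[OF P_ends(1)[OF edge(1)]] uc[OF P_ends(2)[OF edge(1)]] d[OF edge(1)]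
        jc[OF P_ends(1)[OF edge(1)]] jc[OF P_ends(2)[OF edge(1)]]
      \<comment> \<open>\<open>dj\<close> speaks of the edge generator only. An arbitrary element of
        the edge group is its \<open>n\<close>-th power, and powers commute with
        conjugation.\<close>
      have "j (src G e) (w_src e) = d e \<otimes>\<^bsub>L\<^esub> j (tgt G e) (w_tgt e) \<otimes>\<^bsub>L\<^esub> inv\<^bsub>L\<^esub> d e"
        using dj[OF edge(1)] closed by (simp add: L.inv_solve_right)
      then have "j (src G e) (zscale n (w_src e)) = d e \<otimes>\<^bsub>L\<^esub> j (tgt G e) (zscale n (w_tgt e)) \<otimes>\<^bsub>L\<^esub> inv\<^bsub>L\<^esub> d e"
        using closed L.int_pow_conjugate
        by (simp add: L.Z2_hom_zscale[OF j] P_ends[OF edge(1)])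
      then show ?thesis
        using edge(3,4) closed P_ends[OF edge(1)]
        by (simp add: emb f_vertex f_letter cancel L.inv_mult_group L.m_assoc)
    next
      case tree
      then have "f (Free_Letter e) = \<one>\<^bsub>L\<^esub>"
        using u(3)[of e] T_edges(1,2)[of e] uc[OF P_ends(2)[of e]] by (auto simp: f_letter d'_def)
      then show ?thesis using tree by simp
    qed
  qed
  obtain \<Psi> where \<Psi>: "\<Psi> \<in> hom (presented_group ?X ?R) L" "\<And>x. x \<in> ?X \<Longrightarrow> \<Psi> (generator_class ?X ?R x) = f x"
    using L.presented_group_lift[OF f, of ?R] rel by blast
  have \<Theta>: "\<Theta> (from_pi1 x) = generator_class ?X ?R x" if "x \<in> ?X" for x
  proof -
    have "bij_betw \<Theta> (carrier H) (carrier (presented_group ?X ?R))"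
      using iso by (simp add: iso_def fundamental_group_def)
    then show ?thesis
      using generator_class_closed[OF that, of ?R] by (simp add: from_pi1_def bij_betw_inv_into_right)
  qed
  have "\<Theta> \<in> hom H (presented_group ?X ?R)" using iso by (simp add: iso_def fundamental_group_def)
  then have "\<Psi> \<circ> \<Theta> \<in> hom H L" using \<Psi>(1) by (auto simp: hom_def Pi_iff)
  moreover have "(\<Psi> \<circ> \<Theta>) (i v x) = u v \<otimes>\<^bsub>L\<^esub> j v x \<otimes>\<^bsub>L\<^esub> inv\<^bsub>L\<^esub> u v" if "v \<in> verts G" for v x
    using \<Theta> \<Psi>(2) Vertex_Elt_generator[OF that] f_vertex[OF that] by (simp add: i_def)
  moreover have "(\<Psi> \<circ> \<Theta>) (t e) = u (src G e) \<otimes>\<^bsub>L\<^esub> d e \<otimes>\<^bsub>L\<^esub> inv\<^bsub>L\<^esub> u (tgt G e)" if "e \<in> P" for e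
    using \<Theta> \<Psi>(2) Free_Letter_generator[OF that] f_letter by (simp add: t_def)
  ultimately show thesis using that u uc by blast
qed

end

section \<open>Vertex groups embed\<close>

text \<open>Translation by a nonzero vector has countably infinitely many orbits, each a copy of
  \<int>. Up to a bijection it is therefore the same translation of \<int> \<times> \<nat> for every
  \<open>w\<close>.\<close>

lemma translation_orbits:
  fixes w :: "int \<times> int"
  assumes "w \<noteq> 0"
  obtains \<beta> :: "int \<times> nat \<Rightarrow> int \<times> int" where "bij \<beta>" "\<And>k n. \<beta> (k + 1, n) = \<beta> (k, n) + w"
proof -
  \<comment> \<open>\<open>p\<close> is a coordinate that does not vanish on \<open>w\<close>, and
    \<open>y\<close> is a vector on which it vanishes.\<close>
  obtain p :: "int \<times> int \<Rightarrow> int" and y where p: "p w \<noteq> 0" "\<And>x y. p (x + y) = p x + p y"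
    "\<And>k x. p (zscale k x) = k * p x" and y: "y \<noteq> 0" "p y = 0"
  proof (cases "fst w = 0")
    case True
    then have "snd w \<noteq> 0" using assms by (auto simp: prod_eq_iff)
    then show thesis by (intro that[of snd "(1, 0)"]) (auto simp: zero_prod_def)
  next
    case False
    then show thesis by (intro that[of fst "(0, 1)"]) (auto simp: zero_prod_def)
  qed
  \<comment> \<open>A fundamental domain: each orbit has exactly one point with quotient
    \<open>0\<close>, also when \<open>p w\<close> is negative. The multiples of \<open>y\<close>
    show that it is infinite.\<close>
  define R where "R = {x. p x div p w = 0}"
  have "zscale k y \<in> R" for k using y p by (simp add: R_def)
  moreover have "inj (\<lambda>k. zscale k y)" using y(1) by (auto simp: inj_on_def prod_eq_iff)
  ultimately have "infinite R"
    by (metis (no_types, lifting) UNIV_I finite_imageD finite_subset image_subsetI infinite_UNIV_int)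
  moreover have "countable R" by simp
  ultimately have b: "bij_betw (from_nat_into R) UNIV R" using bij_betw_from_nat_into by blast
  define \<beta> where "\<beta> = (\<lambda>(k, n). from_nat_into R n + zscale k w)"
  have fR: "from_nat_into R n \<in> R" for n using b by (auto simp: bij_betw_def)
  have div: "p (r + zscale k w) div p w = k" if "r \<in> R" for r k
    using that p by (simp add: R_def)
  show thesis
  proof
    show "bij \<beta>"
    proof (rule bijI)
      show "inj \<beta>"
      proof (rule injI, clarify)
        fix k n l m assume eq: "\<beta> (k, n) = \<beta> (l, m)"
        then have "k = l" using div[OF fR] by (metis (no_types, lifting) \<beta>_def case_prod_conv)
        with eq have "from_nat_into R n = from_nat_into R m" by (simp add: \<beta>_def)
        then show "k = l \<and> n = m" using b \<open>k = l\<close> by (auto simp: bij_betw_def inj_on_def)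
      qed
      have "x \<in> range \<beta>" for x
      proof -
        have "x - zscale (p x div p w) w \<in> R"
        proof -
          have "p x = p (x - zscale (p x div p w) w) + (p x div p w) * p w"
            using p(2)[of "x - zscale (p x div p w) w" "zscale (p x div p w) w"] p(3) by simp
          then have "p (x - zscale (p x div p w) w) = p x mod p w"
            by (simp add: minus_div_mult_eq_mod [symmetric])
          then show ?thesis by (simp add: R_def)
        qed
        then obtain n where "x - zscale (p x div p w) w = from_nat_into R n"
          using b by (auto simp: bij_betw_def)
        then have "\<beta> (p x div p w, n) = x" by (simp add: \<beta>_def algebra_simps)
        then show ?thesis by (metis rangeI)
      qed
      then show "surj \<beta>" by blast
    qed
    show "\<beta> (k + 1, n) = \<beta> (k, n) + w" for k n by (simp add: \<beta>_def zscale_add add.assoc)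
  qed
qed

lemma translations_conjugate:
  fixes w w' :: "int \<times> int"
  assumes "w \<noteq> 0" "w' \<noteq> 0"
  obtains d :: "int \<times> int \<Rightarrow> int \<times> int" where "bij d" "\<And>x. d (x + w) = d x + w'"
proof -
  obtain \<beta> :: "int \<times> nat \<Rightarrow> int \<times> int" where \<beta>: "bij \<beta>" "\<And>k n. \<beta> (k + 1, n) = \<beta> (k, n) + w"
    using translation_orbits[OF assms(1)] by blast
  obtain \<beta>' :: "int \<times> nat \<Rightarrow> int \<times> int" where \<beta>': "bij \<beta>'" "\<And>k n. \<beta>' (k + 1, n) = \<beta>' (k, n) + w'"
    using translation_orbits[OF assms(2)] by blast
  show thesis
  proof
    show "bij (\<beta>' \<circ> inv_into UNIV \<beta>)" using \<beta>(1) \<beta>'(1) by (simp add: bij_comp bij_imp_bij_inv)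
    fix x
    obtain k n where "x = \<beta> (k, n)" using \<beta>(1) by (metis bij_pointE surj_pair)
    then show "(\<beta>' \<circ> inv_into UNIV \<beta>) (x + w) = (\<beta>' \<circ> inv_into UNIV \<beta>) x + w'"
      using \<beta>(1) by (simp add: \<beta>(2)[symmetric] \<beta>'(2)[symmetric] bij_is_inj)
  qed
qed

context tubular
begin

text \<open>The group acts on \<open>\<int> \<times> \<int>\<close> with conjugates of vertex groups acting by translations, since all
  edge groups have equally many orbits.\<close>

lemma i_eq_one_iff:
  assumes "v \<in> verts G" shows "i v x = \<one> \<longleftrightarrow> x = 0"
proof
  let ?L = "BijGroup (UNIV :: (int \<times> int) set)"
  assume one: "i v x = \<one>"
  have car: "f \<in> carrier ?L \<longleftrightarrow> bij f" for f by (simp add: BijGroup_def Bij_def extensional_def)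
  have mult: "f \<otimes>\<^bsub>?L\<^esub> g = f \<circ> g" if "bij f" "bij g" for f g
    using that by (auto simp: BijGroup_def Bij_def extensional_def compose_def)
  define j :: "'v \<Rightarrow> int \<times> int \<Rightarrow> int \<times> int \<Rightarrow> int \<times> int" where "j v x y = y + x" for v x y
  have bij_j: "bij (j v x)" for v x
    by (rule bij_betwI[where g = "\<lambda>y. y - x"]) (auto simp: j_def)
  \<comment> \<open>\<open>d e\<close> intertwines the translations by the two attaching vectors,
    which is the edge relation for \<open>gauge\<close>.\<close>
  define d where "d e = (SOME d. bij d \<and> (\<forall>x. d (x + w_tgt e) = d x + w_src e))" for e
  have d: "bij (d e)" "\<And>x. d e (x + w_tgt e) = d e x + w_src e" if "e \<in> P" for e
  proof -
    have "\<exists>d. bij d \<and> (\<forall>x. d (x + w_tgt e) = d x + w_src e)"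
      using translations_conjugate[OF w_nonzero(2)[OF that] w_nonzero(1)[OF that]] by metis
    from someI_ex[OF this] show "bij (d e)" "\<And>x. d e (x + w_tgt e) = d e x + w_src e"
      unfolding d_def by blast+
  qed
  have "Z2_hom ?L (j v)" for v
    unfolding Z2_hom_def car mult[OF bij_j bij_j]
    by (auto simp: bij_j j_def fun_eq_iff)
  moreover have "d e \<otimes>\<^bsub>?L\<^esub> j (tgt G e) (w_tgt e) = j (src G e) (w_src e) \<otimes>\<^bsub>?L\<^esub> d e" if "e \<in> P" for e
    unfolding mult[OF d(1)[OF that] bij_j] mult[OF bij_j d(1)[OF that]]
    using d(2)[OF that] by (auto simp: j_def fun_eq_iff)
  ultimately obtain \<Phi> u where \<Phi>: "\<Phi> \<in> hom H ?L" "u \<in> verts G \<rightarrow> carrier ?L"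
    "\<And>v x. v \<in> verts G \<Longrightarrow> \<Phi> (i v x) = u v \<otimes>\<^bsub>?L\<^esub> j v x \<otimes>\<^bsub>?L\<^esub> inv\<^bsub>?L\<^esub> u v"
    using gauge[OF group_BijGroup, where j = j and d = d] d(1) car by metis
  interpret L: group ?L by (rule group_BijGroup)
  have u: "u v \<in> carrier ?L" and jc: "j v x \<in> carrier ?L" using \<Phi>(2) assms car bij_j by auto
  have "\<Phi> \<one> = \<one>\<^bsub>?L\<^esub>" using \<Phi>(1) is_group L.is_group by (simp add: hom_one)
  then have "u v \<otimes>\<^bsub>?L\<^esub> j v x \<otimes>\<^bsub>?L\<^esub> inv\<^bsub>?L\<^esub> u v = \<one>\<^bsub>?L\<^esub>"
    using \<Phi>(3)[OF assms, of x] one by simp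
  then have "u v \<otimes>\<^bsub>?L\<^esub> j v x = u v" using u jc L.inv_solve_right'[of "\<one>\<^bsub>?L\<^esub>" "u v \<otimes>\<^bsub>?L\<^esub> j v x" "u v"] by simp
  \<comment> \<open>The conjugation by \<open>u v\<close> is now undone, and a translation that
    fixes \<open>0\<close> is trivial.\<close>
  then have "j v x = \<one>\<^bsub>?L\<^esub>" using u jc by (simp add: L.r_cancel_one')
  then have "j v x 0 = 0" by (simp add: BijGroup_def)
  then show "x = 0" by (simp add: j_def)
qed (use assms i_hom Z2_hom_zero in auto)

end

section \<open>Cocycles on a transitive action\<close>

text \<open>Modelled on the left cosets of \<open>N\<close>. Edge groups are taken at the target end
  throughout; \<open>t_va\<close> carries their action over to the source end. The \<open>z\<close>
  in \<open>stabilizer\<close> is nonzero, so that every vertex contributes a basis element.\<close>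

locale tubular_action = tubular H G T P \<Theta>
  for H :: "('h, 'm) monoid_scheme" (structure) and G :: "('v, 'e, 'g, 'c) graph_of_groups" and T P \<Theta> +
  fixes \<Omega> :: "'o set" and act :: "'h \<Rightarrow> 'o \<Rightarrow> 'o" and p0 :: 'o
  assumes act_closed: "\<And>g p. g \<in> carrier H \<Longrightarrow> p \<in> \<Omega> \<Longrightarrow> act g p \<in> \<Omega>"
    and act_one: "\<And>p. p \<in> \<Omega> \<Longrightarrow> act \<one> p = p"
    and act_mult: "\<And>g h p. g \<in> carrier H \<Longrightarrow> h \<in> carrier H \<Longrightarrow> p \<in> \<Omega> \<Longrightarrow> act (g \<otimes> h) p = act g (act h p)"
    and p0: "p0 \<in> \<Omega>"
    and transitive: "\<And>p. p \<in> \<Omega> \<Longrightarrow> \<exists>g\<in>carrier H. act g p0 = p"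
    and edge_free: "\<And>e k p. e \<in> P \<Longrightarrow> p \<in> \<Omega> \<Longrightarrow> act (i (tgt G e) (zscale k (w_tgt e))) p = p \<Longrightarrow> k = 0"
    and stabilizer: "\<And>v p. v \<in> verts G \<Longrightarrow> p \<in> \<Omega> \<Longrightarrow>
      \<exists>z. z \<noteq> 0 \<and> {x. act (i v x) p = p} = range (\<lambda>k. zscale k z)"
    and finite_vertex_orbits: "\<And>v. v \<in> verts G \<Longrightarrow> finite ((\<lambda>p. range (\<lambda>x. act (i v x) p)) ` \<Omega>)"
    and finite_edge_orbits: "\<And>e. e \<in> P \<Longrightarrow>
      finite ((\<lambda>p. range (\<lambda>k. act (i (tgt G e) (zscale k (w_tgt e))) p)) ` \<Omega>)"
begin

definition va :: "'v \<Rightarrow> int \<times> int \<Rightarrow> 'o \<Rightarrow> 'o" where "va v x p = act (i v x) p"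

definition orb :: "'v \<Rightarrow> 'o \<Rightarrow> 'o set" where "orb v p = range (\<lambda>x. va v x p)"

text \<open>The preference for \<open>p0\<close> makes it the base point of its root orbit. The lift
  of that orbit can then be \<one>, and the section at \<open>root\<close> takes the value \<one> at
  \<open>p0\<close>.\<close>

definition base :: "'o set \<Rightarrow> 'o" where "base O' = (if p0 \<in> O' then p0 else SOME q. q \<in> O')"

definition z :: "'v \<Rightarrow> 'o \<Rightarrow> int \<times> int" where
  "z v p = (SOME z. z \<noteq> 0 \<and> {x. va v x p = p} = range (\<lambda>k. zscale k z))"

definition r :: "'v \<Rightarrow> 'o \<Rightarrow> int \<times> int" where
  "r v p = (if p = base (orb v p) then 0 else SOME x. va v x (base (orb v p)) = p)"

text \<open>Moving from the base point to \<open>p\<close>, then by \<open>x\<close>, then back to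
  the base point is an element of the stabilizer; \<kappa> is its exponent with respect to the
  generator \<open>z v p\<close>.\<close>

definition \<kappa> :: "'v \<Rightarrow> int \<times> int \<Rightarrow> 'o \<Rightarrow> int" where
  "\<kappa> v x p = (THE k. x + r v p = r v (va v x p) + zscale k (z v p))"

definition eorb :: "'e \<Rightarrow> 'o \<Rightarrow> 'o set" where
  "eorb e p = range (\<lambda>k. va (tgt G e) (zscale k (w_tgt e)) p)"

definition rep :: "'o set \<Rightarrow> 'o" where "rep Q = (SOME q. q \<in> Q)"

definition ek :: "'e \<Rightarrow> 'o \<Rightarrow> int" where
  "ek e p = (THE k. va (tgt G e) (zscale k (w_tgt e)) (rep (eorb e p)) = p)"

section \<open>Orbits of the vertex groups and the cocycle into their stabilizers\<close>

lemma orb_iff: "q \<in> orb v p \<longleftrightarrow> (\<exists>x. va v x p = q)"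
  unfolding orb_def image_def by blast

lemma eorb_iff: "q \<in> eorb e p \<longleftrightarrow> (\<exists>k. va (tgt G e) (zscale k (w_tgt e)) p = q)"
  unfolding eorb_def image_def by blast

lemma va_closed: "v \<in> verts G \<Longrightarrow> p \<in> \<Omega> \<Longrightarrow> va v x p \<in> \<Omega>"
  by (simp add: va_def act_closed i_closed)

lemma va_zero: "v \<in> verts G \<Longrightarrow> p \<in> \<Omega> \<Longrightarrow> va v 0 p = p"
  using Z2_hom_zero[OF i_hom] by (simp add: va_def act_one)

lemma va_add: "v \<in> verts G \<Longrightarrow> p \<in> \<Omega> \<Longrightarrow> va v (x + y) p = va v x (va v y p)"
  using Z2_hom_add[OF i_hom] by (simp add: va_def act_mult i_closed)

lemma va_uminus: "v \<in> verts G \<Longrightarrow> p \<in> \<Omega> \<Longrightarrow> va v (- x) (va v x p) = p"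
  using va_add[of v p "- x" x] va_zero by simp

lemma va_eq_iff: "v \<in> verts G \<Longrightarrow> p \<in> \<Omega> \<Longrightarrow> va v x p = va v y p \<longleftrightarrow> va v (x - y) p = p"
  using va_add[of v p "- y" x] va_add[of v p y "x - y"] va_uminus[of v p y] by auto

lemma orb_self: "v \<in> verts G \<Longrightarrow> p \<in> \<Omega> \<Longrightarrow> p \<in> orb v p"
  unfolding orb_def by (metis rangeI va_zero)

lemma orb_subset: "v \<in> verts G \<Longrightarrow> p \<in> \<Omega> \<Longrightarrow> orb v p \<subseteq> \<Omega>"
  by (auto simp: orb_def va_closed)

lemma orb_va: "orb v (va v y p) = orb v p" if "v \<in> verts G" "p \<in> \<Omega>"
proof -
  have "va v x p = va v (x - y) (va v y p)" for x using va_add[OF that, of "x - y" y] by simp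
  then have "va v x p \<in> orb v (va v y p)" for x unfolding orb_def by (metis rangeI)
  moreover have "va v x (va v y p) \<in> orb v p" for x
    using va_add[OF that, of x y] unfolding orb_def by (metis rangeI)
  ultimately show ?thesis unfolding orb_def[of v p] orb_def[of v "va v y p"]
    by (auto simp: orb_def)
qed

lemma orb_eq: "v \<in> verts G \<Longrightarrow> p \<in> \<Omega> \<Longrightarrow> q \<in> orb v p \<Longrightarrow> orb v q = orb v p"
  using orb_va by (auto simp: orb_def[of v p])

lemma base_orb: "v \<in> verts G \<Longrightarrow> p \<in> \<Omega> \<Longrightarrow> base (orb v p) \<in> orb v p"
  using orb_self[of v p] by (auto simp: base_def intro: someI)

lemma base_closed: "v \<in> verts G \<Longrightarrow> p \<in> \<Omega> \<Longrightarrow> base (orb v p) \<in> \<Omega>"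
  using base_orb orb_subset by blast

lemma orb_base: "v \<in> verts G \<Longrightarrow> p \<in> \<Omega> \<Longrightarrow> orb v (base (orb v p)) = orb v p"
  using base_orb orb_eq by blast

lemma va_r: assumes "v \<in> verts G" "p \<in> \<Omega>" shows "va v (r v p) (base (orb v p)) = p"
proof (cases "p = base (orb v p)")
  case True
  then show ?thesis using assms by (simp add: r_def va_zero)
next
  case False
  have "p \<in> orb v (base (orb v p))" using orb_base[OF assms] orb_self[OF assms] by simp
  then have "\<exists>x. va v x (base (orb v p)) = p" unfolding orb_iff .
  from someI_ex[OF this] show ?thesis using False by (simp add: r_def)
qed

lemma r_base: "v \<in> verts G \<Longrightarrow> p \<in> \<Omega> \<Longrightarrow> r v (base (orb v p)) = 0"
  by (simp add: r_def orb_base)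

lemma z:
  assumes "v \<in> verts G" "p \<in> \<Omega>"
  shows "z v p \<noteq> 0" "va v x p = p \<longleftrightarrow> (\<exists>k. x = zscale k (z v p))"
proof -
  have "z v p \<noteq> 0 \<and> {x. va v x p = p} = range (\<lambda>k. zscale k (z v p))"
    unfolding z_def using stabilizer[OF assms] unfolding va_def by (rule someI_ex)
  then show "z v p \<noteq> 0" "va v x p = p \<longleftrightarrow> (\<exists>k. x = zscale k (z v p))" by auto
qed

text \<open>Stabilizers along an orbit are conjugate, hence equal since the vertex group is abelian;
  \<open>SOME\<close> is then applied to the same predicate and picks the same generator.\<close>

lemma z_va: "z v (va v y p) = z v p" if "v \<in> verts G" "p \<in> \<Omega>"
proof -
  have "va v x (va v y p) = va v y p \<longleftrightarrow> va v x p = p" for x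
    using that by (metis add.commute va_add va_closed va_uminus)
  then show ?thesis by (simp add: z_def)
qed

lemma z_orb: "v \<in> verts G \<Longrightarrow> p \<in> \<Omega> \<Longrightarrow> q \<in> orb v p \<Longrightarrow> z v q = z v p"
  using z_va by (auto simp: orb_def)

lemma \<kappa>_unique:
  assumes "v \<in> verts G" "p \<in> \<Omega>" "x + r v p = r v (va v x p) + zscale k (z v p)"
  shows "\<kappa> v x p = k"
  unfolding \<kappa>_def
proof (rule the_equality)
  fix l assume "x + r v p = r v (va v x p) + zscale l (z v p)"
  then have "zscale (l - k) (z v p) = 0" using assms(3) by (simp add: zscale_diff)
  then show "l = k" using z(1)[OF assms(1,2)] by (simp add: zscale_eq_0_iff)
qed (rule assms(3))

lemma \<kappa>_eq:
  assumes "v \<in> verts G" "p \<in> \<Omega>"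
  shows "x + r v p = r v (va v x p) + zscale (\<kappa> v x p) (z v p)"
proof -
  let ?b = "base (orb v p)"
  have b: "?b \<in> \<Omega>" using base_closed[OF assms] .
  have "va v (x + r v p) ?b = va v x p" using va_add[OF assms(1) b] va_r[OF assms] by simp
  also have "\<dots> = va v (r v (va v x p)) ?b"
    using va_r[OF assms(1) va_closed[OF assms]] orb_va[OF assms] by simp
  finally have "va v (x + r v p - r v (va v x p)) ?b = ?b" using va_eq_iff[OF assms(1) b] by simp
  then obtain k where "x + r v p - r v (va v x p) = zscale k (z v ?b)" using z(2)[OF assms(1) b] by blast
  then have "x + r v p = r v (va v x p) + zscale k (z v p)"
    using z_orb[OF assms base_orb[OF assms]] by (simp add: algebra_simps)
  then show ?thesis using \<kappa>_unique[OF assms] by simp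
qed

text \<open>The cocycle identity: the defining equations of the two steps are added, which is
  possible because \<open>z v\<close> is constant along the orbit.\<close>

lemma \<kappa>_add:
  assumes "v \<in> verts G" "p \<in> \<Omega>"
  shows "\<kappa> v (x + y) p = \<kappa> v x (va v y p) + \<kappa> v y p"
proof (rule \<kappa>_unique[OF assms])
  have "x + y + r v p = x + r v (va v y p) + zscale (\<kappa> v y p) (z v p)"
    using \<kappa>_eq[OF assms, of y] by (simp add: add.assoc)
  also have "\<dots> = r v (va v (x + y) p) + (zscale (\<kappa> v x (va v y p)) (z v p) + zscale (\<kappa> v y p) (z v p))"
    using \<kappa>_eq[OF assms(1) va_closed[OF assms], of x y] va_add[OF assms, of x y] z_va[OF assms]
    by (simp add: add.assoc)
  finally show "x + y + r v p = r v (va v (x + y) p) + zscale (\<kappa> v x (va v y p) + \<kappa> v y p) (z v p)"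
    by (simp add: zscale_add)
qed

lemma \<kappa>_z: "v \<in> verts G \<Longrightarrow> p \<in> \<Omega> \<Longrightarrow> \<kappa> v (z v p) p = 1"
  using z(2)[of v p "z v p"] by (intro \<kappa>_unique) (auto intro!: exI[of _ 1] simp: add.commute)

lemma \<kappa>_zero: "v \<in> verts G \<Longrightarrow> p \<in> \<Omega> \<Longrightarrow> \<kappa> v 0 p = 0"
  by (rule \<kappa>_unique) (auto simp: va_zero)

lemma \<kappa>_r: "v \<in> verts G \<Longrightarrow> p \<in> \<Omega> \<Longrightarrow> \<kappa> v (r v p) (base (orb v p)) = 0"
  by (rule \<kappa>_unique) (auto simp: base_closed r_base va_r)

section \<open>Orbits of the edge groups\<close>

lemma eorb_self: "e \<in> P \<Longrightarrow> p \<in> \<Omega> \<Longrightarrow> p \<in> eorb e p"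
  unfolding eorb_def by (rule range_eqI[of _ _ 0]) (simp add: va_zero P_ends)

lemma eorb_va:
  assumes "e \<in> P" "p \<in> \<Omega>"
  shows "eorb e (va (tgt G e) (zscale l (w_tgt e)) p) = eorb e p"
proof -
  note a = va_add[OF P_ends(2)[OF assms(1)] assms(2)]
  have "va (tgt G e) (zscale k (w_tgt e)) (va (tgt G e) (zscale l (w_tgt e)) p) =
     va (tgt G e) (zscale (k + l) (w_tgt e)) p" for k
    using a[of "zscale k (w_tgt e)"] by (simp add: zscale_add)
  then have "eorb e (va (tgt G e) (zscale l (w_tgt e)) p) =
      range (\<lambda>k. va (tgt G e) (zscale (k + l) (w_tgt e)) p)"
    by (simp only: eorb_def)
  also have "\<dots> = (\<lambda>k. va (tgt G e) (zscale k (w_tgt e)) p) ` range (\<lambda>k. k + l)"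
    by (rule image_image[symmetric])
  also have "range (\<lambda>k. k + l) = UNIV" by (rule surjI[of _ "\<lambda>k. k - l"]) simp
  finally show ?thesis by (simp only: eorb_def)
qed

lemma rep_eorb: "e \<in> P \<Longrightarrow> p \<in> \<Omega> \<Longrightarrow> rep (eorb e p) \<in> eorb e p"
  using eorb_self[of e p] by (auto simp: rep_def intro: someI)

lemma eorb_closed: "e \<in> P \<Longrightarrow> p \<in> \<Omega> \<Longrightarrow> q \<in> eorb e p \<Longrightarrow> q \<in> \<Omega>"
  by (auto simp: eorb_def va_closed P_ends)

lemma eorb_eq: "e \<in> P \<Longrightarrow> p \<in> \<Omega> \<Longrightarrow> q \<in> eorb e p \<Longrightarrow> eorb e q = eorb e p"
  using eorb_va by (auto simp: eorb_def[of e p])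

lemma rep_closed: "e \<in> P \<Longrightarrow> p \<in> \<Omega> \<Longrightarrow> rep (eorb e p) \<in> \<Omega>"
  using rep_eorb eorb_closed by blast

lemma ek_unique:
  assumes "e \<in> P" "p \<in> \<Omega>" "va (tgt G e) (zscale k (w_tgt e)) (rep (eorb e p)) = p"
  shows "ek e p = k"
  unfolding ek_def
proof (rule the_equality)
  fix l assume "va (tgt G e) (zscale l (w_tgt e)) (rep (eorb e p)) = p"
  then have "va (tgt G e) (zscale (l - k) (w_tgt e)) (rep (eorb e p)) = rep (eorb e p)"
    using assms(3) va_eq_iff[OF P_ends(2)[OF assms(1)] rep_closed[OF assms(1,2)],
      of "zscale l (w_tgt e)" "zscale k (w_tgt e)"] by (simp add: zscale_diff)
  then show "l = k" using edge_free[OF assms(1) rep_closed[OF assms(1,2)]] unfolding va_def by fastforce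
qed (rule assms(3))

lemma ek:
  assumes "e \<in> P" "p \<in> \<Omega>"
  shows "va (tgt G e) (zscale (ek e p) (w_tgt e)) (rep (eorb e p)) = p"
proof -
  have "p \<in> eorb e (rep (eorb e p))"
    using eorb_eq[OF assms rep_eorb[OF assms]] eorb_self[OF assms] by simp
  then obtain k where "va (tgt G e) (zscale k (w_tgt e)) (rep (eorb e p)) = p"
    unfolding eorb_iff by blast
  then show ?thesis using ek_unique[OF assms] by simp
qed

lemma ek_va:
  assumes "e \<in> P" "p \<in> \<Omega>"
  shows "ek e (va (tgt G e) (w_tgt e) p) = ek e p + 1"
proof (rule ek_unique[OF assms(1) va_closed[OF P_ends(2)[OF assms(1)] assms(2)]])
  have "eorb e (va (tgt G e) (w_tgt e) p) = eorb e p" using eorb_va[OF assms, of 1] by simp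
  moreover have "zscale (ek e p + 1) (w_tgt e) = w_tgt e + zscale (ek e p) (w_tgt e)"
    by (simp add: zscale_add add.commute)
  ultimately show "va (tgt G e) (zscale (ek e p + 1) (w_tgt e)) (rep (eorb e (va (tgt G e) (w_tgt e) p))) =
      va (tgt G e) (w_tgt e) p"
    using va_add[OF P_ends(2)[OF assms(1)] rep_closed[OF assms]] ek[OF assms] by simp
qed

text \<open>The edge relation for powers, read on points of \<Omega>.\<close>

lemma t_va:
  assumes "e \<in> P" "p \<in> \<Omega>"
  shows "act (t e) (va (tgt G e) (zscale k (w_tgt e)) p) = va (src G e) (zscale k (w_src e)) (act (t e) p)"
proof -
  note c = i_closed[OF P_ends(1)[OF assms(1)]] i_closed[OF P_ends(2)[OF assms(1)]] t_closed[OF assms(1)]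
  have "i (src G e) (w_src e) = t e \<otimes> i (tgt G e) (w_tgt e) \<otimes> inv t e"
    using t_conj[OF assms(1)] c by (simp add: inv_solve_right)
  then have "i (src G e) (zscale k (w_src e)) = t e \<otimes> i (tgt G e) (zscale k (w_tgt e)) \<otimes> inv t e"
    using c int_pow_conjugate by (simp add: Z2_hom_zscale[OF i_hom] P_ends[OF assms(1)])
  then have "i (src G e) (zscale k (w_src e)) \<otimes> t e = t e \<otimes> i (tgt G e) (zscale k (w_tgt e))"
    using c by (simp add: m_assoc)
  then show ?thesis using c assms(2) unfolding va_def by (simp flip: act_mult)
qed

text \<open>The value \<open>b\<close> is prescribed at the representative of each edge orbit, where
  \<open>ek\<close> is \<open>0\<close>. The edge relation then forces the value at every other
  point of the orbit, and this is the forced value; freeness of the edge action makes the exponent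
  \<open>ek\<close> well defined.\<close>

definition edge_cocycle :: "('l, 'n) monoid_scheme \<Rightarrow> ('v \<Rightarrow> 'o set \<Rightarrow> 'l) \<Rightarrow> ('e \<Rightarrow> 'o set \<Rightarrow> 'l) \<Rightarrow> 'e \<Rightarrow> 'o \<Rightarrow> 'l" where
  "edge_cocycle \<Lambda> a b e p =
    a (src G e) (orb (src G e) (act (t e) p)) [^]\<^bsub>\<Lambda>\<^esub>
      \<kappa> (src G e) (zscale (ek e p) (w_src e)) (act (t e) (rep (eorb e p))) \<otimes>\<^bsub>\<Lambda>\<^esub>
    b e (eorb e p) \<otimes>\<^bsub>\<Lambda>\<^esub>
    inv\<^bsub>\<Lambda>\<^esub> (a (tgt G e) (orb (tgt G e) p) [^]\<^bsub>\<Lambda>\<^esub> \<kappa> (tgt G e) (zscale (ek e p) (w_tgt e)) (rep (eorb e p)))"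

text \<open>The permutational wreath product. The first function is evaluated at the point moved by
  the second group element, so that a homomorphism \<open>\<lambda>h. (h, c h)\<close> is the same
  as a cocycle \<open>c\<close>. Extensional functions make agreement on \<Omega> an
  equality.\<close>

definition wreath :: "('l, 'n) monoid_scheme \<Rightarrow> ('h \<times> ('o \<Rightarrow> 'l)) monoid" where
  "wreath \<Lambda> = \<lparr>carrier = carrier H \<times> (\<Omega> \<rightarrow>\<^sub>E carrier \<Lambda>),
    mult = (\<lambda>(g, c) (h, d). (g \<otimes> h, \<lambda>p\<in>\<Omega>. c (act h p) \<otimes>\<^bsub>\<Lambda>\<^esub> d p)),
    one = (\<one>, \<lambda>p\<in>\<Omega>. \<one>\<^bsub>\<Lambda>\<^esub>)\<rparr>"

lemma group_wreath:
  assumes "group \<Lambda>" shows "group (wreath \<Lambda>)"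
proof -
  interpret L: group \<Lambda> by fact
  have app: "c p \<in> carrier \<Lambda>" if "c \<in> \<Omega> \<rightarrow>\<^sub>E carrier \<Lambda>" "p \<in> \<Omega>" for c p
    using that by (rule PiE_mem)
  show ?thesis
  proof (rule groupI)
    fix x assume "x \<in> carrier (wreath \<Lambda>)"
    then obtain g c where x: "x = (g, c)" "g \<in> carrier H" "c \<in> \<Omega> \<rightarrow>\<^sub>E carrier \<Lambda>" by (auto simp: wreath_def)
    have cp: "c p \<in> carrier \<Lambda>" if "p \<in> \<Omega>" for p using x that by auto
    have "c p = undefined" if "p \<notin> \<Omega>" for p using x that by (auto simp: PiE_def extensional_def)
    then have c: "(\<lambda>p\<in>\<Omega>. c p) = c" by (auto simp: fun_eq_iff)
    show "\<one>\<^bsub>wreath \<Lambda>\<^esub> \<otimes>\<^bsub>wreath \<Lambda>\<^esub> x = x"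
      using x cp act_closed by (auto simp: wreath_def c cong: restrict_cong)
    have "act (inv g) (act g p) = p" if "p \<in> \<Omega>" for p
      using x that by (simp flip: act_mult add: act_one)
    then have "(inv g, \<lambda>p\<in>\<Omega>. inv\<^bsub>\<Lambda>\<^esub> c (act (inv g) p)) \<otimes>\<^bsub>wreath \<Lambda>\<^esub> x = \<one>\<^bsub>wreath \<Lambda>\<^esub>"
      using x cp act_closed by (auto simp: wreath_def cong: restrict_cong)
    moreover have "(inv g, \<lambda>p\<in>\<Omega>. inv\<^bsub>\<Lambda>\<^esub> c (act (inv g) p)) \<in> carrier (wreath \<Lambda>)"
      using x cp act_closed by (auto simp: wreath_def)
    ultimately show "\<exists>y\<in>carrier (wreath \<Lambda>). y \<otimes>\<^bsub>wreath \<Lambda>\<^esub> x = \<one>\<^bsub>wreath \<Lambda>\<^esub>" by blast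
  qed (use act_closed act_mult act_one in \<open>auto simp: wreath_def m_assoc L.m_assoc app intro!: restrict_ext\<close>)
qed

text \<open>A step by \<open>w_tgt e\<close> raises \<open>ek\<close> by one and changes none of the
  orbits involved, so by \<open>\<kappa>_add\<close> both exponents grow by those of a single step.
  This is the relation required by \<open>gauge\<close> in \<open>wreath \<Lambda>\<close>.\<close>

lemma edge_cocycle_step:
  assumes "group \<Lambda>" and a: "\<And>v O'. a v O' \<in> carrier \<Lambda>" and b: "\<And>e Q. b e Q \<in> carrier \<Lambda>"
    and e: "e \<in> P" and p: "p \<in> \<Omega>"
  shows "edge_cocycle \<Lambda> a b e (va (tgt G e) (w_tgt e) p) \<otimes>\<^bsub>\<Lambda>\<^esub>
      a (tgt G e) (orb (tgt G e) p) [^]\<^bsub>\<Lambda>\<^esub> \<kappa> (tgt G e) (w_tgt e) p =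
    a (src G e) (orb (src G e) (act (t e) p)) [^]\<^bsub>\<Lambda>\<^esub> \<kappa> (src G e) (w_src e) (act (t e) p) \<otimes>\<^bsub>\<Lambda>\<^esub>
      edge_cocycle \<Lambda> a b e p"
proof -
  interpret L: group \<Lambda> by fact
  note v = P_ends[OF e]
  let ?p' = "va (tgt G e) (w_tgt e) p" and ?q = "rep (eorb e p)"
  let ?s = "a (src G e) (orb (src G e) (act (t e) p))" and ?t = "a (tgt G e) (orb (tgt G e) p)"
  have q: "?q \<in> \<Omega>" "act (t e) ?q \<in> \<Omega>" using rep_closed[OF e p] act_closed t_closed[OF e] by auto
  have tp: "act (t e) p \<in> \<Omega>" using p act_closed t_closed[OF e] by auto
  have eorb': "eorb e ?p' = eorb e p" using eorb_va[OF e p, of 1] by simp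
  have orb': "orb (tgt G e) ?p' = orb (tgt G e) p" using orb_va[OF v(2) p] .
  have "act (t e) ?p' = va (src G e) (w_src e) (act (t e) p)" using t_va[OF e p, of 1] by simp
  then have orb'': "orb (src G e) (act (t e) ?p') = orb (src G e) (act (t e) p)" using orb_va[OF v(1) tp] by simp
  have z1: "zscale (ek e p + 1) x = x + zscale (ek e p) x" for x by (simp add: zscale_add add.commute)
  have "va (src G e) (zscale (ek e p) (w_src e)) (act (t e) ?q) = act (t e) p"
    using t_va[OF e q(1), of "ek e p"] ek[OF e p] by simp
  then have k1: "\<kappa> (src G e) (zscale (ek e p + 1) (w_src e)) (act (t e) ?q) =
      \<kappa> (src G e) (w_src e) (act (t e) p) + \<kappa> (src G e) (zscale (ek e p) (w_src e)) (act (t e) ?q)"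
    using \<kappa>_add[OF v(1) q(2), of "w_src e" "zscale (ek e p) (w_src e)"] by (simp add: z1)
  have k2: "\<kappa> (tgt G e) (zscale (ek e p + 1) (w_tgt e)) ?q =
      \<kappa> (tgt G e) (w_tgt e) p + \<kappa> (tgt G e) (zscale (ek e p) (w_tgt e)) ?q"
    using \<kappa>_add[OF v(2) q(1), of "w_tgt e" "zscale (ek e p) (w_tgt e)"] ek[OF e p] by (simp add: z1)
  have cancel: "inv\<^bsub>\<Lambda>\<^esub> (x \<otimes>\<^bsub>\<Lambda>\<^esub> y) \<otimes>\<^bsub>\<Lambda>\<^esub> x = inv\<^bsub>\<Lambda>\<^esub> y" if "x \<in> carrier \<Lambda>" "y \<in> carrier \<Lambda>" for x y
    using that by (simp add: L.inv_mult_group L.m_assoc)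
  show ?thesis
    unfolding edge_cocycle_def eorb' orb' orb'' ek_va[OF e p] k1 k2
    using a b by (simp add: L.int_pow_mult L.m_assoc cancel)
qed

text \<open>The cocycle is the second component of a homomorphism from \<open>H\<close> to \<open>wreath \<Lambda>\<close> whose first
  component is the identity.\<close>

lemma cocycle_exists:
  assumes "group \<Lambda>" and a: "\<And>v O'. a v O' \<in> carrier \<Lambda>" and b: "\<And>e Q. b e Q \<in> carrier \<Lambda>"
  obtains c U where
    "\<And>h p. h \<in> carrier H \<Longrightarrow> p \<in> \<Omega> \<Longrightarrow> c h p \<in> carrier \<Lambda>"
    "\<And>g h p. g \<in> carrier H \<Longrightarrow> h \<in> carrier H \<Longrightarrow> p \<in> \<Omega> \<Longrightarrow> c (g \<otimes> h) p = c g (act h p) \<otimes>\<^bsub>\<Lambda>\<^esub> c h p"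
    "\<And>v p. v \<in> verts G \<Longrightarrow> p \<in> \<Omega> \<Longrightarrow> U v p \<in> carrier \<Lambda>"
    "\<And>p. p \<in> \<Omega> \<Longrightarrow> U root p = \<one>\<^bsub>\<Lambda>\<^esub>"
    "\<And>v x p. v \<in> verts G \<Longrightarrow> p \<in> \<Omega> \<Longrightarrow>
      c (i v x) p \<otimes>\<^bsub>\<Lambda>\<^esub> U v p = U v (va v x p) \<otimes>\<^bsub>\<Lambda>\<^esub> a v (orb v p) [^]\<^bsub>\<Lambda>\<^esub> \<kappa> v x p"
    "\<And>e p. e \<in> P \<Longrightarrow> p \<in> \<Omega> \<Longrightarrow>
      c (t e) p \<otimes>\<^bsub>\<Lambda>\<^esub> U (tgt G e) p = U (src G e) (act (t e) p) \<otimes>\<^bsub>\<Lambda>\<^esub> edge_cocycle \<Lambda> a b e p"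
proof -
  interpret L: group \<Lambda> by fact
  let ?W = "wreath \<Lambda>"
  interpret W: group ?W using group_wreath[OF \<open>group \<Lambda>\<close>] .
  define j where "j v x = (i v x, \<lambda>p\<in>\<Omega>. a v (orb v p) [^]\<^bsub>\<Lambda>\<^esub> \<kappa> v x p)" for v x
  define d where "d e = (t e, \<lambda>p\<in>\<Omega>. edge_cocycle \<Lambda> a b e p)" for e
  have W_mult: "(g, c) \<otimes>\<^bsub>?W\<^esub> (h, c') = (g \<otimes> h, \<lambda>p\<in>\<Omega>. c (act h p) \<otimes>\<^bsub>\<Lambda>\<^esub> c' p)" for g c h c'
    by (simp add: wreath_def)
  have W_carrier: "(g, c) \<in> carrier ?W \<longleftrightarrow> g \<in> carrier H \<and> c \<in> \<Omega> \<rightarrow>\<^sub>E carrier \<Lambda>" for g c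
    by (simp add: wreath_def)
  have ec: "edge_cocycle \<Lambda> a b e p \<in> carrier \<Lambda>" for e p
    using a b by (simp add: edge_cocycle_def)
  have j: "Z2_hom ?W (j v)" if "v \<in> verts G" for v
    unfolding Z2_hom_def
  proof (intro conjI allI)
    show "j v x \<in> carrier ?W" for x using i_closed[OF that] a by (auto simp: j_def W_carrier)
    show "j v (x + y) = j v x \<otimes>\<^bsub>?W\<^esub> j v y" for x y
      unfolding j_def W_mult
      using Z2_hom_add[OF i_hom[OF that]] va_closed[OF that] orb_va[OF that] \<kappa>_add[OF that] a
      by (auto simp: va_def[symmetric] L.int_pow_mult cong: restrict_cong)
  qed
  have dc: "d e \<in> carrier ?W" if "e \<in> P" for e
    using t_closed[OF that] ec by (auto simp: d_def W_carrier)
  have "d e \<otimes>\<^bsub>?W\<^esub> j (tgt G e) (w_tgt e) = j (src G e) (w_src e) \<otimes>\<^bsub>?W\<^esub> d e" if "e \<in> P" for e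
    unfolding j_def d_def W_mult prod.inject
  proof (intro conjI restrict_ext)
    fix p assume p: "p \<in> \<Omega>"
    have "va (tgt G e) (w_tgt e) p \<in> \<Omega>" "act (t e) p \<in> \<Omega>"
      using va_closed[OF P_ends(2)[OF that] p] act_closed[OF t_closed[OF that] p] by auto
    then show "(\<lambda>p\<in>\<Omega>. edge_cocycle \<Lambda> a b e p) (act (i (tgt G e) (w_tgt e)) p) \<otimes>\<^bsub>\<Lambda>\<^esub>
        (\<lambda>p\<in>\<Omega>. a (tgt G e) (orb (tgt G e) p) [^]\<^bsub>\<Lambda>\<^esub> \<kappa> (tgt G e) (w_tgt e) p) p =
      (\<lambda>p\<in>\<Omega>. a (src G e) (orb (src G e) p) [^]\<^bsub>\<Lambda>\<^esub> \<kappa> (src G e) (w_src e) p) (act (t e) p) \<otimes>\<^bsub>\<Lambda>\<^esub>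
        (\<lambda>p\<in>\<Omega>. edge_cocycle \<Lambda> a b e p) p"
      using edge_cocycle_step[where a = a and b = b, OF \<open>group \<Lambda>\<close> a b that p] p
      by (simp add: va_def[symmetric])
  qed (rule t_conj[OF that])
  then obtain \<Phi> u where \<Phi>: "\<Phi> \<in> hom H ?W" "u \<in> verts G \<rightarrow> carrier ?W" "u root = \<one>\<^bsub>?W\<^esub>"
    "\<And>v x. v \<in> verts G \<Longrightarrow> \<Phi> (i v x) = u v \<otimes>\<^bsub>?W\<^esub> j v x \<otimes>\<^bsub>?W\<^esub> inv\<^bsub>?W\<^esub> u v"
    "\<And>e. e \<in> P \<Longrightarrow> \<Phi> (t e) = u (src G e) \<otimes>\<^bsub>?W\<^esub> d e \<otimes>\<^bsub>?W\<^esub> inv\<^bsub>?W\<^esub> u (tgt G e)"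
    using gauge[where j = j and d = d, OF W.is_group j dc] by blast
  have uc: "u v \<in> carrier ?W" if "v \<in> verts G" for v using \<Phi>(2) that by auto
  have jc: "j v x \<in> carrier ?W" if "v \<in> verts G" for v x using Z2_hom_closed[OF j[OF that]] .
  have \<Phi>_i: "\<Phi> (i v x) \<otimes>\<^bsub>?W\<^esub> u v = u v \<otimes>\<^bsub>?W\<^esub> j v x" if "v \<in> verts G" for v x
    using \<Phi>(4)[OF that] uc[OF that] jc[OF that] by (simp add: W.m_assoc)
  have \<Phi>_t: "\<Phi> (t e) \<otimes>\<^bsub>?W\<^esub> u (tgt G e) = u (src G e) \<otimes>\<^bsub>?W\<^esub> d e" if "e \<in> P" for e
    using \<Phi>(5)[OF that] uc[OF P_ends(1)[OF that]] uc[OF P_ends(2)[OF that]] dc[OF that] by (simp add: W.m_assoc)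
  have \<Phi>c: "\<Phi> h \<in> carrier ?W" if "h \<in> carrier H" for h using \<Phi>(1) that by (auto simp: hom_def)
  have \<Phi>_mult: "\<Phi> (g \<otimes> h) = \<Phi> g \<otimes>\<^bsub>?W\<^esub> \<Phi> h" if "g \<in> carrier H" "h \<in> carrier H" for g h
    using \<Phi>(1) that by (auto simp: hom_def)
  have fst_mult: "fst (x \<otimes>\<^bsub>?W\<^esub> y) = fst x \<otimes> fst y" for x y by (simp add: wreath_def split_beta)
  have fst_c: "fst x \<in> carrier H" if "x \<in> carrier ?W" for x using that by (auto simp: wreath_def)
  have \<Phi>_one: "\<Phi> \<one> = \<one>\<^bsub>?W\<^esub>" using \<Phi>(1) is_group W.is_group by (simp add: hom_one)
  \<comment> \<open>The correction by \<open>u v\<close> might change first components. It does not: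
    the tree letters are trivial in \<open>H\<close>, so the first component of \<open>u\<close> is
    constant along the tree and equal to its value at \<open>root\<close>.\<close>
  have fst_u: "fst (u v) = \<one>" if "v \<in> verts G" for v
  proof (rule tree_induct[OF _ _ that])
    show "fst (u root) = \<one>" by (simp add: \<Phi>(3) wreath_def)
    fix f assume f: "f \<in> edges T \<inter> P"
    then have fP: "f \<in> P" by simp
    have "u (tgt G f) = u (src G f) \<otimes>\<^bsub>?W\<^esub> d f"
      using \<Phi>_t[OF fP] t_tree[OF f] \<Phi>_one uc[OF P_ends(2)[OF fP]] by simp
    then have "fst (u (tgt G f)) = fst (u (src G f))"
      using t_tree[OF f] fst_c[OF uc[OF P_ends(1)[OF fP]]] by (simp add: fst_mult d_def)
    then show "fst (u (src G f)) = \<one> \<longleftrightarrow> fst (u (tgt G f)) = \<one>" by simp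
  qed
  \<comment> \<open>The projection of \<Phi> to \<open>H\<close> is the identity on generators,
    hence everywhere. Without this the second component would obey the cocycle law for a different
    action.\<close>
  have "{h \<in> carrier H. fst (\<Phi> h) = h} = carrier H"
  proof (rule generated)
    interpret \<Phi>: group_hom H ?W \<Phi> using \<Phi>(1) by unfold_locales
    show "subgroup {h \<in> carrier H. fst (\<Phi> h) = h} H"
    proof (rule subgroupI)
      have "fst (\<Phi> \<one>) = \<one>" by (simp add: wreath_def)
      then show "{h \<in> carrier H. fst (\<Phi> h) = h} \<noteq> {}" by (metis (mono_tags, lifting) empty_Collect_eq one_closed)
      fix h assume h: "h \<in> {h \<in> carrier H. fst (\<Phi> h) = h}"
      then have "fst (inv\<^bsub>?W\<^esub> \<Phi> h \<otimes>\<^bsub>?W\<^esub> \<Phi> h) = \<one>"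
        using \<Phi>c[of h] by (simp del: \<Phi>.hom_closed) (simp add: wreath_def)
      then have "fst (inv\<^bsub>?W\<^esub> \<Phi> h) \<otimes> h = \<one>" using h by (simp add: fst_mult)
      then have "fst (inv\<^bsub>?W\<^esub> \<Phi> h) = inv h"
        using h fst_c[OF W.inv_closed[OF \<Phi>c[of h]]] inv_equality[symmetric] by simp
      moreover have "\<Phi> (inv h) = inv\<^bsub>?W\<^esub> \<Phi> h" using h \<Phi>.hom_inv by simp
      ultimately show "inv h \<in> {h \<in> carrier H. fst (\<Phi> h) = h}" using h by simp
    qed (auto simp: fst_mult)
    show "i v x \<in> {h \<in> carrier H. fst (\<Phi> h) = h}" if "v \<in> verts G" for v x
    proof -
      have "fst (\<Phi> (i v x)) \<otimes> fst (u v) = fst (u v) \<otimes> fst (j v x)"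
        using \<Phi>_i[OF that] by (metis fst_mult)
      then show ?thesis using i_closed[OF that] fst_u[OF that] fst_c[OF \<Phi>c] by (simp add: j_def)
    qed
    show "t e \<in> {h \<in> carrier H. fst (\<Phi> h) = h}" if "e \<in> P" for e
    proof -
      have "fst (\<Phi> (t e)) \<otimes> fst (u (tgt G e)) = fst (u (src G e)) \<otimes> fst (d e)"
        using \<Phi>_t[OF that] by (metis fst_mult)
      then show ?thesis using t_closed[OF that] fst_u P_ends[OF that] fst_c[OF \<Phi>c] by (simp add: d_def)
    qed
  qed
  then have fst_\<Phi>: "fst (\<Phi> h) = h" if "h \<in> carrier H" for h using that by blast
  define c where "c h = snd (\<Phi> h)" for h
  define U where "U v = snd (u v)" for v
  have \<Phi>_eq: "\<Phi> h = (h, c h)" if "h \<in> carrier H" for h using fst_\<Phi>[OF that] by (simp add: c_def prod_eq_iff)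
  have u_eq: "u v = (\<one>, U v)" if "v \<in> verts G" for v using fst_u[OF that] by (simp add: U_def prod_eq_iff)
  show thesis
  proof
    show "c h p \<in> carrier \<Lambda>" if "h \<in> carrier H" "p \<in> \<Omega>" for h p
      using \<Phi>c[OF that(1)] that unfolding \<Phi>_eq[OF that(1)] W_carrier by auto
    show "c (g \<otimes> h) p = c g (act h p) \<otimes>\<^bsub>\<Lambda>\<^esub> c h p" if "g \<in> carrier H" "h \<in> carrier H" "p \<in> \<Omega>" for g h p
      using \<Phi>_mult[OF that(1,2)] that by (simp add: \<Phi>_eq W_mult)
    show "U v p \<in> carrier \<Lambda>" if "v \<in> verts G" "p \<in> \<Omega>" for v p
      using uc[OF that(1)] that unfolding u_eq[OF that(1)] W_carrier by auto
    show "U root p = \<one>\<^bsub>\<Lambda>\<^esub>" if "p \<in> \<Omega>" for p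
      using \<Phi>(3) that by (simp add: U_def wreath_def)
    show "c (i v x) p \<otimes>\<^bsub>\<Lambda>\<^esub> U v p = U v (va v x p) \<otimes>\<^bsub>\<Lambda>\<^esub> a v (orb v p) [^]\<^bsub>\<Lambda>\<^esub> \<kappa> v x p"
      if "v \<in> verts G" "p \<in> \<Omega>" for v x p
    proof -
      have "(\<lambda>p\<in>\<Omega>. c (i v x) (act \<one> p) \<otimes>\<^bsub>\<Lambda>\<^esub> U v p) =
        (\<lambda>p\<in>\<Omega>. U v (act (i v x) p) \<otimes>\<^bsub>\<Lambda>\<^esub> (\<lambda>p\<in>\<Omega>. a v (orb v p) [^]\<^bsub>\<Lambda>\<^esub> \<kappa> v x p) p)"
        using \<Phi>_i[OF that(1), of x] by (simp add: u_eq[OF that(1)] \<Phi>_eq[OF i_closed[OF that(1)]] j_def W_mult)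
      from fun_cong[OF this, of p] show ?thesis using that act_one by (simp add: va_def)
    qed
    show "c (t e) p \<otimes>\<^bsub>\<Lambda>\<^esub> U (tgt G e) p = U (src G e) (act (t e) p) \<otimes>\<^bsub>\<Lambda>\<^esub> edge_cocycle \<Lambda> a b e p"
      if "e \<in> P" "p \<in> \<Omega>" for e p
    proof -
      have "(\<lambda>p\<in>\<Omega>. c (t e) (act \<one> p) \<otimes>\<^bsub>\<Lambda>\<^esub> U (tgt G e) p) =
        (\<lambda>p\<in>\<Omega>. U (src G e) (act (t e) p) \<otimes>\<^bsub>\<Lambda>\<^esub> (\<lambda>p\<in>\<Omega>. edge_cocycle \<Lambda> a b e p) p)"
        using \<Phi>_t[OF that(1)]
        by (simp add: u_eq P_ends[OF that(1)] \<Phi>_eq[OF t_closed[OF that(1)]] d_def W_mult)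
      from fun_cong[OF this, of p] show ?thesis using that act_one by simp
    qed
  qed
qed

end

section \<open>The stabilizer of a point\<close>

lemma (in group) inv_cancel:
  assumes "a \<in> carrier G" "b \<in> carrier G"
  shows "inv a \<otimes> (a \<otimes> b) = b" "a \<otimes> (inv a \<otimes> b) = b"
  using assms by (simp_all add: m_assoc[symmetric])

lemma (in group) left_cancel:
  assumes "a \<in> carrier G" "b \<in> carrier G" "c \<in> carrier G"
  shows "a \<otimes> b = a \<otimes> c \<longleftrightarrow> b = c"
  using assms inv_cancel(1) by metis

context tubular_action
begin

text \<open>A choice of vertices of the tree above the vertices of the quotient graph, expressed by
  group elements. Values at sets that are not orbits are unconstrained.\<close>

definition lifts :: "('v \<Rightarrow> 'o set \<Rightarrow> 'h) \<Rightarrow> bool" where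
  "lifts g \<longleftrightarrow> (\<forall>v\<in>verts G. \<forall>p\<in>\<Omega>.
    g v (orb v p) \<in> carrier H \<and> act (g v (orb v p)) p0 = base (orb v p))"

text \<open>For every vertex a section of the orbit map \<open>\<lambda>h. act h p0\<close>. Points
  of one \<open>v\<close>-orbit share a lift, so their values differ by elements of the vertex
  group.\<close>

definition sec :: "('v \<Rightarrow> 'o set \<Rightarrow> 'h) \<Rightarrow> 'v \<Rightarrow> 'o \<Rightarrow> 'h" where
  "sec g v p = i v (r v p) \<otimes> g v (orb v p)"

text \<open>The Schreier generator of an edge: it is \<one> exactly when \<open>t e\<close> carries
  the section at the target end to the one at the source end.\<close>

definition edge_elt :: "('v \<Rightarrow> 'o set \<Rightarrow> 'h) \<Rightarrow> 'e \<Rightarrow> 'o \<Rightarrow> 'h" where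
  "edge_elt g e p = inv (sec g (src G e) (act (t e) p)) \<otimes> (t e \<otimes> sec g (tgt G e) p)"

definition fixer :: "'h set" where "fixer = {h \<in> carrier H. act h p0 = p0}"

lemma fixer_iff: "h \<in> fixer \<longleftrightarrow> h \<in> carrier H \<and> act h p0 = p0"
  by (simp add: fixer_def)

lemma act_inv: "h \<in> carrier H \<Longrightarrow> p \<in> \<Omega> \<Longrightarrow> act (inv h) (act h p) = p"
  by (simp flip: act_mult add: act_one)

lemma act_inv': "h \<in> carrier H \<Longrightarrow> p \<in> \<Omega> \<Longrightarrow> act h (act (inv h) p) = p"
  by (simp flip: act_mult add: act_one)

lemma subgroup_fixer: "subgroup fixer H"
proof (rule subgroupI)
  show "fixer \<noteq> {}" using act_one[OF p0] by (auto simp: fixer_def)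
  show "inv h \<in> fixer" if "h \<in> fixer" for h
    using that act_inv[of h p0] p0 by (auto simp: fixer_def)
qed (auto simp: fixer_def act_mult p0)

lemma lifts_closed: "lifts g \<Longrightarrow> v \<in> verts G \<Longrightarrow> p \<in> \<Omega> \<Longrightarrow> g v (orb v p) \<in> carrier H"
  and lifts_act: "lifts g \<Longrightarrow> v \<in> verts G \<Longrightarrow> p \<in> \<Omega> \<Longrightarrow> act (g v (orb v p)) p0 = base (orb v p)"
  by (auto simp: lifts_def)

lemma sec_closed: "lifts g \<Longrightarrow> v \<in> verts G \<Longrightarrow> p \<in> \<Omega> \<Longrightarrow> sec g v p \<in> carrier H"
  by (simp add: sec_def i_closed lifts_closed)

lemma sec_act: "lifts g \<Longrightarrow> v \<in> verts G \<Longrightarrow> p \<in> \<Omega> \<Longrightarrow> act (sec g v p) p0 = p"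
  using va_r[of v p] by (simp add: sec_def act_mult i_closed lifts_closed lifts_act p0 va_def)

lemma t_act_closed: "e \<in> P \<Longrightarrow> p \<in> \<Omega> \<Longrightarrow> act (t e) p \<in> \<Omega>"
  by (simp add: act_closed t_closed)

lemma edge_elt_fixer: "edge_elt g e p \<in> fixer" if "lifts g" "e \<in> P" "p \<in> \<Omega>"
proof -
  let ?s = "sec g (src G e) (act (t e) p)"
  have c: "?s \<in> carrier H" "sec g (tgt G e) p \<in> carrier H" "t e \<in> carrier H"
    using sec_closed[OF that(1)] P_ends[OF that(2)] that t_act_closed t_closed by auto
  have "act (edge_elt g e p) p0 = act (inv ?s) (act (t e) p)"
    using c p0 sec_act[OF that(1) P_ends(2)[OF that(2)] that(3)] act_closed
    by (simp add: edge_elt_def act_mult)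
  also have "\<dots> = p0"
    using act_inv[OF c(1) p0] sec_act[OF that(1) P_ends(1)[OF that(2)] t_act_closed[OF that(2,3)]] by simp
  finally show ?thesis using c by (simp add: fixer_def edge_elt_def)
qed

text \<open>An edge of the quotient graph has well-defined end points: they can be read off at the
  representative.\<close>

lemma rep_same_orbits:
  assumes "e \<in> P" "p \<in> \<Omega>"
  shows "orb (tgt G e) (rep (eorb e p)) = orb (tgt G e) p"
    "orb (src G e) (act (t e) (rep (eorb e p))) = orb (src G e) (act (t e) p)"
proof -
  let ?q = "rep (eorb e p)"
  have q: "?q \<in> \<Omega>" using rep_closed[OF assms] .
  show "orb (tgt G e) ?q = orb (tgt G e) p"
    using orb_va[OF P_ends(2)[OF assms(1)] q, of "zscale (ek e p) (w_tgt e)"] ek[OF assms] by simp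
  show "orb (src G e) (act (t e) ?q) = orb (src G e) (act (t e) p)"
    using orb_va[OF P_ends(1)[OF assms(1)] t_act_closed[OF assms(1) q], of "zscale (ek e p) (w_src e)"]
      t_va[OF assms(1) q, of "ek e p"] ek[OF assms] by simp
qed

lemma rep_rep: "e \<in> P \<Longrightarrow> p \<in> \<Omega> \<Longrightarrow> eorb e (rep (eorb e p)) = eorb e p"
  using eorb_eq rep_eorb by blast

text \<open>The pairs \<open>(v, orb v p)\<close> are the vertices, and the pairs \<open>(e, eorb e p)\<close> the edges of a graph, the
  quotient of the Bass--Serre tree by the stabilizer of \<open>p0\<close>.\<close>

lemma orbits_connected:
  assumes root: "R root (orb root p0)"
    and edge: "\<And>e p. e \<in> P \<Longrightarrow> p \<in> \<Omega> \<Longrightarrow> rep (eorb e p) = p \<Longrightarrow>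
      R (src G e) (orb (src G e) (act (t e) p)) \<longleftrightarrow> R (tgt G e) (orb (tgt G e) p)"
    and v: "v \<in> verts G" and p: "p \<in> \<Omega>"
  shows "R v (orb v p)"
proof -
  have edge': "R (src G e) (orb (src G e) (act (t e) p)) \<longleftrightarrow> R (tgt G e) (orb (tgt G e) p)"
    if "e \<in> P" "p \<in> \<Omega>" for e p
    using edge[OF that(1) rep_closed[OF that]] rep_same_orbits[OF that] by (simp add: rep_rep[OF that])
  \<comment> \<open>Tree letters are trivial, so the edges above the tree join the orbits of one
    fixed point under all the vertex groups.\<close>
  have same: "R v (orb v p) \<longleftrightarrow> R root (orb root p)" if "v \<in> verts G" "p \<in> \<Omega>" for v p
  proof -
    have "\<forall>p\<in>\<Omega>. R v (orb v p) \<longleftrightarrow> R root (orb root p)"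
    proof (rule tree_induct[OF _ _ that(1)])
      fix f assume f: "f \<in> edges T \<inter> P"
      then have "R (src G f) (orb (src G f) p) \<longleftrightarrow> R (tgt G f) (orb (tgt G f) p)" if "p \<in> \<Omega>" for p
        using edge'[of f p] t_tree[OF f] that by (simp add: act_one)
      then show "(\<forall>p\<in>\<Omega>. R (src G f) (orb (src G f) p) \<longleftrightarrow> R root (orb root p)) \<longleftrightarrow>
          (\<forall>p\<in>\<Omega>. R (tgt G f) (orb (tgt G f) p) \<longleftrightarrow> R root (orb root p))" by simp
    qed simp
    then show ?thesis using that(2) by simp
  qed
  \<comment> \<open>It remains to move the point. A vertex element keeps it in its
    \<open>v\<close>-orbit and a letter takes it across an edge, so the truth of \<open>R\<close> at
    its root orbit is unchanged under every generator.\<close>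
  let ?B = "{h \<in> carrier H. \<forall>p\<in>\<Omega>. R root (orb root (act h p)) \<longleftrightarrow> R root (orb root p)}"
  have "?B = carrier H"
  proof (rule generated)
    show "subgroup ?B H"
    proof (rule subgroupI)
      show "?B \<noteq> {}" using act_one by auto
      fix h assume h: "h \<in> ?B"
      then have "R root (orb root (act (inv h) p)) \<longleftrightarrow> R root (orb root p)" if "p \<in> \<Omega>" for p
        using act_inv'[of h p] act_closed[of "inv h" p] that by fastforce
      then show "inv h \<in> ?B" using h by simp
    qed (auto simp: act_mult act_closed)
    show "i v x \<in> ?B" if "v \<in> verts G" for v x
    proof -
      have "R root (orb root (act (i v x) p)) \<longleftrightarrow> R root (orb root p)" if "p \<in> \<Omega>" for p
        using same[OF \<open>v \<in> verts G\<close> that] same[OF \<open>v \<in> verts G\<close> va_closed[OF \<open>v \<in> verts G\<close> that, of x]]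
          orb_va[OF \<open>v \<in> verts G\<close> that] by (simp add: va_def)
      then show ?thesis using i_closed[OF that] by simp
    qed
    show "t e \<in> ?B" if "e \<in> P" for e
      using that edge'[OF that] same P_ends[OF that] t_act_closed[OF that] t_closed[OF that] by simp
  qed
  moreover obtain h where "h \<in> carrier H" "act h p0 = p" using transitive[OF p] by blast
  ultimately have "R root (orb root p)" using root p0 by blast
  then show ?thesis using same[OF v p] by simp
qed

section \<open>A spanning tree of the quotient graph\<close>

definition vertex_orbits :: "('v \<times> 'o set) set" where
  "vertex_orbits = (SIGMA v:verts G. orb v ` \<Omega>)"

definition edge_orbits :: "('e \<times> 'o set) set" where
  "edge_orbits = (SIGMA e:P. eorb e ` \<Omega>)"

lemma finite_vertex_orbits': "finite vertex_orbits"
  unfolding vertex_orbits_def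
  using finite_vertex_orbits finite_verts by (intro finite_SigmaI) (simp_all add: orb_def[abs_def] va_def)

lemma finite_edge_orbits': "finite edge_orbits"
  unfolding edge_orbits_def
  using finite_edge_orbits finite_P by (intro finite_SigmaI) (simp_all add: eorb_def[abs_def] va_def)

lemma vertex_orbits_iff: "(v, O') \<in> vertex_orbits \<longleftrightarrow> v \<in> verts G \<and> (\<exists>p\<in>\<Omega>. O' = orb v p)"
  by (auto simp: vertex_orbits_def)

lemma root_orbit: "(root, orb root p0) \<in> vertex_orbits"
  using root p0 by (auto simp: vertex_orbits_iff)

lemma base_root: "base (orb root p0) = p0"
  using orb_self[OF root p0] by (simp add: base_def)

text \<open>\<open>spans A g\<close> says that the edges inside \<open>A\<close> with trivial \<open>edge_elt\<close> connect all of \<open>A\<close>.\<close>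

definition spans :: "('v \<times> 'o set) set \<Rightarrow> ('v \<Rightarrow> 'o set \<Rightarrow> 'h) \<Rightarrow> bool" where
  "spans A g \<longleftrightarrow> (\<forall>R. R (root, orb root p0) \<longrightarrow>
    (\<forall>e\<in>P. \<forall>p\<in>\<Omega>. rep (eorb e p) = p \<and> (src G e, orb (src G e) (act (t e) p)) \<in> A \<and>
      (tgt G e, orb (tgt G e) p) \<in> A \<and> edge_elt g e p = \<one> \<longrightarrow>
      (R (src G e, orb (src G e) (act (t e) p)) \<longleftrightarrow> R (tgt G e, orb (tgt G e) p))) \<longrightarrow>
    (\<forall>x\<in>A. R x))"

text \<open>The lift is altered only at an orbit outside \<open>A\<close>, so edges inside
  \<open>A\<close> keep their \<open>edge_elt\<close>; the edge at \<open>p\<close> attaches the new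
  orbit.\<close>

lemma spans_insert:
  assumes g: "spans A g" and x: "(v, O') \<notin> A"
    and e: "e \<in> P" "p \<in> \<Omega>" "rep (eorb e p) = p" "edge_elt (g(v := (g v)(O' := h))) e p = \<one>"
    and ends: "(src G e, orb (src G e) (act (t e) p)) \<in> A \<and> (v, O') = (tgt G e, orb (tgt G e) p) \<or>
      (tgt G e, orb (tgt G e) p) \<in> A \<and> (v, O') = (src G e, orb (src G e) (act (t e) p))"
  shows "spans (insert (v, O') A) (g(v := (g v)(O' := h)))"
  unfolding spans_def
proof (intro allI impI)
  let ?g = "g(v := (g v)(O' := h))"
  fix R
  assume root: "R (root, orb root p0)"
    and R: "\<forall>e\<in>P. \<forall>p\<in>\<Omega>. rep (eorb e p) = p \<and>
      (src G e, orb (src G e) (act (t e) p)) \<in> insert (v, O') A \<and>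
      (tgt G e, orb (tgt G e) p) \<in> insert (v, O') A \<and> edge_elt ?g e p = \<one> \<longrightarrow>
      (R (src G e, orb (src G e) (act (t e) p)) \<longleftrightarrow> R (tgt G e, orb (tgt G e) p))"
  have same: "?g v' (orb v' q) = g v' (orb v' q)" if "(v', orb v' q) \<in> A" for v' q
    using that x by auto
  have "edge_elt ?g f q = edge_elt g f q"
    if "(src G f, orb (src G f) (act (t f) q)) \<in> A" "(tgt G f, orb (tgt G f) q) \<in> A" for f q
    unfolding edge_elt_def sec_def same[OF that(1)] same[OF that(2)] ..
  then have A: "\<forall>x\<in>A. R x"
    using g[unfolded spans_def, rule_format, of R] root R by (metis insertCI)
  have "R (src G e, orb (src G e) (act (t e) p)) \<longleftrightarrow> R (tgt G e, orb (tgt G e) p)"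
    using R e ends by (metis insertCI)
  then show "\<forall>x\<in>insert (v, O') A. R x" using A ends by auto
qed

text \<open>By \<open>orbits_connected\<close> some edge has exactly one end in \<open>A\<close>.
  The lift at its other end may be redefined so that the edge becomes trivial.\<close>

lemma spans_extend:
  assumes g: "lifts g" "spans A g" "g root (orb root p0) = \<one>" and A: "A \<subset> vertex_orbits" "(root, orb root p0) \<in> A"
  obtains x g' where "x \<in> vertex_orbits - A" "lifts g'" "spans (insert x A) g'" "g' root (orb root p0) = \<one>"
proof -
  note out = that
  have "\<exists>e\<in>P. \<exists>p\<in>\<Omega>. rep (eorb e p) = p \<and>
      ((src G e, orb (src G e) (act (t e) p)) \<in> A) \<noteq> ((tgt G e, orb (tgt G e) p) \<in> A)"
  proof (rule ccontr)
    assume "\<not> ?thesis"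
    then have "(v, orb v p) \<in> A" if "v \<in> verts G" "p \<in> \<Omega>" for v p
      using orbits_connected[of "\<lambda>v O'. (v, O') \<in> A", OF A(2) _ that] by blast
    then show False using A(1) by (auto simp: vertex_orbits_def)
  qed
  then obtain e p where e: "e \<in> P" and p: "p \<in> \<Omega>" "rep (eorb e p) = p"
    and ends: "((src G e, orb (src G e) (act (t e) p)) \<in> A) \<noteq> ((tgt G e, orb (tgt G e) p) \<in> A)"
    by blast
  let ?s = "src G e" and ?t = "tgt G e" and ?p = "act (t e) p"
  note v = P_ends[OF e] and tp = t_act_closed[OF e p(1)] and tc = t_closed[OF e]
  note c = i_closed[OF v(1)] i_closed[OF v(2)] sec_closed[OF g(1) v(1) tp] sec_closed[OF g(1) v(2) p(1)]
  have extend: thesis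
    if x: "(v, orb v q) \<notin> A" "v \<in> verts G" "q \<in> \<Omega>" and h: "h \<in> carrier H" "act h p0 = base (orb v q)"
      and one: "edge_elt (g(v := (g v)(orb v q := h))) e p = \<one>"
      and ends': "(?s, orb ?s ?p) \<in> A \<and> (v, orb v q) = (?t, orb ?t p) \<or> (?t, orb ?t p) \<in> A \<and> (v, orb v q) = (?s, orb ?s ?p)"
    for v q h
  proof (rule out)
    show "(v, orb v q) \<in> vertex_orbits - A" using x by (auto simp: vertex_orbits_def)
    show "lifts (g(v := (g v)(orb v q := h)))" using g(1) h by (auto simp: lifts_def)
    show "spans (insert (v, orb v q) A) (g(v := (g v)(orb v q := h)))"
      by (rule spans_insert[OF g(2) x(1) e p one ends'])
    show "(g(v := (g v)(orb v q := h))) root (orb root p0) = \<one>" using g(3) A(2) x(1) by auto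
  qed
  show thesis
  proof (cases "(?t, orb ?t p) \<in> A")
    case True
    \<comment> \<open>The outer end is the source. With this lift the section there equals
      \<open>t e \<otimes> sec g ?t p\<close>, so \<open>edge_elt\<close> is \<one>. The other case
      solves the same equation for the target.\<close>
    let ?h = "inv (i ?s (r ?s ?p)) \<otimes> (t e \<otimes> sec g ?t p)"
    let ?g = "g(?s := (g ?s)(orb ?s ?p := ?h))"
    have "sec ?g ?t p = sec g ?t p" using True ends by (auto simp: sec_def)
    moreover have "sec ?g ?s ?p = t e \<otimes> sec g ?t p" using c tc by (simp add: sec_def[of ?g] inv_cancel)
    ultimately have "edge_elt ?g e p = \<one>" using c tc by (simp add: edge_elt_def)
    moreover have "act ?h p0 = base (orb ?s ?p)"
    proof -
      have "act ?h p0 = act (inv (i ?s (r ?s ?p))) ?p"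
        using c tc p0 p(1) tp sec_act[OF g(1) v(2) p(1)] by (simp add: act_mult)
      also have "\<dots> = act (inv (i ?s (r ?s ?p))) (act (i ?s (r ?s ?p)) (base (orb ?s ?p)))"
        using va_r[OF v(1) tp] by (simp add: va_def)
      also have "\<dots> = base (orb ?s ?p)" using c base_closed[OF v(1) tp] by (simp add: act_inv)
      finally show ?thesis .
    qed
    ultimately show thesis using extend[of ?s ?p ?h] True ends v tp c tc by auto
  next
    case False
    let ?h = "inv (i ?t (r ?t p)) \<otimes> (inv (t e) \<otimes> sec g ?s ?p)"
    let ?g = "g(?t := (g ?t)(orb ?t p := ?h))"
    have "sec ?g ?s ?p = sec g ?s ?p" using False ends by (auto simp: sec_def)
    moreover have "sec ?g ?t p = inv (t e) \<otimes> sec g ?s ?p" using c tc by (simp add: sec_def[of ?g] inv_cancel)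
    ultimately have "edge_elt ?g e p = \<one>" using c tc by (simp add: edge_elt_def inv_cancel)
    moreover have "act ?h p0 = base (orb ?t p)"
    proof -
      have "act ?h p0 = act (inv (i ?t (r ?t p))) p"
        using c tc p0 p(1) tp sec_act[OF g(1) v(1) tp] by (simp add: act_mult act_inv)
      also have "\<dots> = act (inv (i ?t (r ?t p))) (act (i ?t (r ?t p)) (base (orb ?t p)))"
        using va_r[OF v(2) p(1)] by (simp add: va_def)
      also have "\<dots> = base (orb ?t p)" using c base_closed[OF v(2) p(1)] by (simp add: act_inv)
      finally show ?thesis .
    qed
    ultimately show thesis using extend[of ?t p ?h] False ends v p c tc by auto
  qed
qed

text \<open>Orbits are added one at a time, starting from the root orbit with lift \<one>;
  finiteness of \<open>vertex_orbits\<close> ends the process with all of them.\<close>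

lemma spanning_lift:
  obtains g where "lifts g" "g root (orb root p0) = \<one>" "spans vertex_orbits g"
proof -
  have "\<exists>A g. A \<subseteq> vertex_orbits \<and> card A = Suc n \<and> (root, orb root p0) \<in> A \<and> lifts g \<and>
      g root (orb root p0) = \<one> \<and> spans A g" if "Suc n \<le> card vertex_orbits" for n
    using that
  proof (induction n)
    case 0
    define g where "g v O' = (if (v, O') = (root, orb root p0) then \<one>
      else SOME h. h \<in> carrier H \<and> act h p0 = base O')" for v O'
    have "lifts g"
      unfolding lifts_def
    proof (intro ballI)
      fix v p assume v: "v \<in> verts G" "p \<in> \<Omega>"
      show "g v (orb v p) \<in> carrier H \<and> act (g v (orb v p)) p0 = base (orb v p)"
      proof (cases "(v, orb v p) = (root, orb root p0)")
        case True
        then have "g v (orb v p) = \<one>" unfolding g_def by (rule if_P)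
        moreover have "orb v p = orb root p0" using True by blast
        ultimately show ?thesis using base_root act_one[OF p0] by simp
      next
        case False
        let ?P = "\<lambda>h. h \<in> carrier H \<and> act h p0 = base (orb v p)"
        have "\<exists>h. ?P h" using transitive[OF base_closed[OF v]] by blast
        from someI_ex[OF this] have "?P (SOME h. ?P h)" .
        moreover have "g v (orb v p) = (SOME h. h \<in> carrier H \<and> act h p0 = base (orb v p))"
          unfolding g_def using False by (rule if_not_P)
        ultimately show ?thesis by (simp only:)
      qed
    qed
    moreover have "g root (orb root p0) = \<one>" by (simp add: g_def)
    moreover have "spans {(root, orb root p0)} g" by (simp add: spans_def)
    ultimately show ?case using root_orbit by (intro exI[of _ "{(root, orb root p0)}"] exI[of _ g]) auto
  next
    case (Suc n)
    then obtain A g where A: "A \<subseteq> vertex_orbits" "card A = Suc n" "(root, orb root p0) \<in> A" "lifts g"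
      "g root (orb root p0) = \<one>" "spans A g" by auto
    then have "A \<subset> vertex_orbits" using Suc.prems by auto
    then obtain x g' where x: "x \<in> vertex_orbits - A" "lifts g'" "spans (insert x A) g'" "g' root (orb root p0) = \<one>"
      using spans_extend[OF A(4,6,5) _ A(3)] by blast
    moreover have "finite A" using A finite_vertex_orbits' finite_subset by blast
    ultimately show ?case using A by (intro exI[of _ "insert x A"] exI[of _ g']) auto
  qed
  moreover have "card vertex_orbits > 0" using finite_vertex_orbits' root_orbit by (auto simp: card_gt_0_iff)
  ultimately obtain A g where A: "A \<subseteq> vertex_orbits" "card A = card vertex_orbits" "lifts g"
    "g root (orb root p0) = \<one>" "spans A g" by (metis Suc_pred order_refl)
  then have "A = vertex_orbits" using card_subset_eq finite_vertex_orbits' by blast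
  then show thesis using that A by blast
qed

text \<open>By \<open>\<kappa>_eq\<close> the vector \<kappa> times \<open>z\<close> is
  \<open>x + r v p\<close> minus the \<open>r\<close> of the moved point. This turns a power of the
  vertex generator into an expression in sections, which telescopes in products.\<close>

lemma conj_i:
  assumes g: "lifts g" and v: "v \<in> verts G" "p \<in> \<Omega>"
  shows "(inv (g v (orb v p)) \<otimes> (i v (z v p) \<otimes> g v (orb v p))) [^] \<kappa> v x p =
    inv (sec g v (va v x p)) \<otimes> (i v x \<otimes> sec g v p)"
proof -
  let ?g = "g v (orb v p)" and ?k = "\<kappa> v x p"
  have c: "?g \<in> carrier H" "\<And>x. i v x \<in> carrier H" using lifts_closed[OF g v] i_closed[OF v(1)] by auto
  have "(inv ?g \<otimes> (i v (z v p) \<otimes> ?g)) [^] ?k = (inv ?g \<otimes> i v (z v p) \<otimes> inv (inv ?g)) [^] ?k"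
    using c by (simp add: m_assoc)
  also have "\<dots> = inv ?g \<otimes> i v (z v p) [^] ?k \<otimes> inv (inv ?g)"
    using c by (intro int_pow_conjugate) auto
  also have "i v (z v p) [^] ?k = i v (- r v (va v x p) + (x + r v p))"
    using \<kappa>_eq[OF v, of x] Z2_hom_zscale[OF i_hom[OF v(1)], of ?k "z v p"] by simp
  also have "\<dots> = inv (i v (r v (va v x p))) \<otimes> (i v x \<otimes> i v (r v p))"
    by (simp only: Z2_hom_add[OF i_hom[OF v(1)]] Z2_hom_uminus[OF i_hom[OF v(1)]])
  finally show ?thesis
    using c by (simp add: sec_def orb_va[OF v] inv_mult_group m_assoc)
qed

text \<open>The inverse of \<psi> is \<open>\<lambda>h. c h p0\<close>, multiplicative on
  \<open>fixer\<close> by the cocycle law. That \<psi> undoes it follows from a formula valid on all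
  of \<open>H\<close>, which can be checked on the generators of \<open>H\<close>. That it undoes
  \<psi> is checked on the generators of the free group and rests on \<open>spans\<close>.\<close>

theorem fixer_free:
  obtains n \<psi> where "n \<ge> 1" "\<psi> \<in> iso (free_group_of_rank n) (H\<lparr>carrier := fixer\<rparr>)"
proof -
  obtain g where g: "lifts g" "g root (orb root p0) = \<one>" "spans vertex_orbits g" by (rule spanning_lift)
  \<comment> \<open>The index set of the basis: \<open>Inl\<close> for vertices, \<open>Inr\<close>
    for edges. Edges are left out by triviality of \<open>edge_elt\<close> instead of by membership
    in a chosen tree; by \<open>spans\<close> the omitted ones connect all vertex orbits.\<close>
  define I where "I = Inl ` vertex_orbits \<union> Inr ` {(e, Q) \<in> edge_orbits. edge_elt g e (rep Q) \<noteq> \<one>}"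
  have "finite I"
    using finite_vertex_orbits' finite_edge_orbits' finite_subset[of "{(e, Q) \<in> edge_orbits. edge_elt g e (rep Q) \<noteq> \<one>}" edge_orbits]
    by (auto simp: I_def)
  define n where "n = card I"
  have "Inl (root, orb root p0) \<in> I" using root_orbit by (simp add: I_def)
  then have n: "n \<ge> 1" using \<open>finite I\<close> by (metis One_nat_def Suc_leI card_gt_0_iff empty_iff n_def)
  obtain idx where idx: "bij_betw idx I {..<n}"
    using ex_bij_betw_finite_nat[OF \<open>finite I\<close>] by (auto simp: n_def atLeast0LessThan)
  let ?L = "free_group_of_rank n" and ?gen = "\<lambda>k. generator_class {..<n} {} k"
  interpret L: group ?L unfolding free_group_of_rank_def by (rule group_presented_group)
  interpret N: subgroup fixer H by (rule subgroup_fixer)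
  interpret NG: group "H\<lparr>carrier := fixer\<rparr>" by (rule N.subgroup_is_group[OF is_group])
  have gen: "?gen (idx x) \<in> carrier ?L" if "x \<in> I" for x
    using bij_betwE[OF idx] that generator_class_closed[of "idx x" "{..<n}" "{}"] by (simp add: free_group_of_rank_def)
  define a where "a v O' = (if Inl (v, O') \<in> I then ?gen (idx (Inl (v, O'))) else \<one>\<^bsub>?L\<^esub>)" for v O'
  \<comment> \<open>The default \<one> matters: on an omitted edge it agrees with the trivial
    \<open>edge_elt\<close>. For \<open>a\<close> the default only makes the function total.\<close>
  define b where "b e Q = (if Inr (e, Q) \<in> I then ?gen (idx (Inr (e, Q))) else \<one>\<^bsub>?L\<^esub>)" for e Q
  have a: "a v O' \<in> carrier ?L" and b: "b e Q \<in> carrier ?L" for v O' e Q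
    using gen by (auto simp: a_def b_def)

  define f where "f x = (case x of Inl (v, O') \<Rightarrow> inv (g v O') \<otimes> (i v (z v (base O')) \<otimes> g v O')
    | Inr (e, Q) \<Rightarrow> edge_elt g e (rep Q))" for x
  have z_fixer: "inv (g v (orb v p)) \<otimes> (i v (z v p) \<otimes> g v (orb v p)) \<in> fixer" if "v \<in> verts G" "p \<in> \<Omega>" for v p
  proof -
    have c: "g v (orb v p) \<in> carrier H" "i v (z v p) \<in> carrier H"
      using lifts_closed[OF g(1) that] i_closed[OF that(1)] by auto
    have "z v (base (orb v p)) = z v p" using z_orb[OF that base_orb[OF that]] .
    then have "act (i v (z v p)) (base (orb v p)) = base (orb v p)"
      using z(2)[OF that(1) base_closed[OF that], of "z v p"] zscale_simps(2)[of "z v p"] unfolding va_def by metis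
    then have "act (inv (g v (orb v p)) \<otimes> (i v (z v p) \<otimes> g v (orb v p))) p0 =
        act (inv (g v (orb v p))) (act (g v (orb v p)) p0)"
      using c p0 base_closed[OF that] lifts_act[OF g(1) that] by (simp add: act_mult)
    then show ?thesis
      using c act_inv[OF c(1) p0] unfolding fixer_def by simp
  qed
  have f_Inl: "f (Inl (v, orb v p)) = inv (g v (orb v p)) \<otimes> (i v (z v p) \<otimes> g v (orb v p))"
    if "v \<in> verts G" "p \<in> \<Omega>" for v p
    using z_orb[OF that base_orb[OF that]] by (simp add: f_def)
  have f_fixer: "f x \<in> fixer" if "x \<in> I" for x
  proof -
    consider v p where "v \<in> verts G" "p \<in> \<Omega>" "x = Inl (v, orb v p)"
      | e p where "e \<in> P" "p \<in> \<Omega>" "x = Inr (e, eorb e p)"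
      using \<open>x \<in> I\<close> unfolding I_def vertex_orbits_def edge_orbits_def by blast
    then show ?thesis
    proof cases
      case 1
      then show ?thesis using f_Inl z_fixer by simp
    next
      case 2
      then show ?thesis using edge_elt_fixer[OF g(1) _ rep_closed] by (simp add: f_def)
    qed
  qed
  have inv_idx: "inv_into I idx (idx x) = x" if "x \<in> I" for x
    using idx that by (simp add: bij_betw_def inv_into_f_f)
  have idx_inv: "inv_into I idx k \<in> I" "idx (inv_into I idx k) = k" if "k < n" for k
    using idx that by (auto simp: bij_betw_def inv_into_into f_inv_into_f)
  obtain \<psi> where \<psi>: "\<psi> \<in> hom ?L (H\<lparr>carrier := fixer\<rparr>)" "\<And>k. k < n \<Longrightarrow> \<psi> (?gen k) = f (inv_into I idx k)"
    using NG.free_group_lift[of "\<lambda>k. f (inv_into I idx k)" n] f_fixer idx_inv by auto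
  have "\<psi> \<in> hom ?L H" using \<psi>(1) N.subset by (auto simp: hom_def)
  then interpret \<psi>: group_hom ?L H \<psi> by unfold_locales
  have \<psi>_gen: "\<psi> (?gen (idx x)) = f x" if "x \<in> I" for x
    using \<psi>(2)[of "idx x"] inv_idx[OF that] bij_betwE[OF idx] that by simp
  have \<psi>_a: "\<psi> (a v (orb v p)) = inv (g v (orb v p)) \<otimes> (i v (z v p) \<otimes> g v (orb v p))"
    if "v \<in> verts G" "p \<in> \<Omega>" for v p
  proof -
    have "Inl (v, orb v p) \<in> I" using that by (auto simp: I_def vertex_orbits_def)
    then show ?thesis using \<psi>_gen f_Inl[OF that] by (simp add: a_def)
  qed
  have \<psi>_b: "\<psi> (b e (eorb e p)) = edge_elt g e (rep (eorb e p))" if "e \<in> P" "p \<in> \<Omega>" for e p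
  proof (cases "Inr (e, eorb e p) \<in> I")
    case True
    then show ?thesis using \<psi>_gen[OF True] by (simp add: b_def f_def)
  next
    case False
    then have "edge_elt g e (rep (eorb e p)) = \<one>" using that by (auto simp: I_def edge_orbits_def)
    then show ?thesis using False by (simp add: b_def)
  qed
  note sec = sec_closed[OF g(1)]
  have \<psi>_\<kappa>: "\<psi> (a v (orb v p) [^]\<^bsub>?L\<^esub> \<kappa> v x p) = inv (sec g v (va v x p)) \<otimes> (i v x \<otimes> sec g v p)"
    if "v \<in> verts G" "p \<in> \<Omega>" for v x p
    using \<psi>.hom_int_pow[OF a] \<psi>_a[OF that] conj_i[OF g(1) that] by simp

  \<comment> \<open>At the representative this is \<open>\<psi>_b\<close>. Elsewhere the two
    \<kappa>-powers become sections by \<open>\<psi>_\<kappa>\<close>, and everything cancels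
    through the edge relation.\<close>
  have \<psi>_edge: "\<psi> (edge_cocycle ?L a b e p) = edge_elt g e p" if "e \<in> P" "p \<in> \<Omega>" for e p
  proof -
    let ?q = "rep (eorb e p)" and ?s = "src G e" and ?t = "tgt G e" and ?k = "ek e p"
    note v = P_ends[OF that(1)] and q = rep_closed[OF that]
    note tq = t_act_closed[OF that(1) q] and tp = t_act_closed[OF that]
    have va: "va ?t (zscale ?k (w_tgt e)) ?q = p" using ek[OF that] .
    have va': "va ?s (zscale ?k (w_src e)) (act (t e) ?q) = act (t e) p"
      using t_va[OF that(1) q, of ?k] va by simp
    note c = i_closed[OF v(1)] i_closed[OF v(2)] t_closed[OF that(1)]
      sec[OF v(1) tq] sec[OF v(1) tp] sec[OF v(2) q] sec[OF v(2) that(2)]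
    have "i ?s (w_src e) = t e \<otimes> i ?t (w_tgt e) \<otimes> inv t e"
      using t_conj[OF that(1)] c by (simp add: inv_solve_right)
    then have "i ?s (zscale ?k (w_src e)) = t e \<otimes> i ?t (zscale ?k (w_tgt e)) \<otimes> inv t e"
      using c int_pow_conjugate by (simp add: Z2_hom_zscale[OF i_hom] v)
    then have it: "i ?s (zscale ?k (w_src e)) = t e \<otimes> (i ?t (zscale ?k (w_tgt e)) \<otimes> inv t e)"
      using c by (simp add: m_assoc)
    have "\<psi> (edge_cocycle ?L a b e p) =
      inv (sec g ?s (act (t e) p)) \<otimes> (i ?s (zscale ?k (w_src e)) \<otimes> sec g ?s (act (t e) ?q)) \<otimes>
      edge_elt g e ?q \<otimes> inv (inv (sec g ?t p) \<otimes> (i ?t (zscale ?k (w_tgt e)) \<otimes> sec g ?t ?q))"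
      using \<psi>_\<kappa>[OF v(1) tq, of "zscale ?k (w_src e)"] \<psi>_\<kappa>[OF v(2) q, of "zscale ?k (w_tgt e)"] \<psi>_b[OF that] a b
      by (simp add: edge_cocycle_def va va' rep_same_orbits[OF that])
    also have "\<dots> = edge_elt g e p"
      using c by (simp add: edge_elt_def it m_assoc inv_mult_group inv_cancel)
    finally show ?thesis .
  qed

  obtain c U where
    cc: "\<And>h p. h \<in> carrier H \<Longrightarrow> p \<in> \<Omega> \<Longrightarrow> c h p \<in> carrier ?L" and
    c_mult: "\<And>g h p. g \<in> carrier H \<Longrightarrow> h \<in> carrier H \<Longrightarrow> p \<in> \<Omega> \<Longrightarrow> c (g \<otimes> h) p = c g (act h p) \<otimes>\<^bsub>?L\<^esub> c h p" and
    Uc: "\<And>v p. v \<in> verts G \<Longrightarrow> p \<in> \<Omega> \<Longrightarrow> U v p \<in> carrier ?L" and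
    U_root: "\<And>p. p \<in> \<Omega> \<Longrightarrow> U root p = \<one>\<^bsub>?L\<^esub>" and
    c_i: "\<And>v x p. v \<in> verts G \<Longrightarrow> p \<in> \<Omega> \<Longrightarrow>
      c (i v x) p \<otimes>\<^bsub>?L\<^esub> U v p = U v (va v x p) \<otimes>\<^bsub>?L\<^esub> a v (orb v p) [^]\<^bsub>?L\<^esub> \<kappa> v x p" and
    c_t: "\<And>e p. e \<in> P \<Longrightarrow> p \<in> \<Omega> \<Longrightarrow>
      c (t e) p \<otimes>\<^bsub>?L\<^esub> U (tgt G e) p = U (src G e) (act (t e) p) \<otimes>\<^bsub>?L\<^esub> edge_cocycle ?L a b e p"
    by (rule cocycle_exists[where a = a and b = b, OF L.is_group a b]) blast
  have ec: "edge_cocycle ?L a b e p \<in> carrier ?L" for e p using a b by (simp add: edge_cocycle_def)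
  have c_one: "c \<one> p = \<one>\<^bsub>?L\<^esub>" if "p \<in> \<Omega>" for p
    using c_mult[of \<one> \<one> p] cc[of \<one> p] that by (simp add: act_one L.l_cancel_one)
  have U_tree: "U (tgt G f) p = U (src G f) p \<otimes>\<^bsub>?L\<^esub> edge_cocycle ?L a b f p" if "f \<in> edges T \<inter> P" "p \<in> \<Omega>" for f p
    using c_t[of f p] that t_tree[OF that(1)] c_one Uc[OF P_ends(2)] by (simp add: act_one)
  \<comment> \<open>Both sides are \<one> at \<open>root\<close> and change by the same factor
    \<open>edge_elt g f p\<close> across every tree edge.\<close>
  have \<psi>_U: "\<psi> (U v p) = inv (sec g root p) \<otimes> sec g v p" if "v \<in> verts G" "p \<in> \<Omega>" for v p
  proof -
    have "\<forall>p\<in>\<Omega>. \<psi> (U v p) = inv (sec g root p) \<otimes> sec g v p"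
    proof (rule tree_induct[OF _ _ that(1)])
      show "\<forall>p\<in>\<Omega>. \<psi> (U root p) = inv (sec g root p) \<otimes> sec g root p"
        using U_root sec[OF root] by simp
      fix f assume f: "f \<in> edges T \<inter> P"
      then have fP: "f \<in> P" by simp
      note v = P_ends[OF fP]
      have "\<psi> (U (src G f) p) = inv (sec g root p) \<otimes> sec g (src G f) p \<longleftrightarrow>
          \<psi> (U (tgt G f) p) = inv (sec g root p) \<otimes> sec g (tgt G f) p" if p: "p \<in> \<Omega>" for p
      proof -
        note s = sec[OF v(1) p] sec[OF v(2) p] sec[OF root p]
        have "\<psi> (U (tgt G f) p) = \<psi> (U (src G f) p) \<otimes> edge_elt g f p"
          using U_tree[OF f p] \<psi>_edge[OF fP p] Uc[OF v(1) p] ec by simp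
        also have "edge_elt g f p = inv (sec g (src G f) p) \<otimes> sec g (tgt G f) p"
          using s t_tree[OF f] p by (simp add: edge_elt_def act_one)
        finally have 1: "\<psi> (U (tgt G f) p) = \<psi> (U (src G f) p) \<otimes> (inv (sec g (src G f) p) \<otimes> sec g (tgt G f) p)" .
        have 2: "inv (sec g root p) \<otimes> sec g (tgt G f) p =
          (inv (sec g root p) \<otimes> sec g (src G f) p) \<otimes> (inv (sec g (src G f) p) \<otimes> sec g (tgt G f) p)"
          using s by (simp add: m_assoc inv_cancel)
        show ?thesis
          unfolding 1 2 using s \<psi>.hom_closed[OF Uc[OF v(1) p]] by (subst right_cancel) auto
      qed
      then show "(\<forall>p\<in>\<Omega>. \<psi> (U (src G f) p) = inv (sec g root p) \<otimes> sec g (src G f) p) \<longleftrightarrow>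
          (\<forall>p\<in>\<Omega>. \<psi> (U (tgt G f) p) = inv (sec g root p) \<otimes> sec g (tgt G f) p)" by simp
    qed
    then show ?thesis using that(2) by simp
  qed
  \<comment> \<open>Under \<psi> the cocycle becomes the change of the root section. For
    \<open>h\<close> in \<open>fixer\<close> and \<open>p = p0\<close> both section values are
    \<one>, and the formula says that \<psi> takes \<open>c h p0\<close> to
    \<open>h\<close>.\<close>
  let ?B = "{h \<in> carrier H. \<forall>p\<in>\<Omega>. \<psi> (c h p) = inv (sec g root (act h p)) \<otimes> (h \<otimes> sec g root p)}"
  have "?B = carrier H"
  proof (rule generated)
    show "subgroup ?B H"
    proof (rule subgroupI)
      show "?B \<noteq> {}" using c_one act_one sec[OF root] by (auto intro!: exI[of _ \<one>])
      show "inv h \<in> ?B" if h: "h \<in> ?B" for h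
      proof -
        have "\<psi> (c (inv h) p) = inv (sec g root (act (inv h) p)) \<otimes> (inv h \<otimes> sec g root p)" if p: "p \<in> \<Omega>" for p
        proof -
          let ?q = "act (inv h) p"
          have q: "?q \<in> \<Omega>" "act h ?q = p" "h \<in> carrier H" using h p act_closed act_inv' by auto
          have "\<psi> (c h ?q) = inv (sec g root p) \<otimes> (h \<otimes> sec g root ?q)" using h q by auto
          moreover have "\<psi> (c (inv h) p) \<otimes> \<psi> (c h ?q) = \<one>"
          proof -
            have "c (inv h) p \<otimes>\<^bsub>?L\<^esub> c h ?q = \<one>\<^bsub>?L\<^esub>"
              using c_mult[of "inv h" h ?q] q c_one[OF q(1)] by simp
            then show ?thesis using \<psi>.hom_mult[OF cc[of "inv h" p] cc[of h ?q]] p q by simp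
          qed
          ultimately have "\<psi> (c (inv h) p) = inv (inv (sec g root p) \<otimes> (h \<otimes> sec g root ?q))"
            using q p sec[OF root] \<psi>.hom_closed[OF cc[of "inv h" p]] by (intro inv_equality[symmetric]) auto
          then show ?thesis using q p sec[OF root] by (simp add: inv_mult_group m_assoc)
        qed
        then show ?thesis using h by simp
      qed
      show "h \<otimes> k \<in> ?B" if "h \<in> ?B" "k \<in> ?B" for h k
        using that cc act_closed sec[OF root] by (simp add: c_mult act_mult m_assoc inv_cancel)
    qed auto
    show "i v x \<in> ?B" if v: "v \<in> verts G" for v x
    proof -
      have "\<psi> (c (i v x) p) = inv (sec g root (va v x p)) \<otimes> (i v x \<otimes> sec g root p)" if p: "p \<in> \<Omega>" for p
      proof -
        note s = sec[OF v p] sec[OF v va_closed[OF v p]] sec[OF root p] sec[OF root va_closed[OF v p]] i_closed[OF v]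
        have "\<psi> (c (i v x) p) \<otimes> \<psi> (U v p) = \<psi> (U v (va v x p)) \<otimes> \<psi> (a v (orb v p) [^]\<^bsub>?L\<^esub> \<kappa> v x p)"
          using c_i[OF v p, of x] cc[OF i_closed[OF v] p] Uc[OF v p] Uc[OF v va_closed[OF v p]] a
          by (metis L.int_pow_closed \<psi>.hom_mult)
        also have "\<dots> = inv (sec g root (va v x p)) \<otimes> (i v x \<otimes> sec g root p) \<otimes> \<psi> (U v p)"
          using s by (simp add: \<psi>_U[OF v p] \<psi>_U[OF v va_closed[OF v p]] \<psi>_\<kappa>[OF v p] m_assoc inv_cancel)
        finally show ?thesis
          using s \<psi>.hom_closed[OF cc[OF i_closed[OF v] p]] \<psi>.hom_closed[OF Uc[OF v p]] by (simp add: right_cancel)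
      qed
      then show ?thesis using i_closed[OF v] by (simp add: va_def)
    qed
    show "t e \<in> ?B" if e: "e \<in> P" for e
    proof -
      have "\<psi> (c (t e) p) = inv (sec g root (act (t e) p)) \<otimes> (t e \<otimes> sec g root p)" if p: "p \<in> \<Omega>" for p
      proof -
        note v = P_ends[OF e] and tp = t_act_closed[OF e p]
        note s = sec[OF v(2) p] sec[OF v(1) tp] sec[OF root p] sec[OF root tp] t_closed[OF e]
        have "\<psi> (c (t e) p) \<otimes> \<psi> (U (tgt G e) p) =
            \<psi> (U (src G e) (act (t e) p)) \<otimes> \<psi> (edge_cocycle ?L a b e p)"
          using c_t[OF e p] cc[OF t_closed[OF e] p] Uc[OF v(2) p] Uc[OF v(1) tp] ec
          by (metis \<psi>.hom_mult)
        also have "\<dots> = inv (sec g root (act (t e) p)) \<otimes> (t e \<otimes> sec g root p) \<otimes> \<psi> (U (tgt G e) p)"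
          using s by (simp add: \<psi>_U[OF v(2) p] \<psi>_U[OF v(1) tp] \<psi>_edge[OF e p] edge_elt_def m_assoc inv_cancel)
        finally show ?thesis
          using s \<psi>.hom_closed[OF cc[OF t_closed[OF e] p]] \<psi>.hom_closed[OF Uc[OF v(2) p]] by (simp add: right_cancel)
      qed
      then show ?thesis using t_closed[OF e] by simp
    qed
  qed
  then have \<psi>_c': "\<psi> (c h p0) = inv (sec g root (act h p0)) \<otimes> (h \<otimes> sec g root p0)" if "h \<in> carrier H" for h
    using that p0 by blast
  have "sec g root p0 = \<one>"
    using r_base[OF root p0] base_root g(2) Z2_hom_zero[OF i_hom[OF root]] by (simp add: sec_def)
  then have \<psi>_c: "\<psi> (c h p0) = h" if "h \<in> fixer" for h
  proof -
    have h: "h \<in> carrier H" "act h p0 = p0" using that unfolding fixer_iff by blast+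
    show ?thesis using \<psi>_c'[OF h(1)] h(1) unfolding h(2) \<open>sec g root p0 = \<one>\<close> by simp
  qed

  \<comment> \<open>Passing from the base point to \<open>p\<close> multiplies both quantities on
    the left by the same element; no power of \<open>a\<close> arises because \<kappa> vanishes on
    \<open>r v p\<close> by \<open>\<kappa>_r\<close>.\<close>
  have c_sec: "c (sec g v p) p0 = U v p \<longleftrightarrow> c (g v (orb v p)) p0 = U v (base (orb v p))"
    if v: "v \<in> verts G" "p \<in> \<Omega>" for v p
  proof -
    let ?b = "base (orb v p)"
    note cl = i_closed[OF v(1)] lifts_closed[OF g(1) v] and b = base_closed[OF v]
    have "c (sec g v p) p0 = c (i v (r v p)) ?b \<otimes>\<^bsub>?L\<^esub> c (g v (orb v p)) p0"
      using c_mult[OF cl(1) cl(2) p0] lifts_act[OF g(1) v] by (simp add: sec_def)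
    moreover have "U v p = c (i v (r v p)) ?b \<otimes>\<^bsub>?L\<^esub> U v ?b"
      using c_i[OF v(1) b, of "r v p"] va_r[OF v] \<kappa>_r[OF v] Uc[OF v] by simp
    ultimately show ?thesis
      using cc[OF cl(1) b] cc[OF cl(2) p0] Uc[OF v(1) b] by (simp add: L.left_cancel)
  qed
  have edge_rep: "edge_cocycle ?L a b e p = b e (eorb e p)" if "e \<in> P" "p \<in> \<Omega>" "rep (eorb e p) = p" for e p
  proof -
    have "ek e p = 0" by (rule ek_unique[OF that(1,2)]) (simp add: that va_zero P_ends)
    then show ?thesis
      using b that by (simp add: edge_cocycle_def \<kappa>_zero P_ends t_act_closed)
  qed
  have edge_mult: "t e \<otimes> sec g (tgt G e) p = sec g (src G e) (act (t e) p) \<otimes> edge_elt g e p" if "e \<in> P" "p \<in> \<Omega>" for e p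
    using sec[OF P_ends(1)[OF that(1)] t_act_closed[OF that]] sec[OF P_ends(2)[OF that(1)] that(2)] t_closed[OF that(1)]
    by (simp add: edge_elt_def inv_cancel)
  have vertex: "(\<lambda>(v, O'). c (g v O') p0 = U v (base O')) x" if "x \<in> vertex_orbits" for x
  proof (rule g(3)[unfolded spans_def, rule_format], goal_cases)
    case 1
    then show ?case using g(2) c_one[OF p0] U_root[OF p0] base_root by simp
  next
    case (2 e p)
    then have e: "e \<in> P" "p \<in> \<Omega>" "rep (eorb e p) = p" "edge_elt g e p = \<one>" by auto
    note v = P_ends[OF e(1)] and tp = t_act_closed[OF e(1,2)]
    have "b e (eorb e p) = \<one>\<^bsub>?L\<^esub>" using e by (auto simp: b_def I_def)
    then have U: "c (t e) p \<otimes>\<^bsub>?L\<^esub> U (tgt G e) p = U (src G e) (act (t e) p)"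
      using c_t[OF e(1,2)] edge_rep[OF e(1-3)] Uc[OF v(1) tp] by simp
    have "sec g (src G e) (act (t e) p) = t e \<otimes> sec g (tgt G e) p"
      using edge_mult[OF e(1,2)] e(4) sec[OF v(1) tp] by simp
    then have "c (sec g (src G e) (act (t e) p)) p0 = c (t e) p \<otimes>\<^bsub>?L\<^esub> c (sec g (tgt G e) p) p0"
      using c_mult[OF t_closed[OF e(1)] sec[OF v(2) e(2)] p0] sec_act[OF g(1) v(2) e(2)] by simp
    then have "c (sec g (src G e) (act (t e) p)) p0 = U (src G e) (act (t e) p) \<longleftrightarrow>
        c (sec g (tgt G e) p) p0 = U (tgt G e) p"
      using cc[OF t_closed[OF e(1)] e(2)] cc[OF sec[OF v(2) e(2)] p0] Uc[OF v(2) e(2)] by (simp add: U[symmetric] L.left_cancel)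
    then show ?case using c_sec[OF v(1) tp] c_sec[OF v(2) e(2)] by simp
  qed (rule that)
  have c_g: "c (g v (orb v p)) p0 = U v (base (orb v p))" if "v \<in> verts G" "p \<in> \<Omega>" for v p
    using vertex[of "(v, orb v p)"] that by (auto simp: vertex_orbits_def)
  have c_f: "c (f x) p0 = ?gen (idx x)" if "x \<in> I" for x
  proof -
    have fx: "f x \<in> carrier H" "act (f x) p0 = p0" using f_fixer[OF that] unfolding fixer_iff by blast+
    consider v p where "v \<in> verts G" "p \<in> \<Omega>" "x = Inl (v, orb v p)"
      | e p where "e \<in> P" "p \<in> \<Omega>" "x = Inr (e, eorb e p)"
      using \<open>x \<in> I\<close> unfolding I_def vertex_orbits_def edge_orbits_def by blast
    then show ?thesis
    proof cases
      case 1
      let ?g = "g v (orb v p)" and ?b = "base (orb v p)"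
      note gc = lifts_closed[OF g(1) 1(1,2)] and iz = i_closed[OF 1(1)] and b' = base_closed[OF 1(1,2)]
      have zb: "z v ?b = z v p" using z_orb[OF 1(1,2) base_orb[OF 1(1,2)]] .
      have vz: "va v (z v p) ?b = ?b" using z(2)[OF 1(1) b', of "z v p"] zscale_simps(2) zb by metis
      \<comment> \<open>Applying \<open>c\<close> to both sides leaves exactly one factor
        \<open>a\<close>, because \<kappa> is \<open>1\<close> on the stabilizer generator.\<close>
      have "?g \<otimes> f x = i v (z v p) \<otimes> ?g" using gc iz by (simp add: 1(3) f_Inl[OF 1(1,2)] inv_cancel)
      then have "c ?g p0 \<otimes>\<^bsub>?L\<^esub> c (f x) p0 = c (i v (z v p)) ?b \<otimes>\<^bsub>?L\<^esub> c ?g p0"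
        using c_mult[OF gc fx(1) p0] c_mult[OF iz gc p0] fx(2) lifts_act[OF g(1) 1(1,2)] by simp
      also have "\<dots> = c ?g p0 \<otimes>\<^bsub>?L\<^esub> a v (orb v p)"
        using c_i[OF 1(1) b', of "z v p"] \<kappa>_z[OF 1(1) b'] vz zb c_g[OF 1(1,2)] orb_base[OF 1(1,2)] a by simp
      finally have "c (f x) p0 = a v (orb v p)"
        using cc[OF gc p0] cc[OF fx(1) p0] a by (simp add: L.left_cancel)
      then show ?thesis using that 1 by (simp add: a_def)
    next
      case 2
      let ?q = "rep (eorb e p)"
      note v = P_ends[OF 2(1)] and q = rep_closed[OF 2(1,2)] note tq = t_act_closed[OF 2(1) q]
      have fe: "f x = edge_elt g e ?q" using 2 by (simp add: f_def)
      have sec_U: "c (sec g v p) p0 = U v p" if "v \<in> verts G" "p \<in> \<Omega>" for v p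
        using c_sec[OF that] c_g[OF that] by simp
      \<comment> \<open>Here \<open>c\<close> is applied to both sides of \<open>edge_mult\<close>;
        the values of \<open>U\<close> cancel and \<open>b\<close> remains.\<close>
      have "U (src G e) (act (t e) ?q) \<otimes>\<^bsub>?L\<^esub> c (f x) p0 = c (t e) ?q \<otimes>\<^bsub>?L\<^esub> U (tgt G e) ?q"
        using arg_cong[OF edge_mult[OF 2(1) q], of "\<lambda>h. c h p0"] fx
          c_mult[OF sec[OF v(1) tq] fx(1) p0] c_mult[OF t_closed[OF 2(1)] sec[OF v(2) q] p0]
          sec_U[OF v(1) tq] sec_U[OF v(2) q] sec_act[OF g(1) v(2) q] by (simp add: fe)
      also have "\<dots> = U (src G e) (act (t e) ?q) \<otimes>\<^bsub>?L\<^esub> b e (eorb e p)"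
        using c_t[OF 2(1) q] edge_rep[OF 2(1) q] rep_rep[OF 2(1,2)] by simp
      finally have "c (f x) p0 = b e (eorb e p)"
        using Uc[OF v(1) tq] cc[OF fx(1) p0] b by (simp add: L.left_cancel)
      then show ?thesis using that 2 by (simp add: b_def)
    qed
  qed
  have c_\<psi>: "c (\<psi> x) p0 = x" if "x \<in> carrier ?L" for x
  proof -
    have \<psi>N: "\<psi> x \<in> carrier H" "act (\<psi> x) p0 = p0" if "x \<in> carrier ?L" for x
    proof -
      have "\<psi> x \<in> fixer" using hom_in_carrier[OF \<psi>(1) that] by simp
      then show "\<psi> x \<in> carrier H" "act (\<psi> x) p0 = p0" unfolding fixer_iff by blast+
    qed
    have hom: "(\<lambda>x. c (\<psi> x) p0) \<in> hom ?L ?L"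
      using \<psi>N cc[OF _ p0] c_mult[OF _ _ p0] by (auto simp: hom_def)
    have "(\<lambda>x. c (\<psi> x) p0) x = (\<lambda>x. x) x"
    proof (rule hom_eq_on_generators[where X = "{..<n}" and R = "{}"])
      show "(\<lambda>x. c (\<psi> x) p0) \<in> hom (presented_group {..<n} {}) ?L"
        using hom unfolding free_group_of_rank_def .
      show "c (\<psi> (?gen k)) p0 = ?gen k" if "k \<in> {..<n}" for k
        using that \<psi>(2)[of k] c_f[OF idx_inv(1)] idx_inv(2) by simp
    qed (use that L.is_group in \<open>auto simp: hom_def free_group_of_rank_def\<close>)
    then show ?thesis by simp
  qed
  have "bij_betw \<psi> (carrier ?L) fixer"
    by (rule bij_betwI[where g = "\<lambda>h. c h p0"])
      (use hom_in_carrier[OF \<psi>(1)] \<psi>_c c_\<psi> cc[OF N.mem_carrier p0] in auto)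
  then have "\<psi> \<in> iso ?L (H\<lparr>carrier := fixer\<rparr>)" using \<psi>(1) by (simp add: iso_def)
  then show thesis using that n by blast
qed

end

section \<open>Homomorphisms to the integers from property (VRC)\<close>

context group
begin

section \<open>Subgroups of finite index\<close>

lemma rcoset_eq_iff:
  assumes "subgroup K G" "g \<in> carrier G" "h \<in> carrier G"
  shows "K #> g = K #> h \<longleftrightarrow> g \<otimes> inv h \<in> K"
  using assms repr_independence[of g K h] repr_independenceD[of K g h] subgroup.rcos_module[OF assms(1) is_group]
  by metis

text \<open>The index is bounded by the number of values of an invariant that separates right
  cosets.\<close>

lemma finite_index_invariant:
  assumes N: "subgroup N G" and F: "finite (F ` carrier G)"
    and eq: "\<And>g h. g \<in> carrier G \<Longrightarrow> h \<in> carrier G \<Longrightarrow> F g = F h \<Longrightarrow> g \<otimes> inv h \<in> N"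
  shows "finite (rcosets N)"
proof -
  define sel where "sel s = (SOME g. g \<in> carrier G \<and> F g = s)" for s
  have "N #> g = N #> sel (F g)" if "g \<in> carrier G" for g
  proof -
    have "sel (F g) \<in> carrier G \<and> F (sel (F g)) = F g"
      unfolding sel_def by (rule someI[of _ g]) (use that in simp)
    then show ?thesis using rcoset_eq_iff[OF N] eq that by metis
  qed
  then have "rcosets N \<subseteq> (\<lambda>s. N #> sel s) ` F ` carrier G" by (auto simp: RCOSETS_def)
  then show ?thesis using F finite_subset by blast
qed

text \<open>\<open>N\<close> is the kernel of right multiplication on the finite set
  \<open>D\<close> of all cosets of all members of \<open>\<K>\<close>. Fixing the coset
  \<open>K\<close> itself means lying in \<open>K\<close>.\<close>

lemma finite_index_core:
  assumes "finite \<K>" and K: "\<And>K. K \<in> \<K> \<Longrightarrow> subgroup K G" "\<And>K. K \<in> \<K> \<Longrightarrow> finite (rcosets K)"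
  obtains N where "N \<lhd> G" "finite (rcosets N)" "\<And>K. K \<in> \<K> \<Longrightarrow> N \<subseteq> K"
proof -
  define D where "D = (\<Union>K\<in>\<K>. rcosets K)"
  have "finite D" using assms by (simp add: D_def)
  have D: "C \<subseteq> carrier G" "C #> g \<in> D" if CD: "C \<in> D" and "g \<in> carrier G" for C g
  proof -
    obtain K h where K': "K \<in> \<K>" "h \<in> carrier G" "C = K #> h" using CD by (auto simp: D_def RCOSETS_def)
    then have sub: "K \<subseteq> carrier G" using K(1) subgroup.subset by blast
    then show "C \<subseteq> carrier G" using K' r_coset_subset_G by blast
    have "C #> g = K #> (h \<otimes> g)" using K' sub that coset_mult_assoc by simp
    then show "C #> g \<in> D" using K' that by (auto simp: D_def RCOSETS_def)
  qed
  have D1: "C \<subseteq> carrier G" if "C \<in> D" for C using D(1)[OF that one_closed] .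
  define N where "N = {n \<in> carrier G. \<forall>C\<in>D. C #> n = C}"
  have N: "subgroup N G"
  proof (rule subgroupI)
    show "N \<noteq> {}" using coset_mult_one[OF D1] by (auto simp: N_def intro!: exI[of _ \<one>])
    show "inv n \<in> N" if "n \<in> N" for n
      using that coset_mult_one[OF D1] coset_mult_assoc[OF D1, of _ n "inv n"] by (auto simp: N_def)
    show "n \<otimes> m \<in> N" if "n \<in> N" "m \<in> N" for n m
      using that coset_mult_assoc[OF D1, of _ n m, symmetric] by (auto simp: N_def)
  qed (auto simp: N_def)
  have "x \<otimes> n \<otimes> inv x \<in> N" if "x \<in> carrier G" "n \<in> N" for x n
  proof -
    have n: "n \<in> carrier G" using that by (simp add: N_def)
    have "C #> (x \<otimes> n \<otimes> inv x) = C" if C: "C \<in> D" for C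
    proof -
      have sub: "C \<subseteq> carrier G" "C #> x \<subseteq> carrier G" using D1[OF C] D1[OF D(2)[OF C]] \<open>x \<in> carrier G\<close> by auto
      have "C #> (x \<otimes> n \<otimes> inv x) = ((C #> x) #> n) #> inv x"
        using sub n \<open>x \<in> carrier G\<close> by (simp add: coset_mult_assoc m_assoc)
      also have "(C #> x) #> n = C #> x" using \<open>n \<in> N\<close> D(2)[OF C \<open>x \<in> carrier G\<close>] by (simp add: N_def)
      finally show ?thesis using sub \<open>x \<in> carrier G\<close> by (simp add: coset_mult_assoc)
    qed
    then show ?thesis using that n by (simp add: N_def)
  qed
  then have "N \<lhd> G" using N normal_inv_iff by blast
  moreover have "finite (rcosets N)"
  proof (rule finite_index_invariant[OF N])
    define F where "F g = (\<lambda>C\<in>D. C #> g)" for g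
    have "F ` carrier G \<subseteq> D \<rightarrow>\<^sub>E D" using D by (auto simp: F_def)
    moreover have "finite (D \<rightarrow>\<^sub>E D)" using \<open>finite D\<close> by (intro finite_PiE) simp_all
    ultimately show "finite (F ` carrier G)" by (rule finite_subset)
    fix g h assume gh: "g \<in> carrier G" "h \<in> carrier G" "F g = F h"
    have "C #> (g \<otimes> inv h) = C" if "C \<in> D" for C
    proof -
      have "C #> g = C #> h" using fun_cong[OF gh(3), of C] that by (simp add: F_def)
      then show ?thesis using gh D1[OF that]
          coset_mult_assoc[OF D1[OF that], of g "inv h"]
          coset_mult_assoc[OF D1[OF that], of h "inv h"] coset_mult_one by simp
    qed
    then show "g \<otimes> inv h \<in> N" using gh by (simp add: N_def)
  qed
  moreover have "N \<subseteq> K" if "K \<in> \<K>" for K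
  proof
    fix n assume n: "n \<in> N"
    have "K #> \<one> \<in> D" using that by (auto simp: D_def RCOSETS_def)
    then have "K \<in> D" using coset_mult_one[OF subgroup.subset[OF K(1)[OF that]]] by simp
    then show "n \<in> K" using n coset_join1 K(1)[OF that] by (auto simp: N_def)
  qed
  ultimately show thesis using that by blast
qed

text \<open>Two of the powers with exponents from \<open>0\<close> to the index lie in one coset, so
  some positive exponent at most the index works for \<open>x\<close>. The factorial of the index
  works for all \<open>x\<close> at once.\<close>

lemma finite_index_power:
  assumes K: "subgroup K G" and "finite (rcosets K)"
  obtains M :: nat where "M > 0" "\<And>x. x \<in> carrier G \<Longrightarrow> x [^] M \<in> K"
proof
  let ?c = "card (rcosets K)"
  show "fact ?c > (0 :: nat)" by simp
  fix x assume x: "x \<in> carrier G"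
  let ?f = "\<lambda>j::nat. K #> (x [^] j)"
  have "?f ` {..?c} \<subseteq> rcosets K" using x by (auto simp: RCOSETS_def)
  then have "card (?f ` {..?c}) < card {..?c}" using card_mono[OF assms(2), of "?f ` {..?c}"] by simp
  then have "\<not> inj_on ?f {..?c}" using pigeonhole by blast
  then obtain a b where ab: "a < b" "b \<le> ?c" "?f b = ?f a"
    by (auto simp: inj_on_def) (metis nat_neq_iff)
  have "x [^] b \<otimes> inv (x [^] a) \<in> K" using ab(3) rcoset_eq_iff[OF K] x by simp
  moreover have "x [^] b = x [^] (b - a) \<otimes> x [^] a" using ab x by (simp add: nat_pow_mult)
  ultimately have m: "x [^] (b - a) \<in> K" using x by (simp add: m_assoc)
  have "b - a dvd fact ?c" using ab by (intro dvd_fact) auto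
  then obtain l where "fact ?c = (b - a) * l" by blast
  then have "x [^] (fact ?c :: nat) = (x [^] (b - a)) [^] l" using x by (simp add: nat_pow_pow)
  moreover have "u [^] k \<in> K" if "u \<in> K" for u and k :: nat
    using that by (induction k) (use K in \<open>auto simp: subgroup.one_closed subgroup.m_closed\<close>)
  ultimately show "x [^] (fact ?c :: nat) \<in> K" using m by simp
qed

lemma right_transversal:
  assumes K: "subgroup K G" and "finite (rcosets K)"
  obtains S where "finite S" "\<And>g. g \<in> carrier G \<Longrightarrow> \<exists>s\<in>S. \<exists>k\<in>K. s \<in> carrier G \<and> g = k \<otimes> s"
proof
  let ?S = "(\<lambda>C. SOME x. x \<in> C) ` (rcosets K)"
  show "finite ?S" using assms(2) by simp
  fix g assume g: "g \<in> carrier G"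
  let ?s = "SOME x. x \<in> K #> g"
  have s: "?s \<in> K #> g" using rcos_self[OF g K] by (rule someI)
  then have sc: "?s \<in> carrier G" using g r_coset_subset_G[OF subgroup.subset[OF K]] by blast
  have "K #> g = K #> ?s" using repr_independence[OF s g K] .
  then have "g \<otimes> inv ?s \<in> K" using rcoset_eq_iff[OF K g sc] by blast
  moreover have "g = (g \<otimes> inv ?s) \<otimes> ?s" using g sc by (simp add: m_assoc)
  moreover have "?s \<in> ?S" using g by (auto simp: RCOSETS_def)
  ultimately show "\<exists>s\<in>?S. \<exists>k\<in>K. s \<in> carrier G \<and> g = k \<otimes> s" using sc by blast
qed

text \<open>The virtual retraction onto the infinite cyclic group of \<open>y\<close>, followed by
  reading off the exponent.\<close>

lemma VRC_retraction:
  assumes "property_VRC G" and y: "y \<in> carrier G" "\<And>k::int. y [^] k = \<one> \<Longrightarrow> k = 0"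
  obtains K h where "subgroup K G" "finite (rcosets K)" "y \<in> K"
    "h \<in> hom (G\<lparr>carrier := K\<rparr>) integer_group" "h y = 1"
proof -
  define C where "C = carrier (subgroup_generated G {y})"
  have C_eq: "G\<lparr>carrier := C\<rparr> = subgroup_generated G {y}" by (simp add: C_def subgroup_generated_def)
  have C: "C = range (\<lambda>k::int. y [^] k)"
    using carrier_subgroup_generated_by_singleton[OF y(1)] by (simp add: C_def)
  have "subgroup C G" unfolding C_def by (rule subgroup_subgroup_generated)
  moreover have "cyclic_group (G\<lparr>carrier := C\<rparr>)" unfolding C_eq by (rule cyclic_group_generated)
  ultimately obtain K \<rho> where K: "subgroup K G" "finite (rcosets K)" "C \<subseteq> K"
    "\<rho> \<in> hom (G\<lparr>carrier := K\<rparr>) (G\<lparr>carrier := C\<rparr>)" "\<And>x. x \<in> C \<Longrightarrow> \<rho> x = x"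
    using assms(1) unfolding property_VRC_def virtual_retract_def by metis
  have inj: "k = l" if "y [^] k = y [^] l" for k l :: int
    using y(2)[of "k - l"] that y(1) by (simp add: int_pow_diff)
  define e where "e x = (THE k::int. y [^] k = x)" for x
  have e: "e (y [^] k) = k" for k :: int unfolding e_def using inj by blast
  have yC: "y \<in> C" unfolding C using y(1) by (intro range_eqI[of _ _ 1]) simp
  show thesis
  proof
    show "(\<lambda>x. e (\<rho> x)) \<in> hom (G\<lparr>carrier := K\<rparr>) integer_group"
    proof (rule homI)
      fix a b assume "a \<in> carrier (G\<lparr>carrier := K\<rparr>)" "b \<in> carrier (G\<lparr>carrier := K\<rparr>)"
      then have "\<rho> (a \<otimes> b) = \<rho> a \<otimes> \<rho> b" "\<rho> a \<in> C" "\<rho> b \<in> C" using K(4) by (auto simp: hom_def)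
      then obtain k l :: int where kl: "\<rho> a = y [^] k" "\<rho> b = y [^] l" "\<rho> (a \<otimes> b) = \<rho> a \<otimes> \<rho> b"
        unfolding C by auto
      have "\<rho> (a \<otimes> b) = y [^] (k + l)" using kl y(1) by (simp add: int_pow_mult)
      then have "e (\<rho> (a \<otimes> b)) = e (\<rho> a) + e (\<rho> b)" unfolding kl(1,2) by (simp only: e)
      then show "e (\<rho> (a \<otimes>\<^bsub>G\<lparr>carrier := K\<rparr>\<^esub> b)) = e (\<rho> a) \<otimes>\<^bsub>integer_group\<^esub> e (\<rho> b)" by simp
    qed simp
    show "e (\<rho> y) = 1" using K(5)[OF yC] e[of 1] y(1) by simp
  qed (use K yC in auto)
qed

text \<open>If \<open>f\<close> is nonzero on the earlier elements and \<open>g\<close> on the new one, then \<open>m f + g\<close> with \<open>m\<close> large works.\<close>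

lemma generic_hom:
  assumes "finite W" and "\<And>w. w \<in> W \<Longrightarrow> \<exists>h \<in> hom K integer_group. h w \<noteq> 0"
  obtains f where "f \<in> hom K integer_group" "\<And>w. w \<in> W \<Longrightarrow> f w \<noteq> 0"
proof -
  have "\<exists>f \<in> hom K integer_group. \<forall>w\<in>W. f w \<noteq> 0"
    using assms
  proof (induction W)
    case empty
    have "(\<lambda>_. 0) \<in> hom K integer_group" by (simp add: hom_def)
    then show ?case by blast
  next
    case (insert x W)
    then obtain f where f: "f \<in> hom K integer_group" "\<And>w. w \<in> W \<Longrightarrow> f w \<noteq> 0" by blast
    show ?case
    proof (cases "f x = 0")
      case True
      obtain g where g: "g \<in> hom K integer_group" "g x \<noteq> 0" using insert by blast
      define m where "m = 1 + (\<Sum>w\<in>W. \<bar>g w\<bar>)"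
      have "m * f w + g w \<noteq> 0" if "w \<in> W" for w
      proof
        assume "m * f w + g w = 0"
        then have "\<bar>g w\<bar> = \<bar>m\<bar> * \<bar>f w\<bar>" by (metis abs_minus_cancel abs_mult add_eq_0_iff)
        moreover have "\<bar>f w\<bar> \<ge> 1" using f(2)[OF that] by linarith
        moreover have "m > \<bar>g w\<bar>"
          using member_le_sum[OF that, of "\<lambda>w. \<bar>g w\<bar>"] insert(1) by (simp add: m_def)
        ultimately show False
          by (smt (verit) mult_le_cancel_left1)
      qed
      moreover have "(\<lambda>w. m * f w + g w) \<in> hom K integer_group"
        using f(1) g(1) by (auto simp: hom_def algebra_simps)
      ultimately show ?thesis using True g(2) by (intro bexI[of _ "\<lambda>w. m * f w + g w"]) auto
    qed (use f in blast)
  qed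
  then show thesis using that by blast
qed

text \<open>Division by the least positive value of \<open>f\<close>, which divides all values by
  division with remainder.\<close>

lemma primitive_hom:
  assumes f: "f \<in> hom G integer_group" and x: "x \<in> carrier G" "f x \<noteq> 0"
  obtains d f' t where "f' \<in> hom G integer_group" "t \<in> carrier G" "f' t = 1"
    "\<And>x. x \<in> carrier G \<Longrightarrow> f x = d * f' x"
proof -
  interpret f: group_hom G integer_group f using f by (simp add: group_hom_def group_hom_axioms_def is_group)
  let ?P = "\<lambda>n. n > 0 \<and> (\<exists>t\<in>carrier G. f t = int n)"
  have "\<exists>n. ?P n"
  proof (cases "f x > 0")
    case True
    then show ?thesis using x by (intro exI[of _ "nat (f x)"]) auto
  next
    case False
    moreover have "f (inv x) = - f x" using x f.hom_inv by simp
    ultimately show ?thesis using x by (intro exI[of _ "nat (- f x)"]) (auto intro!: bexI[of _ "inv x"])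
  qed
  then have n: "?P (LEAST n. ?P n)" and least: "\<And>m. ?P m \<Longrightarrow> (LEAST n. ?P n) \<le> m"
    using LeastI_ex[of ?P] Least_le[of ?P] by blast+
  define d where "d = int (LEAST n. ?P n)"
  then obtain t where t: "t \<in> carrier G" "f t = d" "d > 0" using n by auto
  have dvd: "d dvd f y" if y: "y \<in> carrier G" for y
  proof (rule ccontr)
    assume "\<not> d dvd f y"
    then have m: "f y mod d > 0" using t(3) by (simp add: dvd_eq_mod_eq_0 order_less_le)
    have "f (t [^] (- (f y div d))) = - (f y div d) * d" using f.hom_int_pow[OF t(1)] t(2) by simp
    then have "f (y \<otimes> t [^] (- (f y div d))) = f y mod d"
      using y t(1) by (simp add: minus_div_mult_eq_mod)
    then have "?P (nat (f y mod d))" using m y t(1) by (auto intro!: bexI[of _ "y \<otimes> t [^] (- (f y div d))"])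
    from least[OF this] have "d \<le> f y mod d" using m by (simp add: d_def)
    then show False using pos_mod_bound[OF t(3)] by (metis not_le)
  qed
  show thesis
  proof
    show "(\<lambda>x. f x div d) \<in> hom G integer_group"
      using f dvd by (auto simp: hom_def div_plus_div_distrib_dvd_left)
    show "f y = d * (f y div d)" if "y \<in> carrier G" for y using dvd[OF that] by simp
    show "f t div d = 1" using t by simp
  qed (rule t(1))
qed

text \<open>The domains of the homomorphisms from \<open>VRC_retraction\<close> have a common normal
  subgroup \<open>K\<close> of finite index. On \<open>K\<close> the homomorphisms may be composed
  with conjugations by arbitrary elements of the group, which makes a generic choice nonzero on
  conjugates too; \<open>primitive_hom\<close> then makes it onto.\<close>

lemma VRC_finite_set:
  assumes vrc: "property_VRC G" and "finite Y" "Y \<noteq> {}"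
    and Y: "\<And>y. y \<in> Y \<Longrightarrow> y \<in> carrier G" "\<And>y k. y \<in> Y \<Longrightarrow> y [^] (k::int) = \<one> \<Longrightarrow> k = 0"
  obtains K f t M where "K \<lhd> G" "finite (rcosets K)" "f \<in> hom (G\<lparr>carrier := K\<rparr>) integer_group"
    "t \<in> K" "f t = 1" "(M::nat) > 0" "\<And>x. x \<in> carrier G \<Longrightarrow> x [^] M \<in> K"
    "\<And>y g. y \<in> Y \<Longrightarrow> g \<in> carrier G \<Longrightarrow> f (inv g \<otimes> y [^] M \<otimes> g) \<noteq> 0"
proof -
  define Q where "Q y Kh \<longleftrightarrow> (case Kh of (K, h) \<Rightarrow> subgroup K G \<and> finite (rcosets K) \<and> y \<in> K \<and>
    h \<in> hom (G\<lparr>carrier := K\<rparr>) integer_group \<and> h y = (1::int))" for y Kh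
  define sel where "sel y = (SOME Kh. Q y Kh)" for y
  have sel: "Q y (sel y)" if "y \<in> Y" for y
  proof -
    obtain K h where "subgroup K G" "finite (rcosets K)" "y \<in> K"
      "h \<in> hom (G\<lparr>carrier := K\<rparr>) integer_group" "h y = 1"
      by (rule VRC_retraction[OF vrc Y(1)[OF \<open>y \<in> Y\<close>] Y(2)[OF \<open>y \<in> Y\<close>]])
    then have "Q y (K, h)" by (simp add: Q_def)
    then have "\<exists>Kh. Q y Kh" by blast
    then show ?thesis unfolding sel_def by (rule someI_ex)
  qed
  define L h where "L y = fst (sel y)" and "h y = snd (sel y)" for y
  have L: "subgroup (L y) G" "finite (rcosets (L y))" "y \<in> L y"
    "h y \<in> hom (G\<lparr>carrier := L y\<rparr>) integer_group" "h y y = 1" if "y \<in> Y" for y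
    using sel[OF that] by (auto simp: Q_def L_def h_def split: prod.splits)
  have fin: "finite (L ` Y)" using \<open>finite Y\<close> by simp
  have sub: "\<And>K. K \<in> L ` Y \<Longrightarrow> subgroup K G" "\<And>K. K \<in> L ` Y \<Longrightarrow> finite (rcosets K)"
    using L by auto
  obtain K where K': "K \<lhd> G" "finite (rcosets K)" "\<And>K'. K' \<in> L ` Y \<Longrightarrow> K \<subseteq> K'"
    by (rule finite_index_core[OF fin sub]) blast+
  then have K: "K \<lhd> G" "finite (rcosets K)" "\<And>y. y \<in> Y \<Longrightarrow> K \<subseteq> L y" by simp_all
  interpret K: normal K G by (rule K(1))
  have sK: "subgroup K G" by (rule K.subgroup_axioms)
  let ?GK = "G\<lparr>carrier := K\<rparr>"
  interpret GK: group ?GK by (rule subgroup.subgroup_is_group[OF sK is_group])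
  obtain M :: nat where M: "M > 0" "\<And>x. x \<in> carrier G \<Longrightarrow> x [^] M \<in> K"
    using finite_index_power[OF sK K(2)] by blast
  obtain S where "finite S" and S: "\<And>g. g \<in> carrier G \<Longrightarrow> \<exists>s\<in>S. \<exists>k\<in>K. s \<in> carrier G \<and> g = k \<otimes> s"
    using right_transversal[OF sK K(2)] by blast
  \<comment> \<open>Conjugates by representatives of the cosets of \<open>K\<close> suffice, since a
    homomorphism from \<open>K\<close> to \<int> is invariant under conjugation by \<open>K\<close>.
    This makes \<open>W\<close> finite.\<close>
  define W where "W = (\<lambda>(y, s). s \<otimes> y [^] M \<otimes> inv s) ` (Y \<times> (S \<inter> carrier G))"
  have WK: "s \<otimes> y [^] M \<otimes> inv s \<in> K" if "y \<in> Y" "s \<in> carrier G" for y s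
    using that Y(1) M(2) by (intro K.inv_op_closed2) auto
  have "\<exists>f \<in> hom ?GK integer_group. f w \<noteq> 0" if "w \<in> W" for w
  proof -
    obtain y s where ys: "y \<in> Y" "s \<in> carrier G" "w = s \<otimes> y [^] M \<otimes> inv s"
      using \<open>w \<in> W\<close> by (auto simp: W_def)
    have conj: "inv s \<otimes> x \<otimes> s \<in> L y" if "x \<in> K" for x
      using K.inv_op_closed1[OF ys(2) that] K(3)[OF ys(1)] by blast
    \<comment> \<open>The conjugation that produced \<open>w\<close> is undone before
      \<open>h y\<close> is applied; the value at \<open>w\<close> is then \<open>M\<close>.\<close>
    have hom: "(\<lambda>x. h y (inv s \<otimes> x \<otimes> s)) \<in> hom ?GK integer_group"
    proof (rule homI)
      fix a b assume "a \<in> carrier ?GK" "b \<in> carrier ?GK"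
      then have ab: "a \<in> K" "b \<in> K" by auto
      then have "a \<in> carrier G" "b \<in> carrier G" by auto
      then have "inv s \<otimes> (a \<otimes> b) \<otimes> s = (inv s \<otimes> a \<otimes> s) \<otimes> (inv s \<otimes> b \<otimes> s)"
        using ys(2) by (simp add: m_assoc inv_cancel)
      then show "h y (inv s \<otimes> (a \<otimes>\<^bsub>?GK\<^esub> b) \<otimes> s) = h y (inv s \<otimes> a \<otimes> s) \<otimes>\<^bsub>integer_group\<^esub> h y (inv s \<otimes> b \<otimes> s)"
        using hom_mult[OF L(4)[OF ys(1)], of "inv s \<otimes> a \<otimes> s" "inv s \<otimes> b \<otimes> s"] conj ab by simp
    qed simp
    have "inv s \<otimes> w \<otimes> s = y [^] M" using ys Y(1) by (simp add: m_assoc inv_cancel)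
    moreover have "h y (y [^] M) = int M"
    proof -
      interpret Ly: group "G\<lparr>carrier := L y\<rparr>" by (rule subgroup.subgroup_is_group[OF L(1)[OF ys(1)] is_group])
      interpret hy: group_hom "G\<lparr>carrier := L y\<rparr>" integer_group "h y"
        using L(4)[OF ys(1)] Ly.is_group by (simp add: group_hom_def group_hom_axioms_def)
      show ?thesis
        using hy.hom_nat_pow[of y M] L(3,5)[OF ys(1)] nat_pow_consistent[of y M "L y"] by simp
    qed
    ultimately show ?thesis using hom M(1) by (intro bexI[OF _ hom]) simp
  qed
  moreover have "finite W" using \<open>finite Y\<close> \<open>finite S\<close> by (simp add: W_def)
  ultimately obtain f where f: "f \<in> hom ?GK integer_group" "\<And>w. w \<in> W \<Longrightarrow> f w \<noteq> 0"
    using generic_hom[of W ?GK] by metis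
  have fK: "f (k \<otimes> x \<otimes> inv k) = f x" if "k \<in> K" "x \<in> K" for k x
  proof -
    interpret f: group_hom ?GK integer_group f using f(1) GK.is_group by (simp add: group_hom_def group_hom_axioms_def)
    have "f (k \<otimes> x \<otimes> inv k) = f k + f x - f k"
      using f.hom_mult[of "k \<otimes> x" "inv k"] f.hom_mult[of k x] f.hom_inv[of k] m_inv_consistent[OF sK] that
      by simp
    then show ?thesis by simp
  qed
  have f_ne: "f (inv g \<otimes> y [^] M \<otimes> g) \<noteq> 0" if y: "y \<in> Y" and g: "g \<in> carrier G" for y g
  proof -
    obtain s k where s: "s \<in> S" "k \<in> K" "s \<in> carrier G" "inv g = k \<otimes> s" using S[OF inv_closed[OF g]] by blast
    have k: "k \<in> carrier G" using s(2) by auto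
    have "g = inv s \<otimes> inv k" using s k g by (metis inv_inv inv_mult_group)
    then have "inv g \<otimes> y [^] M \<otimes> g = k \<otimes> (s \<otimes> y [^] M \<otimes> inv s) \<otimes> inv k"
      using s k Y(1)[OF y] by (simp only: s(4)) (simp add: m_assoc)
    then have "f (inv g \<otimes> y [^] M \<otimes> g) = f (s \<otimes> y [^] M \<otimes> inv s)"
      using fK[OF s(2) WK[OF y s(3)]] by simp
    moreover have "s \<otimes> y [^] M \<otimes> inv s \<in> W" using y s by (auto simp: W_def)
    ultimately show ?thesis using f(2) by simp
  qed
  obtain y where y: "y \<in> Y" using \<open>Y \<noteq> {}\<close> by blast
  have cK: "inv g \<otimes> y [^] M \<otimes> g \<in> K" if "y \<in> Y" "g \<in> carrier G" for y g
    using K.inv_op_closed1 M(2) Y(1) that by blast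
  have x0: "inv \<one> \<otimes> y [^] M \<otimes> \<one> \<in> carrier ?GK" "f (inv \<one> \<otimes> y [^] M \<otimes> \<one>) \<noteq> 0"
    using f_ne[OF y one_closed] cK[OF y one_closed] by simp_all
  obtain d f' t where f'': "f' \<in> hom ?GK integer_group" "t \<in> carrier ?GK" "f' t = 1"
    "\<And>x. x \<in> carrier ?GK \<Longrightarrow> f x = d * f' x"
    by (rule GK.primitive_hom[OF f(1) x0]) blast
  then have f': "f' \<in> hom ?GK integer_group" "t \<in> K" "f' t = 1" "\<And>x. x \<in> K \<Longrightarrow> f x = d * f' x"
    by simp_all
  have "f' (inv g \<otimes> y [^] M \<otimes> g) \<noteq> 0" if "y \<in> Y" "g \<in> carrier G" for y g
    using f_ne[OF that] f'(4)[OF cK[OF that]] by auto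
  then show thesis using that K M f' by blast
qed

end

section \<open>Extensions of the integers\<close>

text \<open>The powers of \<open>s\<close> split \<open>f\<close>, and \<phi> is their conjugation
  action on the kernel, transported along \<psi>.\<close>

lemma (in group) semidirect_kernel:
  fixes \<Lambda> :: "('l, 'n) monoid_scheme"
  assumes f: "f \<in> hom G integer_group" and s: "s \<in> carrier G" "f s = 1" and "group \<Lambda>"
    and \<psi>: "\<psi> \<in> iso \<Lambda> (G\<lparr>carrier := {x \<in> carrier G. f x = 0}\<rparr>)"
  obtains \<phi> where "\<phi> \<in> hom integer_group (AutoGroup \<Lambda>)" "G \<cong> semidirect_product \<Lambda> integer_group \<phi>"
proof -
  interpret L: group \<Lambda> by fact
  interpret f: group_hom G integer_group f using f by (simp add: group_hom_def group_hom_axioms_def is_group)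
  let ?N = "{x \<in> carrier G. f x = 0}"
  have \<psi>_bij: "bij_betw \<psi> (carrier \<Lambda>) ?N" using \<psi> by (simp add: iso_def)
  have \<psi>_mult: "\<psi> (a \<otimes>\<^bsub>\<Lambda>\<^esub> b) = \<psi> a \<otimes> \<psi> b" if "a \<in> carrier \<Lambda>" "b \<in> carrier \<Lambda>" for a b
    using \<psi> that by (auto simp: iso_def hom_def)
  have \<psi>_in: "\<psi> a \<in> carrier G" "f (\<psi> a) = 0" if "a \<in> carrier \<Lambda>" for a
    using bij_betwE[OF \<psi>_bij] that by auto
  have \<psi>_inj: "a = b" if "\<psi> a = \<psi> b" "a \<in> carrier \<Lambda>" "b \<in> carrier \<Lambda>" for a b
    using \<psi>_bij that by (auto simp: bij_betw_def inj_on_def)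
  have f_pow: "f (s [^] (k::int)) = k" for k using f.hom_int_pow[OF s(1), of k] s(2) by simp
  have pow_add: "s [^] (k + l) = s [^] k \<otimes> s [^] l" for k l :: int using s(1) by (simp add: int_pow_mult)
  \<comment> \<open>Restricted to the carrier because the elements of \<open>Bij\<close> are
    extensional.\<close>
  define \<phi> where "\<phi> k = (\<lambda>a\<in>carrier \<Lambda>. inv_into (carrier \<Lambda>) \<psi> (s [^] k \<otimes> (\<psi> a \<otimes> inv (s [^] k))))" for k :: int
  have \<phi>: "\<phi> k a \<in> carrier \<Lambda>" "\<psi> (\<phi> k a) = s [^] k \<otimes> (\<psi> a \<otimes> inv (s [^] k))" if "a \<in> carrier \<Lambda>" for k a
  proof -
    have "s [^] k \<otimes> (\<psi> a \<otimes> inv (s [^] k)) \<in> ?N"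
      using \<psi>_in[OF that] s(1) f_pow by simp
    then have N: "s [^] k \<otimes> (\<psi> a \<otimes> inv (s [^] k)) \<in> \<psi> ` carrier \<Lambda>" using \<psi>_bij by (simp add: bij_betw_def)
    show "\<phi> k a \<in> carrier \<Lambda>" using inv_into_into[OF N] that by (simp add: \<phi>_def)
    show "\<psi> (\<phi> k a) = s [^] k \<otimes> (\<psi> a \<otimes> inv (s [^] k))" using f_inv_into_f[OF N] that by (simp add: \<phi>_def)
  qed
  have \<phi>_mult: "\<phi> k (a \<otimes>\<^bsub>\<Lambda>\<^esub> b) = \<phi> k a \<otimes>\<^bsub>\<Lambda>\<^esub> \<phi> k b" if "a \<in> carrier \<Lambda>" "b \<in> carrier \<Lambda>" for k a b
    by (rule \<psi>_inj) (use that s(1) \<psi>_in in \<open>simp_all add: \<phi> \<psi>_mult m_assoc inv_cancel\<close>)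
  have \<phi>_add: "\<phi> (k + l) a = \<phi> k (\<phi> l a)" if "a \<in> carrier \<Lambda>" for k l a
    by (rule \<psi>_inj) (use that s(1) \<psi>_in in \<open>simp_all add: \<phi> pow_add m_assoc inv_mult_group\<close>)
  have \<phi>_0: "\<phi> 0 a = a" if "a \<in> carrier \<Lambda>" for a
    by (rule \<psi>_inj) (use that \<psi>_in in \<open>simp_all add: \<phi>\<close>)
  have "bij_betw (\<phi> k) (carrier \<Lambda>) (carrier \<Lambda>)" for k
    by (rule bij_betwI[where g = "\<phi> (- k)"]) (auto simp: \<phi> \<phi>_add[symmetric] \<phi>_0)
  then have Bij: "\<phi> k \<in> Bij (carrier \<Lambda>)" for k by (simp add: Bij_def) (simp add: \<phi>_def)
  have \<phi>_hom: "\<phi> \<in> hom integer_group (AutoGroup \<Lambda>)"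
  proof (rule homI)
    show "\<phi> k \<in> carrier (AutoGroup \<Lambda>)" for k
      using Bij \<phi>(1) \<phi>_mult by (auto simp: AutoGroup_def auto_def hom_def)
    show "\<phi> (k \<otimes>\<^bsub>integer_group\<^esub> l) = \<phi> k \<otimes>\<^bsub>AutoGroup \<Lambda>\<^esub> \<phi> l" for k l
    proof
      fix a
      show "\<phi> (k \<otimes>\<^bsub>integer_group\<^esub> l) a = (\<phi> k \<otimes>\<^bsub>AutoGroup \<Lambda>\<^esub> \<phi> l) a"
        using Bij \<phi>_add by (cases "a \<in> carrier \<Lambda>") (auto simp: AutoGroup_def BijGroup_def compose_def \<phi>_def)
    qed
  qed
  let ?S = "semidirect_product \<Lambda> integer_group \<phi>"
  interpret S: group ?S by (rule group_semidirect_product[OF \<open>group \<Lambda>\<close> group_integer_group \<phi>_hom])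
  let ?\<sigma> = "\<lambda>(a, k). \<psi> a \<otimes> s [^] k"
  have f_\<sigma>: "f (\<psi> a \<otimes> s [^] k) = k" if "a \<in> carrier \<Lambda>" for a and k :: int
    using \<psi>_in[OF that] s(1) f_pow by simp
  have "?\<sigma> \<in> iso ?S G"
  proof (rule isoI)
    show "?\<sigma> \<in> hom ?S G"
    proof (rule homI)
      fix x y assume "x \<in> carrier ?S" "y \<in> carrier ?S"
      then obtain a k b l where "x = (a, k)" "y = (b, l)" "a \<in> carrier \<Lambda>" "b \<in> carrier \<Lambda>"
        by (auto simp: semidirect_product_def)
      then show "?\<sigma> (x \<otimes>\<^bsub>?S\<^esub> y) = ?\<sigma> x \<otimes> ?\<sigma> y"
        using s(1) \<psi>_in by (simp add: semidirect_product_def \<psi>_mult \<phi> pow_add m_assoc inv_cancel)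
    qed (use \<psi>_in s(1) in \<open>auto simp: semidirect_product_def\<close>)
    show "bij_betw ?\<sigma> (carrier ?S) (carrier G)"
      unfolding bij_betw_def
    proof (intro conjI equalityI subsetI)
      show "inj_on ?\<sigma> (carrier ?S)"
      proof (rule inj_onI)
        fix x y assume xy: "x \<in> carrier ?S" "y \<in> carrier ?S" "?\<sigma> x = ?\<sigma> y"
        obtain a k b l where ab: "x = (a, k)" "y = (b, l)" by fastforce
        then have ab': "a \<in> carrier \<Lambda>" "b \<in> carrier \<Lambda>" "\<psi> a \<otimes> s [^] k = \<psi> b \<otimes> s [^] l"
          using xy by (auto simp: semidirect_product_def)
        have "k = l" using f_\<sigma>[OF ab'(1), of k] f_\<sigma>[OF ab'(2), of l] ab'(3) by metis
        then have "\<psi> a = \<psi> b" using ab' s(1) \<psi>_in by simp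
        then show "x = y" using \<psi>_inj ab' \<open>k = l\<close> by (simp add: ab)
      qed
      fix x assume x: "x \<in> carrier G"
      have "x \<otimes> inv (s [^] f x) \<in> ?N" using x s(1) f_pow by simp
      then obtain a where a: "a \<in> carrier \<Lambda>" "\<psi> a = x \<otimes> inv (s [^] f x)"
        using \<psi>_bij by (metis (no_types, lifting) bij_betw_def imageE)
      then have "x = ?\<sigma> (a, f x)" using x s(1) by (simp add: m_assoc)
      moreover have "(a, f x) \<in> carrier ?S" using a(1) by (simp add: semidirect_product_def)
      ultimately show "x \<in> ?\<sigma> ` carrier ?S" by (rule image_eqI)
    qed (use \<psi>_in s(1) in \<open>auto simp: semidirect_product_def\<close>)
  qed
  then have "G \<cong> ?S" using S.iso_sym is_isoI by blast
  then show thesis using that \<phi>_hom by blast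
qed

text \<open>\<open>B\<close> meets the first axis trivially, so \<open>snd\<close> embeds it in
  \<int>. An element with least positive second coordinate generates it.\<close>

lemma Z2_subgroup_cyclic:
  fixes B :: "(int \<times> int) set"
  assumes add: "\<And>x y. x \<in> B \<Longrightarrow> y \<in> B \<Longrightarrow> x + y \<in> B" and neg: "\<And>x. x \<in> B \<Longrightarrow> - x \<in> B"
    and x: "x \<in> B" "x \<noteq> 0" and axis: "\<And>k. (k, 0) \<in> B \<Longrightarrow> k = 0"
  obtains z where "z \<noteq> 0" "B = range (\<lambda>k. zscale k z)"
proof -
  have zero: "0 \<in> B" using add[OF x(1) neg[OF x(1)]] by simp
  have nat: "zscale (int n) y \<in> B" if "y \<in> B" for n y
    by (induction n) (use zero add[OF that, of "zscale _ y"] in \<open>auto simp: zscale_add add.commute\<close>)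
  have scale: "zscale k y \<in> B" if "y \<in> B" for k y
    using nat[OF that, of "nat k"] neg[OF nat[OF that, of "nat (- k)"]]
    by (cases "k \<ge> 0") (simp_all add: zscale_minus)
  have snd0: "y = 0" if "y \<in> B" "snd y = 0" for y
    using axis[of "fst y"] that by (cases y) (simp add: prod_eq_iff)
  let ?P = "\<lambda>n. n > 0 \<and> (\<exists>y\<in>B. snd y = int n)"
  have "snd x \<noteq> 0" using snd0 x by blast
  then have "?P (nat \<bar>snd x\<bar>)"
    using bexI[of "\<lambda>y. snd y = int (nat \<bar>snd x\<bar>)", OF _ x(1)]
      bexI[of "\<lambda>y. snd y = int (nat \<bar>snd x\<bar>)", OF _ neg[OF x(1)]] by (cases "snd x > 0") simp_all
  then have n: "?P (LEAST n. ?P n)" by (rule LeastI)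
  have least: "(LEAST n. ?P n) \<le> m" if "?P m" for m using that by (rule Least_le)
  define d where "d = int (LEAST n. ?P n)"
  then obtain z where z: "z \<in> B" "snd z = d" "d > 0" using n by auto
  have "y = zscale (snd y div d) z" if y: "y \<in> B" for y
  proof -
    let ?y = "y + - zscale (snd y div d) z"
    have B: "?y \<in> B" using add neg scale y z(1) by blast
    have snd: "snd ?y = snd y mod d" using z(2) by (simp add: minus_div_mult_eq_mod)
    have "snd y mod d = 0"
    proof (rule ccontr)
      assume "snd y mod d \<noteq> 0"
      moreover have "snd y mod d \<ge> 0" "snd y mod d < d" using z(3) by simp_all
      ultimately have "?P (nat (snd y mod d))" using B snd by (auto intro!: bexI[of _ ?y])
      from least[OF this] show False using \<open>snd y mod d < d\<close> \<open>snd y mod d \<ge> 0\<close> by (simp add: d_def)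
    qed
    then have "?y = 0" using snd0[OF B] snd by simp
    then show ?thesis by simp
  qed
  then have "B = range (\<lambda>k. zscale k z)" using scale[OF z(1)] by auto
  moreover have "z \<noteq> 0" using z by auto
  ultimately show thesis using that by blast
qed

section \<open>The kernel of a generic homomorphism to the integers\<close>

context tubular
begin

theorem VRC_free_by_cyclic:
  assumes vrc: "property_VRC H"
  obtains K n \<phi> where "K \<lhd> H" "finite (rcosets K)" "n \<ge> 1"
    "\<phi> \<in> hom integer_group (AutoGroup (free_group_of_rank n))"
    "H\<lparr>carrier := K\<rparr> \<cong> semidirect_product (free_group_of_rank n) integer_group \<phi>"
proof -
  \<comment> \<open>The edge generators make the edge groups act freely on \<Omega>. The vectors
    \<open>(1, 0)\<close> keep each vertex group from lying in the kernel, so that its stabilizers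
    have rank one; they also keep \<open>Y\<close> nonempty when there are no edges.\<close>
  define Y where "Y = (\<lambda>v. i v (1, 0)) ` verts G \<union> (\<lambda>e. i (tgt G e) (w_tgt e)) ` P"
  have YE: "\<exists>v x. v \<in> verts G \<and> x \<noteq> 0 \<and> y = i v x" if y: "y \<in> Y" for y
  proof -
    consider v where "v \<in> verts G" "y = i v (1, 0)" | e where "e \<in> P" "y = i (tgt G e) (w_tgt e)"
      using y unfolding Y_def by blast
    then show ?thesis
    proof cases
      case 1
      moreover have "(1, 0) \<noteq> (0 :: int \<times> int)" by (simp add: zero_prod_def)
      ultimately show ?thesis by blast
    next
      case 2
      then show ?thesis using w_nonzero(2) P_ends(2) by blast
    qed
  qed
  have Y_inf: "k = 0" if "y \<in> Y" "y [^] (k::int) = \<one>" for y k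
  proof -
    obtain v x where vx: "v \<in> verts G" "x \<noteq> 0" "y = i v x" using YE[OF \<open>y \<in> Y\<close>] by blast
    then have "i v (zscale k x) = \<one>" using Z2_hom_zscale[OF i_hom[OF vx(1)], of k x] \<open>y [^] k = \<one>\<close> by simp
    then show ?thesis using i_eq_one_iff[OF vx(1)] vx(2) by (simp add: zscale_eq_0_iff)
  qed
  have Yc: "y \<in> carrier H" if "y \<in> Y" for y using YE[OF that] i_closed by blast
  have Y_fin: "finite Y" "Y \<noteq> {}" using finite_verts finite_P root by (auto simp: Y_def)
  obtain K f s M where K: "K \<lhd> H" "finite (rcosets K)" and f: "f \<in> hom (H\<lparr>carrier := K\<rparr>) integer_group"
    and s: "s \<in> K" "f s = 1" and M: "(M::nat) > 0" "\<And>x. x \<in> carrier H \<Longrightarrow> x [^] M \<in> K"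
    and fY: "\<And>y g. y \<in> Y \<Longrightarrow> g \<in> carrier H \<Longrightarrow> f (inv g \<otimes> y [^] M \<otimes> g) \<noteq> 0"
    by (rule VRC_finite_set[OF vrc Y_fin Yc Y_inf]) blast+
  interpret K: normal K H by (rule K(1))
  have sK: "subgroup K H" by (rule K.subgroup_axioms)
  let ?HK = "H\<lparr>carrier := K\<rparr>"
  interpret HK: group ?HK by (rule subgroup.subgroup_is_group[OF sK is_group])
  interpret f: group_hom ?HK integer_group f using f HK.is_group by (simp add: group_hom_def group_hom_axioms_def)
  have f_mult: "f (x \<otimes> y) = f x + f y" if "x \<in> K" "y \<in> K" for x y using f.hom_mult[of x y] that by simp
  have f_inv: "f (inv x) = - f x" if "x \<in> K" for x
    using f.hom_inv[of x] m_inv_consistent[OF sK] that by simp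
  have pow_K: "x [^] (k::int) \<in> K" if "x \<in> K" for x k
    using HK.int_pow_closed[of x k] int_pow_consistent[OF sK that, of k] that by simp
  have f_pow: "f (x [^] (k::int)) = k * f x" if "x \<in> K" for x k
    using f.hom_int_pow[of x k] int_pow_consistent[OF sK that, of k] that by simp
  have f_one: "f \<one> = 0" using f.hom_one by simp
  define N where "N = {x \<in> K. f x = 0}"
  have N: "subgroup N H"
  proof (rule subgroupI)
    show "N \<noteq> {}" using f_one K.one_closed unfolding N_def by blast
  qed (use f_mult f_inv in \<open>auto simp: N_def\<close>)
  have MK: "x [^] (int M) \<in> K" if "x \<in> carrier H" for x using M(2)[OF that] by (simp add: int_pow_int)
  have conj_pow: "inv g \<otimes> y [^] (k::int) \<otimes> g = (inv g \<otimes> y \<otimes> g) [^] k" if "y \<in> carrier H" "g \<in> carrier H" for y g k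
    using int_pow_conjugate[of "inv g" y k] that by simp

  \<comment> \<open>\<Omega> will be the set of left cosets of \<open>N\<close>, and the stabilizer
    of the coset of \<open>g\<close> is \<open>N\<close> conjugated by \<open>g\<close>
    (\<open>act_fix\<close>).\<close>
  define act where "act g p = (\<lambda>x. g \<otimes> x) ` p" for g and p :: "'h set"
  define \<Omega> where "\<Omega> = (\<lambda>g. act g N) ` carrier H"
  have act_mult: "act (g \<otimes> h) p = act g (act h p)" if "g \<in> carrier H" "h \<in> carrier H" "p \<subseteq> carrier H" for g h p
    using that by (auto simp: act_def image_image m_assoc subset_iff intro!: image_cong)
  have N_sub: "N \<subseteq> carrier H" using subgroup.subset[OF N] .
  have act_sub: "act g p \<subseteq> carrier H" if "g \<in> carrier H" "p \<subseteq> carrier H" for g p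
    using that by (auto simp: act_def)
  have \<Omega>_sub: "p \<subseteq> carrier H" if "p \<in> \<Omega>" for p using that act_sub N_sub by (auto simp: \<Omega>_def)
  have act_N_eq: "act g N = act h N \<longleftrightarrow> inv h \<otimes> g \<in> N" if gh: "g \<in> carrier H" "h \<in> carrier H" for g h
  proof
    assume "act g N = act h N"
    moreover have "g \<in> act g N" using subgroup.one_closed[OF N] gh by (auto simp: act_def intro: image_eqI[of _ _ \<one>])
    ultimately obtain n where "n \<in> N" "g = h \<otimes> n" by (auto simp: act_def)
    then show "inv h \<otimes> g \<in> N" using gh N_sub by (auto simp: inv_cancel subset_iff)
  next
    assume n: "inv h \<otimes> g \<in> N"
    have "act (inv h \<otimes> g) N = N"
    proof
      show "act (inv h \<otimes> g) N \<subseteq> N" using n subgroup.m_closed[OF N] by (auto simp: act_def)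
      show "N \<subseteq> act (inv h \<otimes> g) N"
      proof
        fix x assume x: "x \<in> N"
        then have "inv (inv h \<otimes> g) \<otimes> x \<in> N" "x = (inv h \<otimes> g) \<otimes> (inv (inv h \<otimes> g) \<otimes> x)"
          using n subgroup.m_closed[OF N] subgroup.m_inv_closed[OF N] N_sub gh inv_cancel(2)[of "inv h \<otimes> g" x] by auto
        then show "x \<in> act (inv h \<otimes> g) N" unfolding act_def by blast
      qed
    qed
    then have "act h (act (inv h \<otimes> g) N) = act h N" by simp
    then show "act g N = act h N" using gh N_sub act_mult[of h "inv h \<otimes> g" N] by (simp add: inv_cancel)
  qed
  have act_fix: "act x (act g N) = act g N \<longleftrightarrow> inv g \<otimes> x \<otimes> g \<in> N" if "x \<in> carrier H" "g \<in> carrier H" for x g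
    using act_N_eq[of "x \<otimes> g" g] act_mult[OF that N_sub] that by (simp add: m_assoc)

  \<comment> \<open>\<open>y\<close> need not lie in \<open>K\<close>, so \<open>f\<close> is
    applied to the \<open>M\<close>-th power of the conjugate of \<open>y [^] k\<close>; its value
    is \<open>k\<close> times a nonzero integer.\<close>
  have power_N: "k = 0" if y: "y \<in> Y" and g: "g \<in> carrier H" and n: "inv g \<otimes> y [^] (k::int) \<otimes> g \<in> N" for y g k
  proof -
    let ?b = "inv g \<otimes> y \<otimes> g"
    have b: "?b \<in> carrier H" using Yc[OF y] g by simp
    have "f ((?b [^] k) [^] int M) = 0"
      using n conj_pow[OF Yc[OF y] g, of k] f_pow[of "?b [^] k" "int M"] by (simp add: N_def)
    moreover have "(?b [^] k) [^] int M = (?b [^] int M) [^] k" using b by (simp add: int_pow_pow mult.commute)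
    ultimately have "k * f (?b [^] int M) = 0" using f_pow[OF MK[OF b], of k] by simp
    moreover have "f (?b [^] int M) \<noteq> 0" using fY[OF y g] conj_pow[OF Yc[OF y] g, of "int M"] by (simp add: int_pow_int)
    ultimately show "k = 0" by simp
  qed

  \<comment> \<open>The powers of \<open>y\<close> alone have finitely many orbits on \<Omega>:
    there are finitely many cosets of \<open>K\<close>, \<open>f\<close> identifies
    \<open>K / N\<close> with \<int>, and a conjugate of \<open>y [^] M\<close> shifts this \<int>
    by a nonzero amount. \<open>F\<close> stands for any invariant of these orbits, so that vertex
    orbits, being unions of them, are covered as well.\<close>
  have finite_orbits: "finite (F ` \<Omega>)"
    if y: "y \<in> Y" and F: "\<And>(j::int) p. p \<in> \<Omega> \<Longrightarrow> F (act (y [^] j) p) = F p" for F :: "'h set \<Rightarrow> 'h set set" and y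
  proof -
    note yc = Yc[OF y]
    obtain S where "finite S" and S: "\<And>g. g \<in> carrier H \<Longrightarrow> \<exists>s\<in>S. \<exists>k\<in>K. s \<in> carrier H \<and> g = k \<otimes> s"
      using right_transversal[OF sK K(2)] by blast
    define d where "d g = f (g \<otimes> y [^] M \<otimes> inv g)" for g
    let ?R = "\<Union>g\<in>S. (\<lambda>m. F (act (inv g \<otimes> s [^] m) N)) ` {- \<bar>d g\<bar> .. \<bar>d g\<bar>}"
    have "F p \<in> ?R" if "p \<in> \<Omega>" for p
    proof -
      obtain h where h: "h \<in> carrier H" "p = act h N" using \<open>p \<in> \<Omega>\<close> by (auto simp: \<Omega>_def)
      obtain g k where g: "g \<in> S" "k \<in> K" "g \<in> carrier H" "inv h = k \<otimes> g" using S[OF inv_closed[OF h(1)]] by blast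
      have k: "k \<in> carrier H" "s \<in> carrier H" using g(2) s(1) by auto
      define u where "u = g \<otimes> y [^] int M \<otimes> inv g"
      have u: "u \<in> K" "f u = d g" "d g \<noteq> 0"
        using K.inv_op_closed2[OF g(3) MK[OF yc]] fY[OF y inv_closed[OF g(3)]] g(3)
        by (auto simp: u_def d_def int_pow_int)
      \<comment> \<open>Division with remainder makes the value of \<open>f\<close> on
        \<open>k \<otimes> (u [^] j \<otimes> s [^] m)\<close> vanish. The sign of
        \<open>d g\<close> is unknown, hence the symmetric range for \<open>m\<close>.\<close>
      define j m where "j = (- f k) div d g" and "m = (- f k) mod d g"
      have m: "m \<in> {- \<bar>d g\<bar> .. \<bar>d g\<bar>}"
        using u(3) abs_mod_less[of "d g" "- f k"] by (auto simp: m_def abs_le_iff simp del: abs_mod_less)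
      have uj: "g \<otimes> y [^] (int M * j) \<otimes> inv g = u [^] j"
        using g(3) yc int_pow_conjugate[of g "y [^] int M" j] by (simp add: u_def int_pow_pow)
      have "k \<otimes> g \<otimes> (y [^] (int M * j) \<otimes> (inv g \<otimes> s [^] m)) =
          k \<otimes> ((g \<otimes> y [^] (int M * j) \<otimes> inv g) \<otimes> s [^] m)"
        using g(3) k yc by (simp add: m_assoc)
      then have "inv h \<otimes> (y [^] (int M * j) \<otimes> (inv g \<otimes> s [^] m)) = k \<otimes> (u [^] j \<otimes> s [^] m)"
        unfolding uj g(4) .
      moreover have "f (k \<otimes> (u [^] j \<otimes> s [^] m)) = 0"
      proof -
        have "f (k \<otimes> (u [^] j \<otimes> s [^] m)) = f k + (j * d g + m)"
          using g(2) u s pow_K by (simp add: f_mult f_pow)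
        moreover have "j * d g + m = - f k" unfolding j_def m_def by (rule div_mult_mod_eq)
        ultimately show ?thesis by simp
      qed
      moreover have "k \<otimes> (u [^] j \<otimes> s [^] m) \<in> K" using g(2) pow_K u(1) s(1) by simp
      ultimately have "inv h \<otimes> (y [^] (int M * j) \<otimes> (inv g \<otimes> s [^] m)) \<in> N" by (simp add: N_def)
      then have "act (y [^] (int M * j) \<otimes> (inv g \<otimes> s [^] m)) N = p"
        using act_N_eq[of "y [^] (int M * j) \<otimes> (inv g \<otimes> s [^] m)" h] h g(3) k yc by simp
      then have "act (y [^] (int M * j)) (act (inv g \<otimes> s [^] m) N) = p"
        using act_mult[of "y [^] (int M * j)" "inv g \<otimes> s [^] m" N] g(3) k yc N_sub by simp
      moreover have "act (inv g \<otimes> s [^] m) N \<in> \<Omega>" using g(3) k by (auto simp: \<Omega>_def)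
      ultimately have "F p = F (act (inv g \<otimes> s [^] m) N)" using F by metis
      then show ?thesis using g(1) m by blast
    qed
    then have "F ` \<Omega> \<subseteq> ?R" by blast
    moreover have "finite ?R" using \<open>finite S\<close> by simp
    ultimately show ?thesis by (rule finite_subset)
  qed

  interpret A: tubular_action H G T P \<Theta> \<Omega> act N
  proof
    show "act g p \<in> \<Omega>" if "g \<in> carrier H" "p \<in> \<Omega>" for g p
    proof -
      obtain h where "h \<in> carrier H" "p = act h N" using \<open>p \<in> \<Omega>\<close> by (auto simp: \<Omega>_def)
      then show ?thesis using act_mult[of g h N] N_sub \<open>g \<in> carrier H\<close> by (auto simp: \<Omega>_def intro!: image_eqI[of _ _ "g \<otimes> h"])
    qed
    have one: "act \<one> p = p" if "p \<subseteq> carrier H" for p using that by (force simp: act_def)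
    show "act \<one> p = p" if "p \<in> \<Omega>" for p using one \<Omega>_sub[OF that] .
    show "act (g \<otimes> h) p = act g (act h p)" if "g \<in> carrier H" "h \<in> carrier H" "p \<in> \<Omega>" for g h p
      using act_mult that \<Omega>_sub by blast
    show "N \<in> \<Omega>" using one[OF N_sub] by (auto simp: \<Omega>_def intro!: image_eqI[of _ _ \<one>])
    show "\<exists>g\<in>carrier H. act g N = p" if "p \<in> \<Omega>" for p using that by (auto simp: \<Omega>_def)
    show "k = 0" if e: "e \<in> P" and p: "p \<in> \<Omega>" and eq: "act (i (tgt G e) (zscale k (w_tgt e))) p = p" for e k p
    proof -
      obtain g where g: "g \<in> carrier H" "p = act g N" using p by (auto simp: \<Omega>_def)
      have "inv g \<otimes> i (tgt G e) (zscale k (w_tgt e)) \<otimes> g \<in> N"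
        using eq act_fix[OF i_closed[OF P_ends(2)[OF e]] g(1)] unfolding g(2) by blast
      then have "inv g \<otimes> i (tgt G e) (w_tgt e) [^] k \<otimes> g \<in> N"
        unfolding Z2_hom_zscale[OF i_hom[OF P_ends(2)[OF e]]] .
      moreover have "i (tgt G e) (w_tgt e) \<in> Y" using e by (auto simp: Y_def)
      ultimately show ?thesis using power_N g(1) by blast
    qed
    show "\<exists>z. z \<noteq> 0 \<and> {x. act (i v x) p = p} = range (\<lambda>k. zscale k z)" if v: "v \<in> verts G" and p: "p \<in> \<Omega>" for v p
    proof -
      obtain g where g: "g \<in> carrier H" "p = act g N" using p by (auto simp: \<Omega>_def)
      define j where "j x = inv g \<otimes> i v x \<otimes> g" for x
      have j: "Z2_hom H j"
        unfolding Z2_hom_def j_def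
        using i_closed[OF v] g(1) Z2_hom_add[OF i_hom[OF v]] by (simp add: m_assoc inv_cancel)
      have fix_iff: "act (i v x) p = p \<longleftrightarrow> j x \<in> N" for x
        using act_fix[OF i_closed[OF v] g(1)] g(2) by (simp add: j_def)
      have yY: "i v (1, 0) \<in> Y" using v by (auto simp: Y_def)
      let ?u = "\<lambda>x. j (zscale (int M) x)"
      have uK: "?u x \<in> K" for x using Z2_hom_zscale[OF j] MK[OF Z2_hom_closed[OF j]] by simp
      define a b where "a = f (?u (1, 0))" and "b = f (?u (0, 1))"
      \<comment> \<open>The combination of \<open>M\<close> times the basis vectors on which the
        values \<open>a\<close> and \<open>b\<close> cancel. As \<open>a\<close> is nonzero, so is
        \<open>x\<close>, and the stabilizer is not trivial.\<close>
      define x where "x = zscale b (zscale (int M) (1, 0)) + zscale (- a) (zscale (int M) (0, 1))"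
      have "j x = ?u (1, 0) [^] b \<otimes> ?u (0, 1) [^] (- a)"
        unfolding x_def Z2_hom_add[OF j] Z2_hom_zscale[OF j, of b] Z2_hom_zscale[OF j, of "- a"] ..
      then have "j x \<in> N" using uK pow_K by (simp add: N_def f_mult f_pow a_def b_def)
      have "?u (1, 0) = inv g \<otimes> i v (1, 0) [^] M \<otimes> g"
        using Z2_hom_zscale[OF i_hom[OF v], of "int M" "(1, 0)"] by (simp add: j_def int_pow_int)
      then have "a \<noteq> 0" using fY[OF yY g(1)] by (simp add: a_def)
      then have "x \<noteq> 0" using M(1) by (simp add: x_def prod_eq_iff)
      have "k = 0" if "j (k, 0) \<in> N" for k
      proof -
        have "i v (k, 0) = i v (1, 0) [^] k"
          using Z2_hom_zscale[OF i_hom[OF v], of k "(1, 0)"] by (simp add: zscale_def)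
        then show ?thesis using power_N[OF yY g(1), of k] that by (simp add: j_def)
      qed
      moreover have "j (x + y) \<in> N" if "j x \<in> N" "j y \<in> N" for x y
        using that subgroup.m_closed[OF N] by (simp add: Z2_hom_add[OF j])
      moreover have "j (- x) \<in> N" if "j x \<in> N" for x
        using that subgroup.m_inv_closed[OF N] by (simp add: Z2_hom_uminus[OF j])
      ultimately obtain z where "z \<noteq> 0" "{x. j x \<in> N} = range (\<lambda>k. zscale k z)"
        using Z2_subgroup_cyclic[of "{x. j x \<in> N}" x] \<open>j x \<in> N\<close> \<open>x \<noteq> 0\<close> by (metis mem_Collect_eq)
      then show ?thesis unfolding fix_iff by blast
    qed
    show "finite ((\<lambda>p. range (\<lambda>x. act (i v x) p)) ` \<Omega>)" if v: "v \<in> verts G" for v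
    proof (rule finite_orbits)
      show "i v (1, 0) \<in> Y" using v by (auto simp: Y_def)
      fix j :: int and p assume p: "p \<in> \<Omega>"
      have "act (i v x) (act (i v (1, 0) [^] j) p) = act (i v (x + zscale j (1, 0))) p" for x
        using act_mult[OF i_closed[OF v] i_closed[OF v] \<Omega>_sub[OF p]]
        by (simp only: Z2_hom_zscale[OF i_hom[OF v], symmetric] Z2_hom_add[OF i_hom[OF v]])
      then have "range (\<lambda>x. act (i v x) (act (i v (1, 0) [^] j) p)) = range (\<lambda>x. act (i v (x + zscale j (1, 0))) p)"
        by (simp only:)
      also have "\<dots> = (\<lambda>x. act (i v x) p) ` range (\<lambda>x. x + zscale j (1, 0))" by (rule image_image[symmetric])
      also have "range (\<lambda>x. x + zscale j (1, 0)) = UNIV" by (rule surjI[of _ "\<lambda>x. x - zscale j (1, 0)"]) simp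
      finally show "range (\<lambda>x. act (i v x) (act (i v (1, 0) [^] j) p)) = range (\<lambda>x. act (i v x) p)" .
    qed
    show "finite ((\<lambda>p. range (\<lambda>k. act (i (tgt G e) (zscale k (w_tgt e))) p)) ` \<Omega>)" if e: "e \<in> P" for e
    proof (rule finite_orbits)
      let ?v = "tgt G e" and ?w = "w_tgt e"
      note v = P_ends(2)[OF e]
      show "i ?v ?w \<in> Y" using e by (auto simp: Y_def)
      fix j :: int and p assume p: "p \<in> \<Omega>"
      have "act (i ?v (zscale k ?w)) (act (i ?v ?w [^] j) p) = act (i ?v (zscale (k + j) ?w)) p" for k
        using act_mult[OF i_closed[OF v] i_closed[OF v] \<Omega>_sub[OF p]]
        by (simp only: Z2_hom_zscale[OF i_hom[OF v], symmetric] Z2_hom_add[OF i_hom[OF v]] zscale_add)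
      then have "range (\<lambda>k. act (i ?v (zscale k ?w)) (act (i ?v ?w [^] j) p)) = range (\<lambda>k. act (i ?v (zscale (k + j) ?w)) p)"
        by (simp only:)
      also have "\<dots> = (\<lambda>k. act (i ?v (zscale k ?w)) p) ` range (\<lambda>k. k + j)" by (rule image_image[symmetric])
      also have "range (\<lambda>k. k + j) = UNIV" by (rule surjI[of _ "\<lambda>k. k - j"]) simp
      finally show "range (\<lambda>k. act (i ?v (zscale k ?w)) (act (i ?v ?w [^] j) p)) = range (\<lambda>k. act (i ?v (zscale k ?w)) p)" .
    qed
  qed
  have "A.fixer = N"
  proof -
    have "act h N = N \<longleftrightarrow> h \<in> N" if "h \<in> carrier H" for h
      using act_fix[OF that one_closed] A.act_one[OF A.p0] that by simp
    then show ?thesis using N_sub by (auto simp: A.fixer_def)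
  qed
  then obtain n \<psi> where n: "n \<ge> 1" "\<psi> \<in> iso (free_group_of_rank n) (H\<lparr>carrier := N\<rparr>)"
    using A.fixer_free by metis
  have "H\<lparr>carrier := N\<rparr> = ?HK\<lparr>carrier := {x \<in> carrier ?HK. f x = 0}\<rparr>" by (simp add: N_def)
  then have \<psi>: "\<psi> \<in> iso (free_group_of_rank n) (?HK\<lparr>carrier := {x \<in> carrier ?HK. f x = 0}\<rparr>)" using n(2) by simp
  have "group (free_group_of_rank n)" unfolding free_group_of_rank_def by (rule group_presented_group)
  then obtain \<phi> where "\<phi> \<in> hom integer_group (AutoGroup (free_group_of_rank n))"
    "?HK \<cong> semidirect_product (free_group_of_rank n) integer_group \<phi>"
    using HK.semidirect_kernel[OF f _ s(2) _ \<psi>] s(1) by auto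
  then show thesis using that K n(1) by blast
qed

end

theorem proposition12p3:
  fixes H :: "('h, 'm) monoid_scheme"
    and \<G> :: "('v, 'e, 'g, 'c) graph_of_groups"
  assumes "tubular_group_via \<G> H"
    and "property_VRC H"
  shows "\<exists>G n \<phi>. G \<lhd> H \<and> finite (rcosets\<^bsub>H\<^esub> G) \<and> n \<ge> 1 \<and>
    \<phi> \<in> hom integer_group (AutoGroup (free_group_of_rank n)) \<and>
    H\<lparr>carrier := G\<rparr> \<cong> semidirect_product (free_group_of_rank n) integer_group \<phi>"
proof -
  obtain T P \<Theta> where "group H" "tubular_graph_of_groups \<G>" "maximal_tree T \<G>" "orientation P \<G>"
    "\<Theta> \<in> iso H (fundamental_group \<G> T P)"
    using assms(1) by (auto simp: tubular_group_via_def is_iso_def)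
  then interpret tubular H \<G> T P \<Theta>
    by (simp add: tubular_def tubular_axioms_def)
  show ?thesis
    using VRC_free_by_cyclic[OF assms(2)] by blast
qed

end
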